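(* Let $(\mathbf N,\mathbf g)$ be an $(n+1)$-dimensional connected $C^2$ Lorentzian spacetime, possibly with boundary, that is asymptotically flat in the sense that a subset of $\mathbf N$ is diffeomorphic to $\mathbb R\times(\mathbb R^n\setminus\bar B_1(0))$, and in these coordinates $x^0,\ldots,x^n$, $$\mathbf g_{\mu\nu}(x^0,x)=\eta_{\mu\nu}+O_2(|x|^{-\beta})$$ for some $\beta>0$, where $\eta_{\mu\nu}$ is the standard Minkowski metric and $|x|$ denotes the norm of the spatial coordinates $x=(x^1,\ldots,x^n)$ only. Assume that $(\mathbf N,\mathbf g)$ is equipped with Killing fields $\mathbf Y_0,\ldots,\mathbf Y_n$ (defined on all of $\mathbf N$) that are asymptotic to the coordinate translation directions in the sense that $$\mathbf Y_\mu=\frac{\partial}{\partial x^\mu}+O_2(|x|^{-\beta}),\qquad \mu=0,\ldots,n.$$ Then $\mathbf Y_0,\ldots,\mathbf Y_n$ form a covariant constant global Lorentzian orthonormal frame on $\mathbf N$, and in particular $\mathbf g$ must be flat.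
   Context: The $O_2$ notation for the metric means that there exists a constant $C>0$ such that $$\sum_{|I|=0}^2\Big||x|^{\beta+|I|}\,\partial^I(\mathbf g_{\mu\nu}-\eta_{\mu\nu})(x^0,x)\Big|\le C$$ on $\mathbb R\times(\mathbb R^n\setminus\bar B_1(0))$, where $\partial^I$ denotes partial derivatives with respect to all $n+1$ coordinates; the meaning for vector fields is the same, applied to coordinate components. No completeness or curvature assumption is made on $(\mathbf N,\mathbf g)$. "Lorentzian orthonormal frame" means $\mathbf g(\mathbf Y_\mu,\mathbf Y_\nu)=\eta_{\mu\nu}$ with $\eta=\mathrm{diag}(-1,1,\ldots,1)$; "covariant constant" means $\nabla\mathbf Y_\mu=0$ for the Levi-Civita connection of $\mathbf g$. *)

theory Defs
  imports "HOL-Analysis.Analysis"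
begin

section \<open>Differentiation on coordinate domains\<close>

text \<open>
  A coordinate domain \<open>S\<close> is open in \<open>\<real>\<^sup>N\<close> or relatively open in a closed half-space.
  In both cases the derivative at a point \<^emph>\<open>within\<close> \<open>S\<close> is unique, so that \<open>frechet_derivative\<close>
  below is the usual derivative, one-sided at boundary points.
\<close>

definition partial ::
    "(real^'i) set \<Rightarrow> 'i::finite \<Rightarrow> (real^'i \<Rightarrow> 'b::real_normed_vector) \<Rightarrow> real^'i \<Rightarrow> 'b" where
  "partial S i f x = frechet_derivative f (at x within S) (axis i 1)"

primrec C_on :: "nat \<Rightarrow> (real^'i::finite) set \<Rightarrow> (real^'i \<Rightarrow> 'b::real_normed_vector) \<Rightarrow> bool" where
  "C_on 0 S f \<longleftrightarrow> continuous_on S f"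
| "C_on (Suc k) S f \<longleftrightarrow> f differentiable_on S \<and> (\<forall>i. C_on k S (partial S i f))"


section \<open>Manifolds with boundary\<close>

text \<open>
  The underlying space of the manifold is a whole type \<open>'m\<close>. A chart is a pair \<open>(U, \<phi>)\<close>;
  the values of \<open>\<phi>\<close> off \<open>U\<close> are irrelevant.
\<close>

type_synonym ('m, 'i) chart = "'m set \<times> ('m \<Rightarrow> real^'i)"

definition image_of :: "('m, 'i::finite) chart \<Rightarrow> (real^'i) set" where
  "image_of c = snd c ` fst c"

definition point_at :: "('m, 'i::finite) chart \<Rightarrow> real^'i \<Rightarrow> 'm" where
  "point_at c = inv_into (fst c) (snd c)"

definition half_space :: "'i::finite \<Rightarrow> (real^'i) set" where
  "half_space k = {x. 0 \<le> x $ k}"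

definition is_chart :: "('m::topological_space, 'i::finite) chart \<Rightarrow> bool" where
  "is_chart c \<longleftrightarrow>
     open (fst c) \<and>
     (open (image_of c) \<or> (\<exists>k. openin (top_of_set (half_space k)) (image_of c))) \<and>
     homeomorphism (fst c) (image_of c) (snd c) (point_at c)"

definition overlap :: "('m, 'i::finite) chart \<Rightarrow> ('m, 'i) chart \<Rightarrow> (real^'i) set" where
  "overlap c d = snd c ` (fst c \<inter> fst d)"

definition transition :: "('m, 'i::finite) chart \<Rightarrow> ('m, 'i) chart \<Rightarrow> real^'i \<Rightarrow> real^'i" where
  "transition c d = snd d \<circ> point_at c"

definition compatible :: "('m, 'i::finite) chart \<Rightarrow> ('m, 'i) chart \<Rightarrow> bool" where
  "compatible c d \<longleftrightarrow>
     C_on 3 (overlap c d) (transition c d) \<and> C_on 3 (overlap d c) (transition d c)"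

text \<open>
  A maximal \<open>C\<^sup>3\<close> atlas: \<open>C\<^sup>3\<close> is the least regularity for which the notion of a \<open>C\<^sup>2\<close> metric
  is independent of the chart. By maximality, the members of the atlas with image \<open>V\<close> are exactly
  the diffeomorphisms from open subsets of the manifold onto \<open>V\<close>.
\<close>

definition manifold_structure :: "('m::topological_space, 'i::finite) chart set \<Rightarrow> bool" where
  "manifold_structure A \<longleftrightarrow>
     (\<forall>c\<in>A. is_chart c) \<and>
     (\<Union>c\<in>A. fst c) = UNIV \<and>
     (\<forall>c\<in>A. \<forall>d\<in>A. compatible c d) \<and>
     (\<forall>c. is_chart c \<and> (\<forall>d\<in>A. compatible c d) \<longrightarrow> c \<in> A)"


section \<open>Tensor fields\<close>

text \<open>
  A tensor field is given by its components in every chart, as functions of the coordinates,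
  subject to the transformation law.
\<close>

type_synonym ('m, 'i) vector_field = "('m, 'i) chart \<Rightarrow> real^'i \<Rightarrow> real^'i"
type_synonym ('m, 'i) bilinear_field = "('m, 'i) chart \<Rightarrow> real^'i \<Rightarrow> real^'i^'i"

definition jacobian :: "('m, 'i::finite) chart \<Rightarrow> ('m, 'i) chart \<Rightarrow> real^'i \<Rightarrow> real^'i^'i" where
  "jacobian c d x = (\<chi> i j. partial (overlap c d) j (transition c d) x $ i)"

definition vector_field_on ::
    "nat \<Rightarrow> ('m, 'i::finite) chart set \<Rightarrow> ('m, 'i) vector_field \<Rightarrow> bool" where
  "vector_field_on k A X \<longleftrightarrow>
     (\<forall>c\<in>A. C_on k (image_of c) (X c)) \<and>
     (\<forall>c\<in>A. \<forall>d\<in>A. \<forall>x\<in>overlap c d. X d (transition c d x) = jacobian c d x *v X c x)"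

definition bilinear_field_on ::
    "nat \<Rightarrow> ('m, 'i::finite) chart set \<Rightarrow> ('m, 'i) bilinear_field \<Rightarrow> bool" where
  "bilinear_field_on k A g \<longleftrightarrow>
     (\<forall>c\<in>A. C_on k (image_of c) (g c)) \<and>
     (\<forall>c\<in>A. \<forall>d\<in>A. \<forall>x\<in>overlap c d.
        g c x = transpose (jacobian c d x) ** g d (transition c d x) ** jacobian c d x)"


section \<open>Lorentzian geometry\<close>

text \<open>
  The \<open>n + 1\<close> coordinate indices are the elements of \<open>'n option\<close>, where \<open>n = CARD('n)\<close>: the time
  index \<open>0\<close> is \<open>None\<close>, the spatial indices \<open>1, \<dots>, n\<close> are the \<open>Some i\<close>.
\<close>

definition eta :: "'n option \<Rightarrow> 'n option \<Rightarrow> real" where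
  "eta \<mu> \<nu> = (if \<mu> \<noteq> \<nu> then 0 else if \<mu> = None then - 1 else 1)"

text \<open>The signature condition says that every tangent space has a Lorentzian orthonormal basis,
  the columns of \<open>P\<close>.\<close>

definition lorentzian_metric ::
    "nat \<Rightarrow> ('m, 'n::finite option) chart set \<Rightarrow> ('m, 'n option) bilinear_field \<Rightarrow> bool" where
  "lorentzian_metric k A g \<longleftrightarrow>
     bilinear_field_on k A g \<and>
     (\<forall>c\<in>A. \<forall>x\<in>image_of c.
        transpose (g c x) = g c x \<and>
        (\<exists>P :: real^('n option)^('n option). invertible P \<and> transpose P ** g c x ** P = (\<chi> \<mu> \<nu>. eta \<mu> \<nu>)))"

definition inner_at ::
    "('m, 'i::finite) bilinear_field \<Rightarrow> ('m, 'i) chart \<Rightarrow> real^'i \<Rightarrow> real^'i \<Rightarrow> real^'i \<Rightarrow> real" where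
  "inner_at g c x v w = (\<Sum>i\<in>UNIV. \<Sum>j\<in>UNIV. g c x $ i $ j * v $ i * w $ j)"

text \<open>Christoffel symbols \<open>\<Gamma>\<^sup>k\<^sub>i\<^sub>j\<close> of the Levi-Civita connection.\<close>

definition christoffel ::
    "('m, 'i::finite) bilinear_field \<Rightarrow> ('m, 'i) chart \<Rightarrow> 'i \<Rightarrow> 'i \<Rightarrow> 'i \<Rightarrow> real^'i \<Rightarrow> real" where
  "christoffel g c k i j x =
     (\<Sum>l\<in>UNIV. matrix_inv (g c x) $ k $ l *
        (partial (image_of c) i (\<lambda>y. g c y $ j $ l) x
         + partial (image_of c) j (\<lambda>y. g c y $ i $ l) x
         - partial (image_of c) l (\<lambda>y. g c y $ i $ j) x)) / 2"

text \<open>\<open>(\<nabla>\<^sub>i X)\<^sup>k\<close>\<close>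

definition covariant_derivative ::
    "('m, 'i::finite) bilinear_field \<Rightarrow> ('m, 'i) vector_field \<Rightarrow> ('m, 'i) chart \<Rightarrow>
       'i \<Rightarrow> 'i \<Rightarrow> real^'i \<Rightarrow> real" where
  "covariant_derivative g X c i k x =
     partial (image_of c) i (\<lambda>y. X c y $ k) x
     + (\<Sum>j\<in>UNIV. christoffel g c k i j x * X c x $ j)"

definition covariant_constant ::
    "('m, 'i::finite) chart set \<Rightarrow> ('m, 'i) bilinear_field \<Rightarrow> ('m, 'i) vector_field \<Rightarrow> bool" where
  "covariant_constant A g X \<longleftrightarrow>
     (\<forall>c\<in>A. \<forall>x\<in>image_of c. \<forall>i k. covariant_derivative g X c i k x = 0)"

text \<open>\<open>(\<L>\<^sub>X g)\<^sub>i\<^sub>j\<close>\<close>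

definition lie_derivative ::
    "('m, 'i::finite) vector_field \<Rightarrow> ('m, 'i) bilinear_field \<Rightarrow> ('m, 'i) chart \<Rightarrow>
       'i \<Rightarrow> 'i \<Rightarrow> real^'i \<Rightarrow> real" where
  "lie_derivative X g c i j x =
     (\<Sum>k\<in>UNIV. X c x $ k * partial (image_of c) k (\<lambda>y. g c y $ i $ j) x
        + g c x $ k $ j * partial (image_of c) i (\<lambda>y. X c y $ k) x
        + g c x $ i $ k * partial (image_of c) j (\<lambda>y. X c y $ k) x)"

definition killing_field ::
    "('m, 'i::finite) chart set \<Rightarrow> ('m, 'i) bilinear_field \<Rightarrow> ('m, 'i) vector_field \<Rightarrow> bool" where
  "killing_field A g X \<longleftrightarrow>
     vector_field_on 1 A X \<and>
     (\<forall>c\<in>A. \<forall>x\<in>image_of c. \<forall>i j. lie_derivative X g c i j x = 0)"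

text \<open>\<open>R\<^sup>l\<^sub>k\<^sub>i\<^sub>j\<close>, the components of \<open>R(\<partial>\<^sub>i, \<partial>\<^sub>j)\<partial>\<^sub>k\<close>\<close>

definition riemann ::
    "('m, 'i::finite) bilinear_field \<Rightarrow> ('m, 'i) chart \<Rightarrow>
       'i \<Rightarrow> 'i \<Rightarrow> 'i \<Rightarrow> 'i \<Rightarrow> real^'i \<Rightarrow> real" where
  "riemann g c l k i j x =
     partial (image_of c) i (christoffel g c l j k) x
     - partial (image_of c) j (christoffel g c l i k) x
     + (\<Sum>m\<in>UNIV. christoffel g c l i m x * christoffel g c m j k x
                  - christoffel g c l j m x * christoffel g c m i k x)"

definition flat :: "('m, 'i::finite) chart set \<Rightarrow> ('m, 'i) bilinear_field \<Rightarrow> bool" where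
  "flat A g \<longleftrightarrow> (\<forall>c\<in>A. \<forall>x\<in>image_of c. \<forall>l k i j. riemann g c l k i j x = 0)"

definition lorentzian_orthonormal_frame ::
    "('m, 'n::finite option) chart set \<Rightarrow> ('m, 'n option) bilinear_field \<Rightarrow>
       ('n option \<Rightarrow> ('m, 'n option) vector_field) \<Rightarrow> bool" where
  "lorentzian_orthonormal_frame A g Y \<longleftrightarrow>
     (\<forall>c\<in>A. \<forall>x\<in>image_of c. \<forall>\<mu> \<nu>. inner_at g c x (Y \<mu> c x) (Y \<nu> c x) = eta \<mu> \<nu>)"


section \<open>Asymptotics\<close>

definition spatial :: "real^('n::finite option) \<Rightarrow> real^'n" where
  "spatial x = (\<chi> i. x $ Some i)"

text \<open>\<open>\<real> \<times> (\<real>\<^sup>n - B)\<close> with \<open>B\<close> the closed unit ball\<close>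

definition exterior :: "(real^('n::finite option)) set" where
  "exterior = {x. 1 < norm (spatial x)}"

text \<open>
  \<open>f = O\<^sub>2(|x|\<^sup>-\<^sup>\<beta>)\<close>. The multi-index \<open>I\<close> is written as the list of the indices
  with respect to which one differentiates, so \<open>|I|\<close> is its length; a mixed second derivative is
  thus counted once for each order, which affects only the constant.
\<close>

definition O2 :: "real \<Rightarrow> (real^('n::finite option) \<Rightarrow> real) \<Rightarrow> bool" where
  "O2 \<beta> f \<longleftrightarrow>
     C_on 2 exterior f \<and>
     (\<exists>C>0. \<forall>x\<in>exterior.
        (\<Sum>I | length I \<le> 2.
           \<bar>norm (spatial x) powr (\<beta> + real (length I)) * foldr (partial exterior) I f x\<bar>) \<le> C)"

text \<open>The sum in the preceding definition is a genuine one:\<close>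

lemma finite_multi_indices: "finite {I :: 'i::finite list. length I \<le> k}"
  using finite_lists_length_le[of "UNIV :: 'i set" k] by simp

text \<open>\<open>e\<close> is the system of asymptotic coordinates on the end.\<close>

definition asymptotically_flat ::
    "real \<Rightarrow> ('m, 'n::finite option) chart set \<Rightarrow> ('m, 'n option) bilinear_field \<Rightarrow>
       ('m, 'n option) chart \<Rightarrow> bool" where
  "asymptotically_flat \<beta> A g e \<longleftrightarrow>
     e \<in> A \<and> image_of e = exterior \<and> (\<forall>\<mu> \<nu>. O2 \<beta> (\<lambda>x. g e x $ \<mu> $ \<nu> - eta \<mu> \<nu>))"

definition asymptotic_to_translations ::
    "real \<Rightarrow> ('m, 'n::finite option) chart \<Rightarrow>
       ('n option \<Rightarrow> ('m, 'n option) vector_field) \<Rightarrow> bool" where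
  "asymptotic_to_translations \<beta> e Y \<longleftrightarrow>
     (\<forall>\<mu> \<nu>. O2 \<beta> (\<lambda>x. Y \<mu> e x $ \<nu> - axis \<mu> 1 $ \<nu>))"

end

theory Submission
  imports Defs
begin

text \<open>
  The component \<open>g(X, \<gamma>')\<close> of a Killing field \<open>X\<close> along a coordinate line \<open>\<gamma>\<close> has a derivative which
  involves first derivatives of \<open>g\<close> but none of \<open>X\<close>. Integrated along lines in a spanning set of
  directions this yields two facts for \<open>C\<^sup>1\<close> Killing fields: one that tends to zero at infinity vanishes
  for large \<open>|x|\<close>, and one that vanishes on an open set vanishes on the connected coordinate patch.

  Both are applied to the commutators \<open>[Y\<^sub>\<mu>, Y\<^sub>\<nu>]\<close>, which are \<open>C\<^sup>1\<close> Killing fields because a \<open>C\<^sup>1\<close> Killing field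
  of a \<open>C\<^sup>2\<close> metric is \<open>C\<^sup>2\<close>. Near infinity they decay, so the fields commute there; then the products
  \<open>g(Y\<^sub>\<mu>, Y\<^sub>\<nu>)\<close> are constant along the frame and equal to their limits \<open>\<eta>\<^sub>\<mu>\<^sub>\<nu>\<close>. By unique continuation the
  set where the fields are orthonormal and commute is open and closed. A commuting
  orthonormal Killing frame is parallel, and a parallel frame forces the curvature to vanish.
\<close>

section \<open>Calculus of \<open>C\<^sup>k\<close> functions on coordinate domains\<close>

text \<open>The fields \<open>Y\<close> themselves do not tend to zero at infinity, but their
  brackets do: each term is a bounded field times a first derivative, hence of order |x| to the
  power -1-\<beta>. Along a radial ray the error in the derivative formula is that same weight times
  the supremum of the field. The weight is integrable for every \<beta> > 0, so far out the supremum
  is at most half of itself. Unique continuation repeats this halving on short segments. As g is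
  indefinite, it controls a vector v through a lower bound for |g v| instead of g(v,v).

  Regularity is the main obstacle, since the bracket of C^1 fields is a priori only continuous. With
  u the lowered field and e_ij = d_i u_j + d_j u_i, the missing derivative comes from d_k(d_a u_b -
  d_b u_a) = d_a e_kb - d_b e_ka. The left side has no meaning yet for a C^1 field, so the identity
  is integrated over small parallelograms.

  At boundary points derivatives are one-sided. Whatever uses symmetry of second derivatives is
  therefore proved on open sets that are dense near the boundary, and reaches the boundary by
  continuity.\<close>

abbreviation D_on :: "(real^'i::finite) set \<Rightarrow> (real^'i \<Rightarrow> 'b::real_normed_vector) \<Rightarrow> real^'i \<Rightarrow> real^'i \<Rightarrow> 'b"
  where "D_on S f x \<equiv> frechet_derivative f (at x within S)"

text \<open>This is the condition under which \<open>frechet_derivative_unique_within\<close> makes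
  the derivative within \<open>S\<close> unique. The sign of \<open>d\<close> is free, so that
  points of a boundary hyperplane qualify.\<close>

definition thick :: "(real^'i::finite) set \<Rightarrow> bool" where
  "thick S \<longleftrightarrow> (\<forall>x\<in>S. \<forall>i\<in>Basis. \<forall>e>0. \<exists>d. 0 < \<bar>d\<bar> \<and> \<bar>d\<bar> < e \<and> x + d *\<^sub>R i \<in> S)"

lemma open_thick:
  fixes S :: "(real^'i::finite) set"
  assumes "open S"
  shows "thick S"
  unfolding thick_def
proof (intro ballI allI impI)
  fix x i :: "real^'i" and e :: real
  assume x: "x \<in> S" and i: "i \<in> Basis" and e: "0 < e"
  obtain r where r: "r > 0" "ball x r \<subseteq> S" using assms x by (meson openE)
  define d where "d = min e r / 2"
  have "dist x (x + d *\<^sub>R i) < r" using i r e by (auto simp: d_def dist_norm)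
  then show "\<exists>d. 0 < \<bar>d\<bar> \<and> \<bar>d\<bar> < e \<and> x + d *\<^sub>R i \<in> S"
    using r e by (intro exI[of _ d]) (auto simp: d_def mem_ball subset_eq)
qed

lemma D_on_eq:
  assumes "thick S" "x \<in> S" "(f has_derivative f') (at x within S)"
  shows "D_on S f x = f'"
proof -
  have "(f has_derivative D_on S f x) (at x within S)"
    using assms(3) by (meson differentiable_def frechet_derivative_works)
  then show ?thesis
    using frechet_derivative_unique_within[OF _ assms(3)] assms(1,2) unfolding thick_def by blast
qed

lemma partial_eq:
  assumes "thick S" "x \<in> S" "(f has_derivative f') (at x within S)"
  shows "partial S i f x = f' (axis i 1)"
  by (simp add: partial_def D_on_eq[OF assms])

lemma has_derivative_D_on:
  assumes "C_on (Suc k) S f" "x \<in> S"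
  shows "(f has_derivative D_on S f x) (at x within S)"
  using assms by (auto simp: differentiable_on_def frechet_derivative_works)

lemma linear_D_on:
  assumes "C_on (Suc k) S f" "x \<in> S"
  shows "linear (D_on S f x)"
  using has_derivative_D_on[OF assms] has_derivative_linear by blast

lemma linear_axis_expansion:
  fixes L :: "real^'i::finite \<Rightarrow> 'b::real_vector"
  assumes "linear L"
  shows "L v = (\<Sum>i\<in>UNIV. v $ i *\<^sub>R L (axis i 1))"
proof -
  have "L v = L (\<Sum>i\<in>UNIV. v $ i *\<^sub>R axis i 1)"
    by (simp add: basis_expansion[of v, unfolded scalar_mult_eq_scaleR])
  also have "\<dots> = (\<Sum>i\<in>UNIV. v $ i *\<^sub>R L (axis i 1))"
    using assms by (simp add: linear_sum linear_scale)
  finally show ?thesis .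
qed

lemma D_on_expansion:
  assumes "C_on (Suc k) S f" "x \<in> S"
  shows "D_on S f x v = (\<Sum>i\<in>UNIV. v $ i *\<^sub>R partial S i f x)"
  unfolding partial_def by (rule linear_axis_expansion[OF linear_D_on[OF assms]])

lemma D_on_cong:
  assumes "\<And>y. y \<in> S \<Longrightarrow> f y = h y" "x \<in> S"
  shows "D_on S f x = D_on S h x"
proof -
  have "(f has_derivative f') (at x within S) \<longleftrightarrow> (h has_derivative f') (at x within S)" for f'
    using assms by (metis has_derivative_transform)
  then show ?thesis unfolding frechet_derivative_def by simp
qed

lemma partial_cong:
  assumes "\<And>y. y \<in> S \<Longrightarrow> f y = h y" "x \<in> S"
  shows "partial S i f x = partial S i h x"
  unfolding partial_def using D_on_cong[OF assms] by simp

text \<open>Derivatives within \<open>S\<close> see only the values on \<open>S\<close>. Regularity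
  of a derivative is usually proved for an explicit formula that agrees with it on \<open>S\<close>,
  and this lemma carries it over.\<close>

lemma C_on_congI:
  assumes "C_on k S h" "\<And>y. y \<in> S \<Longrightarrow> f y = h y"
  shows "C_on k S f"
  using assms
proof (induction k arbitrary: f h)
  case 0
  then show ?case by (simp cong: continuous_on_cong)
next
  case (Suc k)
  have "f differentiable (at x within S)" if x: "x \<in> S" for x
  proof -
    obtain f' where "(h has_derivative f') (at x within S)"
      using Suc.prems(1) x by (auto simp: differentiable_on_def differentiable_def)
    from has_derivative_transform[OF x Suc.prems(2) this] show ?thesis
      by (auto simp: differentiable_def)
  qed
  then have "f differentiable_on S" by (simp add: differentiable_on_def)
  moreover have "C_on k S (partial S i f)" for i
  proof (rule Suc.IH)
    show "C_on k S (partial S i h)" using Suc.prems(1) by simp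
    show "partial S i f y = partial S i h y" if "y \<in> S" for y
      by (rule partial_cong[OF _ that]) (rule Suc.prems(2))
  qed
  ultimately show ?case by simp
qed

lemma C_on_Suc_imp: "C_on (Suc k) S f \<Longrightarrow> C_on k S f"
proof (induction k arbitrary: f)
  case 0
  then show ?case by (simp add: differentiable_imp_continuous_on)
next
  case (Suc k)
  then show ?case by (metis C_on.simps(2))
qed

lemma C_on_le: "C_on k S f \<Longrightarrow> j \<le> k \<Longrightarrow> C_on j S f"
  by (induction k) (auto simp: le_Suc_eq dest: C_on_Suc_imp simp del: C_on.simps)

lemma C_on_imp_continuous_on: "C_on k S f \<Longrightarrow> continuous_on S f"
  using C_on_le[of k S f 0] by simp

lemma partial_const: "thick S \<Longrightarrow> x \<in> S \<Longrightarrow> partial S i (\<lambda>_. c) x = 0"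
  by (subst partial_eq[where f'="\<lambda>_. 0"]) auto

lemma C_on_const: "thick S \<Longrightarrow> C_on k S (\<lambda>_. c)"
proof (induction k arbitrary: c)
  case (Suc k)
  have "C_on k S (partial S i (\<lambda>_. c))" for i
    by (rule C_on_congI[OF Suc.IH[OF Suc.prems] partial_const[OF Suc.prems]])
  then show ?case by simp
qed simp

lemma partial_bounded_linear:
  assumes "bounded_linear L" "thick S" "x \<in> S" "f differentiable (at x within S)"
  shows "partial S i (\<lambda>x. L (f x)) x = L (partial S i f x)"
proof -
  have "(f has_derivative D_on S f x) (at x within S)"
    using assms(4) by (simp add: frechet_derivative_works)
  from bounded_linear.has_derivative[OF assms(1) this]
  show ?thesis using partial_eq[OF assms(2,3)] by (simp add: partial_def)
qed

lemma C_on_bounded_linear: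
  assumes "bounded_linear L" "thick S" "C_on k S f"
  shows "C_on k S (\<lambda>x. L (f x))"
  using assms(3)
proof (induction k arbitrary: f)
  case 0
  then show ?case using assms(1) by (simp add: bounded_linear.continuous_on)
next
  case (Suc k)
  have "(\<lambda>x. L (f x)) differentiable_on S"
    using Suc.prems bounded_linear.has_derivative[OF assms(1)]
    unfolding C_on.simps differentiable_on_def differentiable_def by blast
  moreover have "C_on k S (partial S i (\<lambda>x. L (f x)))" for i
  proof -
    have "C_on k S (\<lambda>x. L (partial S i f x))" using Suc by simp
    then show ?thesis
      by (rule C_on_congI)
        (use Suc.prems partial_bounded_linear[OF assms(1,2)] in \<open>auto simp: differentiable_on_def\<close>)
  qed
  ultimately show ?case by simp
qed

lemma partial_add:
  assumes "thick S" "x \<in> S" "f differentiable (at x within S)" "h differentiable (at x within S)"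
  shows "partial S i (\<lambda>x. f x + h x) x = partial S i f x + partial S i h x"
  unfolding partial_def
  using D_on_eq[OF assms(1,2) has_derivative_add[OF assms(3,4)[unfolded frechet_derivative_works]]]
  by simp

lemma C_on_add:
  assumes "thick S" "C_on k S f" "C_on k S h"
  shows "C_on k S (\<lambda>x. f x + h x)"
  using assms(2,3)
proof (induction k arbitrary: f h)
  case (Suc k)
  have "C_on k S (partial S i (\<lambda>x. f x + h x))" for i
  proof -
    have "C_on k S (\<lambda>x. partial S i f x + partial S i h x)" using Suc by simp
    then show ?thesis
      by (rule C_on_congI) (use Suc.prems in \<open>simp add: partial_add[OF assms(1)] differentiable_on_def\<close>)
  qed
  then show ?case using Suc.prems by (simp add: differentiable_on_add)
qed (simp add: continuous_on_add)

lemma C_on_sum: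
  assumes "thick S" "\<And>i. i \<in> I \<Longrightarrow> C_on k S (f i)"
  shows "C_on k S (\<lambda>x. \<Sum>i\<in>I. f i x)"
  using assms(2)
  by (induction I rule: infinite_finite_induct) (simp_all add: C_on_const C_on_add assms(1))

lemma partial_bilinear:
  assumes "bounded_bilinear B" "thick S" "x \<in> S"
    "f differentiable (at x within S)" "h differentiable (at x within S)"
  shows "partial S i (\<lambda>x. B (f x) (h x)) x = B (f x) (partial S i h x) + B (partial S i f x) (h x)"
  unfolding partial_def
  using D_on_eq[OF assms(2,3)
      bounded_bilinear.FDERIV[OF assms(1) assms(4,5)[unfolded frechet_derivative_works]]]
  by simp

lemma C_on_bilinear:
  assumes B: "bounded_bilinear B" and "thick S" "C_on k S f" "C_on k S h"
  shows "C_on k S (\<lambda>x. B (f x) (h x))"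
  using assms(3,4)
proof (induction k arbitrary: f h)
  case 0
  then show ?case by (simp add: bounded_bilinear.continuous_on[OF B])
next
  case (Suc k)
  have "C_on k S (partial S i (\<lambda>x. B (f x) (h x)))" for i
  proof -
    have "C_on k S (\<lambda>x. B (f x) (partial S i h x) + B (partial S i f x) (h x))"
      using Suc.prems Suc.prems[THEN C_on_Suc_imp]
      by (intro C_on_add[OF assms(2)] Suc.IH) simp_all
    then show ?thesis
      by (rule C_on_congI) (use Suc.prems partial_bilinear[OF B assms(2)] in \<open>auto simp: differentiable_on_def\<close>)
  qed
  moreover have "(\<lambda>x. B (f x) (h x)) differentiable_on S"
    using Suc.prems bounded_bilinear.FDERIV[OF B]
    unfolding C_on.simps differentiable_on_def differentiable_def by blast
  ultimately show ?case by simp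
qed

lemmas C_on_mult = C_on_bilinear[OF bounded_bilinear_mult]
lemmas C_on_scaleR = C_on_bilinear[OF bounded_bilinear_scaleR]
lemmas C_on_vec_nth = C_on_bounded_linear[OF bounded_linear_vec_nth]

lemma C_on_cmult: "thick S \<Longrightarrow> C_on k S f \<Longrightarrow> C_on k S (\<lambda>x. c * f x)" for f :: "_ \<Rightarrow> real"
  by (intro C_on_mult C_on_const)

lemma C_on_uminus: "thick S \<Longrightarrow> C_on k S f \<Longrightarrow> C_on k S (\<lambda>x. - f x)"
  by (rule C_on_bounded_linear[of uminus]) (simp_all add: bounded_linear_minus bounded_linear_ident)

lemma C_on_diff: "thick S \<Longrightarrow> C_on k S f \<Longrightarrow> C_on k S h \<Longrightarrow> C_on k S (\<lambda>x. f x - h x)"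
  using C_on_add[of S k f "\<lambda>x. - h x"] C_on_uminus[of S k h] by simp

lemma C_on_prod:
  fixes f :: "_ \<Rightarrow> _ \<Rightarrow> real"
  assumes "thick S" "\<And>i. i \<in> I \<Longrightarrow> C_on k S (f i)"
  shows "C_on k S (\<lambda>x. \<Prod>i\<in>I. f i x)"
  using assms(2)
  by (induction I rule: infinite_finite_induct) (simp_all add: C_on_const C_on_mult assms(1))

lemma C_on_inverse:
  fixes f :: "_ \<Rightarrow> real"
  assumes "thick S" "C_on k S f" "\<And>x. x \<in> S \<Longrightarrow> f x \<noteq> 0"
  shows "C_on k S (\<lambda>x. inverse (f x))"
  using assms(2)
proof (induction k)
  case 0
  then show ?case using assms(3) by (auto intro: continuous_on_inverse)
next
  case (Suc k)
  have *: "((\<lambda>x. inverse (f x)) has_derivative (\<lambda>h. - (inverse (f x) * D_on S f x h * inverse (f x)))) (at x within S)"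
    if "x \<in> S" for x
    by (rule Deriv.has_derivative_inverse[OF assms(3)[OF that] has_derivative_D_on[OF Suc.prems that]])
  have "C_on k S (\<lambda>x. - (inverse (f x) * partial S i f x * inverse (f x)))" for i
    using Suc C_on_Suc_imp[OF Suc.prems] by (intro C_on_uminus C_on_mult assms(1) Suc.IH) auto
  moreover have "partial S i (\<lambda>x. inverse (f x)) x = - (inverse (f x) * partial S i f x * inverse (f x))"
    if "x \<in> S" for i x
    using partial_eq[OF assms(1) that *[OF that]] by (simp add: partial_def)
  ultimately have "C_on k S (partial S i (\<lambda>x. inverse (f x)))" for i
    by (rule C_on_congI)
  then show ?case using * by (auto simp: differentiable_on_def differentiable_def)
qed

section \<open>Determinants and inverses of matrix-valued functions\<close>

lemma C_on_det:
  fixes F :: "real^'i::finite \<Rightarrow> real^'n^'n"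
  assumes "thick S" "\<And>i j. C_on k S (\<lambda>x. F x $ i $ j)"
  shows "C_on k S (\<lambda>x. det (F x))"
  unfolding det_def by (intro C_on_sum C_on_mult C_on_prod C_on_const assms)

lemma matrix_inv_mult:
  fixes M :: "real^'n^'n"
  assumes "invertible M"
  shows "M ** matrix_inv M = mat 1" "matrix_inv M ** M = mat 1"
proof -
  have "M ** matrix_inv M = mat 1 \<and> matrix_inv M ** M = mat 1"
    using assms unfolding invertible_def matrix_inv_def by (rule someI_ex)
  then show "M ** matrix_inv M = mat 1" "matrix_inv M ** M = mat 1" by auto
qed

text \<open>The entries of the inverse are given by Cramer's rule.\<close>

lemma C_on_matrix_inv:
  fixes F :: "real^'i::finite \<Rightarrow> real^'n^'n"
  assumes "thick S" "\<And>i j. C_on k S (\<lambda>x. F x $ i $ j)" "\<And>x. x \<in> S \<Longrightarrow> invertible (F x)"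
  shows "C_on k S (\<lambda>x. matrix_inv (F x) $ i $ j)"
proof -
  let ?M = "\<lambda>x. (\<chi> a b. if b = i then axis j 1 $ a else F x $ a $ b) :: real^'n^'n"
  have det: "det (F x) \<noteq> 0" if "x \<in> S" for x
    using assms(3)[OF that] by (simp add: invertible_det_nz)
  have eq: "matrix_inv (F x) $ i $ j = det (?M x) * inverse (det (F x))" if "x \<in> S" for x
  proof -
    have "F x *v (matrix_inv (F x) *v axis j 1) = axis j 1"
      using assms(3)[OF that] by (simp add: matrix_vector_mul_assoc matrix_inv_mult)
    then have "matrix_inv (F x) *v axis j 1 = (\<chi> k. det (\<chi> a b. if b = k then axis j 1 $ a else F x $ a $ b) / det (F x))"
      using cramer[OF det[OF that]] by blast
    moreover have "(matrix_inv (F x) *v axis j 1) $ i = matrix_inv (F x) $ i $ j"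
      by (simp add: matrix_vector_mult_basis column_def)
    ultimately show ?thesis by (simp add: divide_inverse)
  qed
  have "C_on k S (\<lambda>x. ?M x $ a $ b)" for a b
    using assms(1,2) by (cases "b = i") (simp_all add: C_on_const)
  then have "C_on k S (\<lambda>x. det (?M x) * inverse (det (F x)))"
    using det by (intro C_on_mult C_on_inverse C_on_det assms) auto
  then show ?thesis by (rule C_on_congI) (rule eq)
qed

text \<open>At points of an open \<open>W\<close> the derivative within \<open>S\<close> is the
  ordinary two-sided one. Arguments that move a point in all directions are run on such a
  \<open>W\<close> inside a chart image and read back through this equation.\<close>

lemma D_on_open_subset:
  assumes "open W" "W \<subseteq> S" "x \<in> W"
  shows "D_on W f x = D_on S f x"
proof -
  have "at x within S = at x" using assms by (meson at_within_interior interior_maximal subsetD)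
  then show ?thesis using assms at_within_open by metis
qed

lemma C_on_open_subset:
  assumes "C_on k S f" "open W" "W \<subseteq> S"
  shows "C_on k W f"
  using assms(1)
proof (induction k arbitrary: f)
  case 0
  then show ?case using assms continuous_on_subset by auto
next
  case (Suc k)
  have "C_on k W (partial W i f)" for i
  proof -
    have "C_on k W (partial S i f)" using Suc by simp
    then show ?thesis
      by (rule C_on_congI) (simp add: partial_def D_on_open_subset[OF assms(2,3)])
  qed
  then show ?case
    using Suc.prems assms differentiable_on_subset by auto
qed

lemma C_on_vec:
  fixes f :: "real^'i::finite \<Rightarrow> real^'n"
  assumes "thick S" "\<And>j. C_on k S (\<lambda>x. f x $ j)"
  shows "C_on k S f"
proof -
  have "C_on k S (\<lambda>x. \<Sum>j\<in>UNIV. f x $ j *\<^sub>R axis j 1)"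
    by (intro C_on_sum C_on_scaleR C_on_const assms)
  moreover have "(\<Sum>j\<in>UNIV. f x $ j *\<^sub>R axis j 1) = f x" for x
    by (simp add: basis_expansion[of "f x", unfolded scalar_mult_eq_scaleR])
  ultimately show ?thesis by (auto intro: C_on_congI)
qed

lemma C_on_D_on:
  assumes "thick S" "C_on (Suc k) S f"
  shows "C_on k S (\<lambda>x. D_on S f x v)"
proof -
  have "C_on k S (\<lambda>x. \<Sum>i\<in>UNIV. v $ i *\<^sub>R partial S i f x)"
    using assms by (intro C_on_sum C_on_bounded_linear[OF bounded_linear_scaleR_right]) auto
  then show ?thesis by (rule C_on_congI) (rule D_on_expansion[OF assms(2)])
qed

section \<open>Loop integrals and symmetric gradients\<close>

text \<open>The mean value theorem on the segment from \<open>z\<close> in direction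
  \<open>a\<close>. The number \<open>c\<close> will be a directional derivative frozen at a nearby
  centre.\<close>

lemma increment_estimate:
  fixes f :: "'a::real_normed_vector \<Rightarrow> real"
  assumes "0 < s"
    and f: "\<And>\<sigma>. 0 \<le> \<sigma> \<Longrightarrow> \<sigma> \<le> s \<Longrightarrow> (f has_derivative f' (z + \<sigma> *\<^sub>R a)) (at (z + \<sigma> *\<^sub>R a))"
    and c: "\<And>\<sigma>. 0 \<le> \<sigma> \<Longrightarrow> \<sigma> \<le> s \<Longrightarrow> \<bar>f' (z + \<sigma> *\<^sub>R a) a - c\<bar> \<le> \<epsilon>"
  shows "\<bar>f (z + s *\<^sub>R a) - f z - s * c\<bar> \<le> s * \<epsilon>"
proof -
  have "((\<lambda>\<sigma>. f (z + \<sigma> *\<^sub>R a)) has_real_derivative f' (z + \<sigma> *\<^sub>R a) a) (at \<sigma>)" if "0 \<le> \<sigma>" "\<sigma> \<le> s" for \<sigma>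
  proof -
    have "((\<lambda>\<sigma>. f (z + \<sigma> *\<^sub>R a)) has_derivative (\<lambda>h. f' (z + \<sigma> *\<^sub>R a) (h *\<^sub>R a))) (at \<sigma>)"
      by (rule has_derivative_compose[of "\<lambda>\<sigma>. z + \<sigma> *\<^sub>R a" "\<lambda>h. h *\<^sub>R a" \<sigma> UNIV f])
        (auto intro!: derivative_eq_intros f that)
    moreover have "f' (z + \<sigma> *\<^sub>R a) (h *\<^sub>R a) = f' (z + \<sigma> *\<^sub>R a) a * h" for h
      using has_derivative_linear[OF f[OF that]] by (simp add: linear_scale)
    ultimately show ?thesis by (simp add: has_field_derivative_def)
  qed
  from MVT2[OF \<open>0 < s\<close> this] obtain \<sigma> where \<sigma>: "0 < \<sigma>" "\<sigma> < s"
    and eq: "f (z + s *\<^sub>R a) - f (z + 0 *\<^sub>R a) = (s - 0) * f' (z + \<sigma> *\<^sub>R a) a" by auto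
  have "f (z + s *\<^sub>R a) - f z - s * c = s * (f' (z + \<sigma> *\<^sub>R a) a - c)"
    using eq by (simp add: algebra_simps)
  then have "\<bar>f (z + s *\<^sub>R a) - f z - s * c\<bar> = s * \<bar>f' (z + \<sigma> *\<^sub>R a) a - c\<bar>"
    using \<open>0 < s\<close> by (simp add: abs_mult)
  also have "\<dots> \<le> s * \<epsilon>" using c[of \<sigma>] \<sigma> \<open>0 < s\<close> by simp
  finally show ?thesis .
qed

abbreviation side :: "real \<Rightarrow> 'a::real_normed_vector \<Rightarrow> ('a \<Rightarrow> real) \<Rightarrow> 'a \<Rightarrow> real" where
  "side s b q x \<equiv> integral {0..s} (\<lambda>t. q (x + t *\<^sub>R b))"

text \<open>The integral of the one-form with components \<open>p\<close>, \<open>q\<close> in the directions \<open>a\<close>, \<open>b\<close> around the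
  parallelogram at \<open>x\<close> with sides \<open>s a\<close> and \<open>s b\<close>.\<close>

definition loop :: "('a::real_normed_vector \<Rightarrow> real) \<Rightarrow> ('a \<Rightarrow> real) \<Rightarrow> 'a \<Rightarrow> 'a \<Rightarrow> real \<Rightarrow> 'a \<Rightarrow> real" where
  "loop p q a b s x =
     integral {0..s} (\<lambda>t. q (x + t *\<^sub>R b + s *\<^sub>R a) - q (x + t *\<^sub>R b))
     - integral {0..s} (\<lambda>t. p (x + t *\<^sub>R a + s *\<^sub>R b) - p (x + t *\<^sub>R a))"

text \<open>Across the parallelogram \<open>q\<close> changes by \<open>s * q' x a\<close> up to
  \<open>s * \<epsilon>\<close>, and integration along the side gives the second factor
  \<open>s\<close>. The condition on \<delta> keeps the parallelogram in the ball. The derivative is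
  frozen at \<open>x\<close> and not at \<open>z\<close>, so the estimate is uniform in the base
  point \<open>z\<close>.\<close>

lemma side_estimate:
  fixes q :: "'a::real_normed_vector \<Rightarrow> real"
  assumes s: "0 < s" "s < \<delta>" "\<delta> * (1 + norm a + norm b) \<le> r" and z: "dist z x < \<delta>"
    and q: "\<And>y. y \<in> ball x r \<Longrightarrow> (q has_derivative q' y) (at y)"
    and \<epsilon>: "\<And>y. y \<in> ball x r \<Longrightarrow> \<bar>q' y a - q' x a\<bar> \<le> \<epsilon>"
  shows "\<bar>integral {0..s} (\<lambda>t. q (z + t *\<^sub>R b + s *\<^sub>R a) - q (z + t *\<^sub>R b)) - s\<^sup>2 * q' x a\<bar> \<le> \<epsilon> * s\<^sup>2"
proof -
  have in_ball: "z + t *\<^sub>R b + \<sigma> *\<^sub>R a \<in> ball x r" if "0 \<le> t" "t \<le> s" "0 \<le> \<sigma>" "\<sigma> \<le> s" for t \<sigma>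
  proof -
    have "norm (z + t *\<^sub>R b + \<sigma> *\<^sub>R a - x) \<le> norm (z - x) + norm (t *\<^sub>R b) + norm (\<sigma> *\<^sub>R a)"
      using norm_triangle_ineq[of "z - x + t *\<^sub>R b" "\<sigma> *\<^sub>R a"] norm_triangle_ineq[of "z - x" "t *\<^sub>R b"]
      by (simp add: algebra_simps)
    also have "norm (t *\<^sub>R b) \<le> \<delta> * norm b" using that s by (simp add: mult_right_mono)
    also have "norm (\<sigma> *\<^sub>R a) \<le> \<delta> * norm a" using that s by (simp add: mult_right_mono)
    also have "norm (z - x) + \<delta> * norm b + \<delta> * norm a < r"
      using z s(3) by (simp add: dist_norm algebra_simps)
    finally show ?thesis by (simp add: dist_norm norm_minus_commute)
  qed
  have cont: "continuous_on (ball x r) q"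
    using q by (meson has_derivative_at_withinI has_derivative_continuous_on)
  have c1: "continuous_on {0..s} (\<lambda>t. q (z + t *\<^sub>R b + s *\<^sub>R a))"
    by (rule continuous_on_compose2[OF cont]) (auto intro!: continuous_intros in_ball simp del: mem_ball simp: s less_imp_le)
  have c2: "continuous_on {0..s} (\<lambda>t. q (z + t *\<^sub>R b))"
    using in_ball[of _ 0] s
    by (intro continuous_on_compose2[OF cont]) (auto intro!: continuous_intros simp del: mem_ball)
  have *: "\<bar>q (z + t *\<^sub>R b + s *\<^sub>R a) - q (z + t *\<^sub>R b) - s * q' x a\<bar> \<le> s * \<epsilon>" if "0 \<le> t" "t \<le> s" for t
    by (rule increment_estimate[where f' = q']) (use s(1) q in_ball \<epsilon> that in \<open>auto simp del: mem_ball\<close>)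
  have "integral {0..s} (\<lambda>t. q (z + t *\<^sub>R b + s *\<^sub>R a) - q (z + t *\<^sub>R b) - s * q' x a)
      = integral {0..s} (\<lambda>t. q (z + t *\<^sub>R b + s *\<^sub>R a) - q (z + t *\<^sub>R b)) - s\<^sup>2 * q' x a"
    using s integrable_continuous_real[OF continuous_on_diff[OF c1 c2]]
    by (simp add: integral_diff[OF _ integrable_const_ivl] power2_eq_square)
  moreover have "norm (integral {0..s} (\<lambda>t. q (z + t *\<^sub>R b + s *\<^sub>R a) - q (z + t *\<^sub>R b) - s * q' x a))
      \<le> (s * \<epsilon>) * (s - 0)"
    by (rule integral_bound) (use s c1 c2 * in \<open>simp_all add: continuous_on_diff\<close>)
  ultimately show ?thesis by (simp add: power2_eq_square mult_ac)
qed

text \<open>Stokes' theorem in infinitesimal form. One \<delta> serves all base points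
  \<open>z\<close> near \<open>x\<close>; this uniformity allows the loop to be displaced before
  \<open>s\<close> tends to zero.\<close>

lemma loop_estimate:
  fixes p q :: "'a::real_normed_vector \<Rightarrow> real"
  assumes W: "open W" "x \<in> W"
    and p: "\<And>y. y \<in> W \<Longrightarrow> (p has_derivative p' y) (at y)"
    and q: "\<And>y. y \<in> W \<Longrightarrow> (q has_derivative q' y) (at y)"
    and cp: "continuous_on W (\<lambda>y. p' y b)" and cq: "continuous_on W (\<lambda>y. q' y a)"
    and "\<epsilon> > 0"
  obtains \<delta> where "\<delta> > 0"
    "\<And>z s. dist z x < \<delta> \<Longrightarrow> 0 < s \<Longrightarrow> s < \<delta> \<Longrightarrow>
       \<bar>loop p q a b s z - s\<^sup>2 * (q' x a - p' x b)\<bar> \<le> \<epsilon> * s\<^sup>2"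
proof -
  obtain r0 where r0: "r0 > 0" "ball x r0 \<subseteq> W" using W by (meson openE)
  have "isCont (\<lambda>y. p' y b) x" "isCont (\<lambda>y. q' y a) x"
    using W cp cq by (auto simp: continuous_on_eq_continuous_at)
  then obtain r1 r2 where r1: "r1 > 0" "\<And>y. dist y x < r1 \<Longrightarrow> dist (p' y b) (p' x b) < \<epsilon> / 2"
    and r2: "r2 > 0" "\<And>y. dist y x < r2 \<Longrightarrow> dist (q' y a) (q' x a) < \<epsilon> / 2"
    using \<open>\<epsilon> > 0\<close> unfolding continuous_at_eps_delta by (metis half_gt_zero)
  define r where "r = min r0 (min r1 r2)"
  have r: "r > 0" using r0 r1 r2 by (simp add: r_def)
  have ball: "ball x r \<subseteq> W" using r0 by (auto simp: r_def)
  have small: "\<bar>p' y b - p' x b\<bar> \<le> \<epsilon> / 2" "\<bar>q' y a - q' x a\<bar> \<le> \<epsilon> / 2" if "y \<in> ball x r" for y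
    using that r1(2)[of y] r2(2)[of y] by (simp_all add: r_def dist_commute dist_real_def abs_minus_commute)
  define \<delta> where "\<delta> = r / (1 + norm a + norm b)"
  have pos: "1 + norm a + norm b > 0" by (simp add: add_pos_nonneg)
  have \<delta>: "\<delta> > 0" "\<delta> * (1 + norm a + norm b) \<le> r" "\<delta> * (1 + norm b + norm a) \<le> r"
    using r pos by (simp_all add: \<delta>_def field_simps)
  have "\<bar>loop p q a b s z - s\<^sup>2 * (q' x a - p' x b)\<bar> \<le> \<epsilon> * s\<^sup>2"
    if "dist z x < \<delta>" "0 < s" "s < \<delta>" for z s
  proof -
    have "\<bar>integral {0..s} (\<lambda>t. q (z + t *\<^sub>R b + s *\<^sub>R a) - q (z + t *\<^sub>R b)) - s\<^sup>2 * q' x a\<bar> \<le> \<epsilon> / 2 * s\<^sup>2"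
      by (rule side_estimate[of s \<delta> a b r z x q q']) (use that \<delta> ball q small in auto)
    moreover have "\<bar>integral {0..s} (\<lambda>t. p (z + t *\<^sub>R a + s *\<^sub>R b) - p (z + t *\<^sub>R a)) - s\<^sup>2 * p' x b\<bar> \<le> \<epsilon> / 2 * s\<^sup>2"
      by (rule side_estimate[of s \<delta> b a r z x p p']) (use that \<delta> ball p small in auto)
    ultimately show ?thesis unfolding loop_def right_diff_distrib by linarith
  qed
  with that \<delta> show ?thesis by blast
qed

lemma has_integral_side:
  fixes \<phi> :: "'a::real_normed_vector \<Rightarrow> real"
  assumes "0 \<le> s" and \<phi>: "\<And>t. 0 \<le> t \<Longrightarrow> t \<le> s \<Longrightarrow> (\<phi> has_derivative \<phi>' (x + t *\<^sub>R b)) (at (x + t *\<^sub>R b))"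
  shows "((\<lambda>t. \<phi>' (x + t *\<^sub>R b) b) has_integral \<phi> (x + s *\<^sub>R b) - \<phi> x) {0..s}"
proof -
  have "((\<lambda>t. \<phi> (x + t *\<^sub>R b)) has_vector_derivative \<phi>' (x + t *\<^sub>R b) b) (at t within {0..s})"
    if "t \<in> {0..s}" for t
  proof -
    have "((\<lambda>t. \<phi> (x + t *\<^sub>R b)) has_derivative (\<lambda>h. \<phi>' (x + t *\<^sub>R b) (h *\<^sub>R b))) (at t within {0..s})"
      by (rule has_derivative_compose[of "\<lambda>t. x + t *\<^sub>R b" "\<lambda>h. h *\<^sub>R b" t "{0..s}" \<phi>])
        (use that in \<open>auto intro!: derivative_eq_intros \<phi>\<close>)
    then show ?thesis
      using has_derivative_linear[OF \<phi>] that by (simp add: has_vector_derivative_def linear_scale)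
  qed
  from fundamental_theorem_of_calculus[OF assms(1) this] show ?thesis by simp
qed

text \<open>The fundamental theorem of calculus on the four sides turns both integrals of
  \<open>loop\<close> into the same alternating sum of \<phi> over the corners. No continuity of the
  derivative is involved, because the integral is the gauge integral.\<close>

lemma loop_gradient:
  fixes \<phi> :: "'a::real_normed_vector \<Rightarrow> real"
  assumes "0 \<le> s"
    and \<phi>: "\<And>\<sigma> \<tau>. 0 \<le> \<sigma> \<Longrightarrow> \<sigma> \<le> s \<Longrightarrow> 0 \<le> \<tau> \<Longrightarrow> \<tau> \<le> s \<Longrightarrow>
      (\<phi> has_derivative \<phi>' (x + \<sigma> *\<^sub>R a + \<tau> *\<^sub>R b)) (at (x + \<sigma> *\<^sub>R a + \<tau> *\<^sub>R b))"
  shows "loop (\<lambda>y. \<phi>' y a) (\<lambda>y. \<phi>' y b) a b s x = 0"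
proof -
  note s = \<open>0 \<le> s\<close>
  have b1: "((\<lambda>t. \<phi>' (x + s *\<^sub>R a + t *\<^sub>R b) b) has_integral \<phi> (x + s *\<^sub>R a + s *\<^sub>R b) - \<phi> (x + s *\<^sub>R a)) {0..s}"
    using s \<phi>[of s] by (intro has_integral_side) auto
  have b2: "((\<lambda>t. \<phi>' (x + t *\<^sub>R b) b) has_integral \<phi> (x + s *\<^sub>R b) - \<phi> x) {0..s}"
    using s \<phi>[of 0] by (intro has_integral_side) auto
  have a1: "((\<lambda>t. \<phi>' (x + s *\<^sub>R b + t *\<^sub>R a) a) has_integral \<phi> (x + s *\<^sub>R b + s *\<^sub>R a) - \<phi> (x + s *\<^sub>R b)) {0..s}"
    using s \<phi>[of _ s] by (intro has_integral_side) (auto simp: add_ac)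
  have a2: "((\<lambda>t. \<phi>' (x + t *\<^sub>R a) a) has_integral \<phi> (x + s *\<^sub>R a) - \<phi> x) {0..s}"
    using s \<phi>[of _ 0] by (intro has_integral_side) auto
  show ?thesis unfolding loop_def
    using integral_unique[OF has_integral_diff[OF b1 b2]] integral_unique[OF has_integral_diff[OF a1 a2]]
    by (simp add: add_ac)
qed

lemma side_derivative:
  fixes q :: "'a::real_normed_vector \<Rightarrow> real"
  assumes "0 \<le> s" "\<bar>h\<bar> < H"
    and q: "\<And>h \<tau>. \<bar>h\<bar> < H \<Longrightarrow> 0 \<le> \<tau> \<Longrightarrow> \<tau> \<le> s \<Longrightarrow>
      (q has_derivative q' (x + h *\<^sub>R k + \<tau> *\<^sub>R b)) (at (x + h *\<^sub>R k + \<tau> *\<^sub>R b))"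
    and cont: "continuous_on W (\<lambda>y. q' y k)"
    and W: "\<And>h \<tau>. \<bar>h\<bar> < H \<Longrightarrow> 0 \<le> \<tau> \<Longrightarrow> \<tau> \<le> s \<Longrightarrow> x + h *\<^sub>R k + \<tau> *\<^sub>R b \<in> W"
  shows "((\<lambda>h. side s b q (x + h *\<^sub>R k)) has_real_derivative
      side s b (\<lambda>y. q' y k) (x + h *\<^sub>R k)) (at h)"
proof -
  have d: "((\<lambda>h. q (x + h *\<^sub>R k + t *\<^sub>R b)) has_real_derivative q' (x + h *\<^sub>R k + t *\<^sub>R b) k) (at h within {-H<..<H})"
    if "h \<in> {-H<..<H}" "t \<in> cbox 0 s" for h t
  proof -
    have hd: "(q has_derivative q' (x + h *\<^sub>R k + t *\<^sub>R b)) (at (x + h *\<^sub>R k + t *\<^sub>R b))"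
      using that by (intro q) auto
    have "((\<lambda>h. q (x + h *\<^sub>R k + t *\<^sub>R b)) has_derivative (\<lambda>\<eta>. q' (x + h *\<^sub>R k + t *\<^sub>R b) (\<eta> *\<^sub>R k))) (at h within {-H<..<H})"
      by (rule has_derivative_compose[of "\<lambda>h. x + h *\<^sub>R k + t *\<^sub>R b" "\<lambda>\<eta>. \<eta> *\<^sub>R k" h _ q])
        (auto intro!: derivative_eq_intros hd)
    moreover have "q' (x + h *\<^sub>R k + t *\<^sub>R b) (\<eta> *\<^sub>R k) = q' (x + h *\<^sub>R k + t *\<^sub>R b) k * \<eta>" for \<eta>
      using has_derivative_linear[OF hd] by (simp add: linear_scale)
    ultimately show ?thesis by (simp add: has_field_derivative_def)
  qed
  have qc: "continuous_on {0..s} (\<lambda>t. q (x + h *\<^sub>R k + t *\<^sub>R b))" if "h \<in> {-H<..<H}" for h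
  proof (rule continuous_at_imp_continuous_on, rule ballI)
    fix t assume t: "t \<in> {0..s}"
    have "isCont q (x + h *\<^sub>R k + t *\<^sub>R b)"
      by (rule has_derivative_continuous[OF q]) (use that t in auto)
    then show "isCont (\<lambda>t. q (x + h *\<^sub>R k + t *\<^sub>R b)) t"
      by (rule isCont_o2[where f="\<lambda>t. x + h *\<^sub>R k + t *\<^sub>R b" and g=q, rotated]) (intro continuous_intros)
  qed
  have "((\<lambda>h. integral (cbox 0 s) (\<lambda>t. q (x + h *\<^sub>R k + t *\<^sub>R b))) has_field_derivative
      integral (cbox 0 s) (\<lambda>t. q' (x + h *\<^sub>R k + t *\<^sub>R b) k)) (at h within {-H<..<H})"
  proof (rule leibniz_rule_field_derivative[OF d])
    show "(\<lambda>t. q (x + h *\<^sub>R k + t *\<^sub>R b)) integrable_on cbox 0 s" if "h \<in> {-H<..<H}" for h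
      using qc[OF that] by (auto intro: integrable_continuous_real)
    show "continuous_on ({-H<..<H} \<times> cbox 0 s) (\<lambda>(h, t). q' (x + h *\<^sub>R k + t *\<^sub>R b) k)"
      unfolding case_prod_beta
      by (rule continuous_on_compose2[OF cont]) (auto intro!: continuous_intros W)
  qed (use assms in auto)
  moreover have "at h within {-H<..<H} = at h" using assms(2) by (intro at_within_open) auto
  ultimately show ?thesis by simp
qed

lemma continuous_on_side:
  fixes q :: "'a::real_normed_vector \<Rightarrow> real"
  assumes "continuous_on W q" "\<And>t. 0 \<le> t \<Longrightarrow> t \<le> s \<Longrightarrow> x + t *\<^sub>R b \<in> W"
  shows "continuous_on {0..s} (\<lambda>t. q (x + t *\<^sub>R b))"
  by (rule continuous_on_compose2[OF assms(1), of _ "\<lambda>t. x + t *\<^sub>R b"])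
    (use assms(2) in \<open>auto intro!: continuous_on_add continuous_on_scaleR continuous_on_const continuous_on_id\<close>)

lemmas integrable_side = integrable_continuous_real[OF continuous_on_side]

lemma loop_split:
  fixes p q :: "'a::real_normed_vector \<Rightarrow> real"
  assumes "0 \<le> s" and c: "continuous_on W p" "continuous_on W q"
    and W: "\<And>\<sigma> \<tau>. 0 \<le> \<sigma> \<Longrightarrow> \<sigma> \<le> s \<Longrightarrow> 0 \<le> \<tau> \<Longrightarrow> \<tau> \<le> s \<Longrightarrow> x + \<sigma> *\<^sub>R a + \<tau> *\<^sub>R b \<in> W"
  shows "loop p q a b s x =
     side s b q (x + s *\<^sub>R a) - side s b q x
     - (side s a p (x + s *\<^sub>R b) - side s a p x)"
proof -
  have Wb: "x + s *\<^sub>R b + \<sigma> *\<^sub>R a \<in> W" if "0 \<le> \<sigma>" "\<sigma> \<le> s" for \<sigma>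
    using W[of \<sigma> s] that \<open>0 \<le> s\<close> by (simp add: add_ac)
  have "(\<lambda>t. q (x + s *\<^sub>R a + t *\<^sub>R b)) integrable_on {0..s}" "(\<lambda>t. q (x + t *\<^sub>R b)) integrable_on {0..s}"
    using W[of s] W[of 0] \<open>0 \<le> s\<close> by (auto intro!: integrable_side[OF c(2)])
  moreover have "(\<lambda>t. p (x + s *\<^sub>R b + t *\<^sub>R a)) integrable_on {0..s}" "(\<lambda>t. p (x + t *\<^sub>R a)) integrable_on {0..s}"
    using Wb W[of _ 0] \<open>0 \<le> s\<close> by (auto intro!: integrable_side[OF c(1)])
  ultimately show ?thesis
    unfolding loop_def by (simp add: integral_diff add.assoc add.commute[of "s *\<^sub>R _"])
qed

lemma loop_diff:
  fixes p1 p2 q1 q2 :: "'a::real_normed_vector \<Rightarrow> real"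
  assumes s: "0 \<le> s" and c: "continuous_on W p1" "continuous_on W q1" "continuous_on W p2" "continuous_on W q2"
    and W: "\<And>\<sigma> \<tau>. 0 \<le> \<sigma> \<Longrightarrow> \<sigma> \<le> s \<Longrightarrow> 0 \<le> \<tau> \<Longrightarrow> \<tau> \<le> s \<Longrightarrow> x + \<sigma> *\<^sub>R a + \<tau> *\<^sub>R b \<in> W"
  shows "loop (\<lambda>y. p1 y - p2 y) (\<lambda>y. q1 y - q2 y) a b s x = loop p1 q1 a b s x - loop p2 q2 a b s x"
proof -
  have Wb: "x + s *\<^sub>R b + \<sigma> *\<^sub>R a \<in> W" if "0 \<le> \<sigma>" "\<sigma> \<le> s" for \<sigma>
    using W[of \<sigma> s] that \<open>0 \<le> s\<close> by (simp add: add_ac)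
  have q: "integral {0..s} (\<lambda>t. q1 (y + t *\<^sub>R b) - q2 (y + t *\<^sub>R b))
      = side s b q1 y - side s b q2 y"
    if "y = x \<or> y = x + s *\<^sub>R a" for y
    using that W[of 0] W[of s] s by (intro integral_diff integrable_side[OF c(2)] integrable_side[OF c(4)]) auto
  have p: "integral {0..s} (\<lambda>t. p1 (y + t *\<^sub>R a) - p2 (y + t *\<^sub>R a))
      = side s a p1 y - side s a p2 y"
    if "y = x \<or> y = x + s *\<^sub>R b" for y
    using that W[of _ 0] Wb s
    by (intro integral_diff integrable_side[OF c(1)] integrable_side[OF c(3)]) auto
  show ?thesis
    unfolding loop_split[OF s continuous_on_diff[OF c(1,3)] continuous_on_diff[OF c(2,4)] W, simplified]
      loop_split[OF s c(1,2) W, simplified] loop_split[OF s c(3,4) W, simplified]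
    using p[of x] p[of "x + s *\<^sub>R b"] q[of x] q[of "x + s *\<^sub>R a"] by simp
qed

text \<open>Displacement in direction \<open>k\<close> moves the four sides rigidly, so the
  derivative in \<open>h\<close> passes under each side integral and the result is again a loop
  integral.\<close>

lemma loop_derivative:
  fixes p q :: "'a::real_normed_vector \<Rightarrow> real"
  assumes s: "0 \<le> s" and h: "\<bar>h\<bar> < H"
    and p: "\<And>y. y \<in> W \<Longrightarrow> (p has_derivative p' y) (at y)"
    and q: "\<And>y. y \<in> W \<Longrightarrow> (q has_derivative q' y) (at y)"
    and cont: "continuous_on W (\<lambda>y. p' y k)" "continuous_on W (\<lambda>y. q' y k)"
    and W: "\<And>h \<sigma> \<tau>. \<bar>h\<bar> < H \<Longrightarrow> 0 \<le> \<sigma> \<Longrightarrow> \<sigma> \<le> s \<Longrightarrow> 0 \<le> \<tau> \<Longrightarrow> \<tau> \<le> s \<Longrightarrow>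
       x + h *\<^sub>R k + \<sigma> *\<^sub>R a + \<tau> *\<^sub>R b \<in> W"
  shows "((\<lambda>h. loop p q a b s (x + h *\<^sub>R k)) has_real_derivative
      loop (\<lambda>y. p' y k) (\<lambda>y. q' y k) a b s (x + h *\<^sub>R k)) (at h)"
proof -
  have c: "continuous_on W p" "continuous_on W q"
    using p q by (meson has_derivative_at_withinI has_derivative_continuous_on)+
  have 1: "((\<lambda>h. side s b q (x + h *\<^sub>R k + s *\<^sub>R a)) has_real_derivative
      side s b (\<lambda>y. q' y k) (x + h *\<^sub>R k + s *\<^sub>R a)) (at h)"
    using side_derivative[of s h H q q' "x + s *\<^sub>R a" k b W] s h q cont(2) W[of _ s]
    by (simp add: add_ac)
  have 2: "((\<lambda>h. side s b q (x + h *\<^sub>R k)) has_real_derivative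
      side s b (\<lambda>y. q' y k) (x + h *\<^sub>R k)) (at h)"
    using side_derivative[of s h H q q' x k b W] s h q cont(2) W[of _ 0] by simp
  have 3: "((\<lambda>h. side s a p (x + h *\<^sub>R k + s *\<^sub>R b)) has_real_derivative
      side s a (\<lambda>y. p' y k) (x + h *\<^sub>R k + s *\<^sub>R b)) (at h)"
    using side_derivative[of s h H p p' "x + s *\<^sub>R b" k a W] s h p cont(1) W[of _ _ s]
    by (simp add: add_ac)
  have 4: "((\<lambda>h. side s a p (x + h *\<^sub>R k)) has_real_derivative
      side s a (\<lambda>y. p' y k) (x + h *\<^sub>R k)) (at h)"
    using side_derivative[of s h H p p' x k a W] s h p cont(1) W[of _ _ 0] by simp
  have eq: "loop (\<lambda>y. p' y k) (\<lambda>y. q' y k) a b s (x + h *\<^sub>R k) =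
     side s b (\<lambda>y. q' y k) (x + h *\<^sub>R k + s *\<^sub>R a) - side s b (\<lambda>y. q' y k) (x + h *\<^sub>R k)
     - (side s a (\<lambda>y. p' y k) (x + h *\<^sub>R k + s *\<^sub>R b) - side s a (\<lambda>y. p' y k) (x + h *\<^sub>R k))"
    by (rule loop_split[OF s cont W[OF h]])
  show ?thesis
    unfolding eq
  proof (rule has_field_derivative_transform_within_open[OF DERIV_diff[OF DERIV_diff[OF 1 2] DERIV_diff[OF 3 4]]])
    show "open {-H<..<H}" "h \<in> {-H<..<H}" using h by auto
    show "side s b q (x + h *\<^sub>R k + s *\<^sub>R a) - side s b q (x + h *\<^sub>R k)
       - (side s a p (x + h *\<^sub>R k + s *\<^sub>R b) - side s a p (x + h *\<^sub>R k))
       = loop p q a b s (x + h *\<^sub>R k)" if "h \<in> {-H<..<H}" for h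
      using that by (subst loop_split[OF s c W]) auto
  qed
qed

lemma parallelepiped_subset:
  fixes x :: "'a::real_normed_vector"
  assumes "open W" "x \<in> W"
  obtains H where "H > 0"
    "\<And>h \<sigma> \<tau>. \<bar>h\<bar> < H \<Longrightarrow> \<bar>\<sigma>\<bar> < H \<Longrightarrow> \<bar>\<tau>\<bar> < H \<Longrightarrow> x + h *\<^sub>R k + \<sigma> *\<^sub>R a + \<tau> *\<^sub>R b \<in> W"
proof -
  obtain r where r: "r > 0" "ball x r \<subseteq> W" using assms by (meson openE)
  define H where "H = r / (1 + norm k + norm a + norm b)"
  have pos: "1 + norm k + norm a + norm b > 0" by (simp add: add_pos_nonneg)
  have "H * (1 + norm k + norm a + norm b) = r" using pos by (simp add: H_def)
  then have H: "H > 0" "H + H * norm k + H * norm a + H * norm b = r"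
    using r pos by (simp_all add: H_def distrib_left)
  have "x + h *\<^sub>R k + \<sigma> *\<^sub>R a + \<tau> *\<^sub>R b \<in> W" if "\<bar>h\<bar> < H" "\<bar>\<sigma>\<bar> < H" "\<bar>\<tau>\<bar> < H" for h \<sigma> \<tau>
  proof -
    have "norm (h *\<^sub>R k) \<le> H * norm k" "norm (\<sigma> *\<^sub>R a) \<le> H * norm a" "norm (\<tau> *\<^sub>R b) \<le> H * norm b"
      using that by (simp_all add: mult_right_mono)
    then have "norm (h *\<^sub>R k + \<sigma> *\<^sub>R a + \<tau> *\<^sub>R b) < r"
      using H norm_triangle_ineq[of "h *\<^sub>R k + \<sigma> *\<^sub>R a" "\<tau> *\<^sub>R b"] norm_triangle_ineq[of "h *\<^sub>R k" "\<sigma> *\<^sub>R a"]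
      by linarith
    then have "x + (h *\<^sub>R k + \<sigma> *\<^sub>R a + \<tau> *\<^sub>R b) \<in> ball x r"
      using norm_minus_cancel[of "h *\<^sub>R k + \<sigma> *\<^sub>R a + \<tau> *\<^sub>R b"] by (simp add: dist_norm)
    then show ?thesis using r(2) by (auto simp: add.assoc simp del: mem_ball)
  qed
  with that H show ?thesis by blast
qed

text \<open>Displace a small loop with sides \<open>a\<close>, \<open>b\<close> in the direction \<open>k\<close>: the rate of change of the
  integral of the form \<open>u\<close> is the loop integral of \<open>\<partial>\<^sub>k u = e(k, \<cdot>) - grad u\<^sub>k\<close>, and the
  gradient does not contribute. So \<open>du(a, b)\<close> is differentiable although \<open>u\<close> is only \<open>C\<^sup>1\<close>.\<close>

lemma curl_derivative:
  fixes p q \<phi> :: "'a::real_normed_vector \<Rightarrow> real"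
  assumes W: "open W" "x \<in> W"
    and p: "\<And>y. y \<in> W \<Longrightarrow> (p has_derivative p' y) (at y)"
    and q: "\<And>y. y \<in> W \<Longrightarrow> (q has_derivative q' y) (at y)"
    and \<phi>: "\<And>y. y \<in> W \<Longrightarrow> (\<phi> has_derivative \<phi>' y) (at y)"
    and c: "\<And>v. continuous_on W (\<lambda>y. p' y v)" "\<And>v. continuous_on W (\<lambda>y. q' y v)"
      "\<And>v. continuous_on W (\<lambda>y. \<phi>' y v)"
    and A: "\<And>y. y \<in> W \<Longrightarrow> ((\<lambda>y. p' y k + \<phi>' y a) has_derivative A' y) (at y)"
    and B: "\<And>y. y \<in> W \<Longrightarrow> ((\<lambda>y. q' y k + \<phi>' y b) has_derivative B' y) (at y)"
    and cAB: "continuous_on W (\<lambda>y. A' y b)" "continuous_on W (\<lambda>y. B' y a)"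
  shows "((\<lambda>h. q' (x + h *\<^sub>R k) a - p' (x + h *\<^sub>R k) b) has_real_derivative (B' x a - A' x b)) (at 0)"
proof -
  let ?A = "\<lambda>y. p' y k + \<phi>' y a" and ?B = "\<lambda>y. q' y k + \<phi>' y b"
  define F where "F = B' x a - A' x b"
  define \<omega> where "\<omega> h = q' (x + h *\<^sub>R k) a - p' (x + h *\<^sub>R k) b" for h
  \<comment> \<open>Order of the choices: \<epsilon> determines \<delta> and \<open>d\<close>, then
    \<open>h\<close> is fixed, and only afterwards is \<open>s\<close> made small.\<close>
  have "\<exists>d>0. \<forall>h. norm (h - 0) < d \<longrightarrow> norm (\<omega> h - \<omega> 0 - F * (h - 0)) \<le> \<epsilon> * norm (h - 0)"
    if \<epsilon>: "\<epsilon> > 0" for \<epsilon>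
  proof -
    obtain \<delta> where \<delta>: "\<delta> > 0" "\<And>z s. dist z x < \<delta> \<Longrightarrow> 0 < s \<Longrightarrow> s < \<delta> \<Longrightarrow>
       \<bar>loop ?A ?B a b s z - s\<^sup>2 * F\<bar> \<le> \<epsilon> * s\<^sup>2"
      unfolding F_def by (rule loop_estimate[OF W A B cAB \<epsilon>]) blast+
    obtain H where H: "H > 0" "\<And>h \<sigma> \<tau>. \<bar>h\<bar> < H \<Longrightarrow> \<bar>\<sigma>\<bar> < H \<Longrightarrow> \<bar>\<tau>\<bar> < H \<Longrightarrow>
        x + h *\<^sub>R k + \<sigma> *\<^sub>R a + \<tau> *\<^sub>R b \<in> W"
      using parallelepiped_subset[OF W] by metis
    define d where "d = min H (\<delta> / (1 + norm k))"
    have pos: "1 + norm k > 0" by (simp add: add_pos_nonneg)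
    have d: "d > 0" using H \<delta> pos by (simp add: d_def)
    have close: "dist (x + h *\<^sub>R k) x < \<delta>" if "\<bar>h\<bar> < d" for h
    proof -
      have "\<bar>h\<bar> * norm k \<le> \<bar>h\<bar> * (1 + norm k)" by (simp add: mult_left_mono)
      also have "\<dots> < \<delta>" using that pos by (simp add: d_def pos_less_divide_eq)
      finally show ?thesis by (simp add: dist_norm)
    qed
    have cont: "continuous_on W ?A" "continuous_on W ?B"
      by (intro continuous_on_add c)+
    have loop_deriv: "((\<lambda>h. loop p q a b s (x + h *\<^sub>R k)) has_real_derivative
        loop ?A ?B a b s (x + h *\<^sub>R k)) (at h)"
      if "0 < s" "s < H" "\<bar>h\<bar> < d" for s h
    proof -
      have box: "x + h *\<^sub>R k + \<sigma> *\<^sub>R a + \<tau> *\<^sub>R b \<in> W"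
        if "\<bar>h\<bar> < d" "0 \<le> \<sigma>" "\<sigma> \<le> s" "0 \<le> \<tau>" "\<tau> \<le> s" for h \<sigma> \<tau>
        by (rule H) (use that \<open>s < H\<close> in \<open>auto simp: d_def\<close>)
      have "loop (\<lambda>y. p' y k) (\<lambda>y. q' y k) a b s (x + h *\<^sub>R k)
        = loop ?A ?B a b s (x + h *\<^sub>R k)
          - loop (\<lambda>y. \<phi>' y a) (\<lambda>y. \<phi>' y b) a b s (x + h *\<^sub>R k)"
        using loop_diff[OF _ cont c(3) c(3), of s "x + h *\<^sub>R k" a b a b] box that by simp
      also have "loop (\<lambda>y. \<phi>' y a) (\<lambda>y. \<phi>' y b) a b s (x + h *\<^sub>R k) = 0"
        using that box by (intro loop_gradient[where \<phi>=\<phi>] \<phi>) auto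
      finally have eq: "loop (\<lambda>y. p' y k) (\<lambda>y. q' y k) a b s (x + h *\<^sub>R k)
        = loop ?A ?B a b s (x + h *\<^sub>R k)" by simp
      show ?thesis
        unfolding eq[symmetric]
        by (rule loop_derivative[of s h d W]) (use that p q c box in auto)
    qed
    \<comment> \<open>The mean value theorem in \<open>h\<close> at fixed \<open>s\<close>. At every
      displaced base point the derivative of the loop integral is \<open>s\<^sup>2 * F\<close> up to
      \<open>\<epsilon> * s\<^sup>2\<close>, by the uniformity in
      \<open>loop_estimate\<close>.\<close>
    have key: "\<bar>loop p q a b s (x + h *\<^sub>R k) - loop p q a b s x - h * (s\<^sup>2 * F)\<bar> \<le> \<bar>h\<bar> * (\<epsilon> * s\<^sup>2)"
      if s: "0 < s" "s < H" "s < \<delta>" and h: "\<bar>h\<bar> < d" for s h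
    proof -
      define L where "L h = loop p q a b s (x + h *\<^sub>R k) - h * (s\<^sup>2 * F)" for h
      have "norm (L h - L 0) \<le> (\<epsilon> * s\<^sup>2) * norm (h - 0)"
      proof (rule field_differentiable_bound[of "{-d<..<d}"])
        fix z assume z: "z \<in> {-d<..<d}"
        show "(L has_field_derivative
            loop ?A ?B a b s (x + z *\<^sub>R k) - s\<^sup>2 * F) (at z within {-d<..<d})"
          unfolding L_def using DERIV_diff[OF loop_deriv[OF s(1,2), of z] DERIV_cmult_right[OF DERIV_ident]] z
          by (auto intro: has_field_derivative_at_within)
        show "norm (loop ?A ?B a b s (x + z *\<^sub>R k) - s\<^sup>2 * F) \<le> \<epsilon> * s\<^sup>2"
          using \<delta>(2)[OF close s(1,3), of z] z by auto
      qed (use h d in auto)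
      then show ?thesis by (simp add: L_def mult_ac)
    qed
    have bound: "\<bar>\<omega> h - \<omega> 0 - F * h\<bar> \<le> \<epsilon> * \<bar>h\<bar>" if h: "\<bar>h\<bar> < d" for h
    proof (rule field_le_epsilon)
      fix e :: real assume e: "e > 0"
      have \<omega>0: "\<omega> 0 = q' x a - p' x b" by (simp add: \<omega>_def)
      have e2: "e / 2 > 0" using e by simp
      have xh: "x + h *\<^sub>R k \<in> W" using H(2)[of h 0 0] h H(1) by (simp add: d_def)
      obtain \<delta>1 where \<delta>1: "\<delta>1 > 0" "\<And>z s. dist z (x + h *\<^sub>R k) < \<delta>1 \<Longrightarrow> 0 < s \<Longrightarrow> s < \<delta>1 \<Longrightarrow>
         \<bar>loop p q a b s z - s\<^sup>2 * \<omega> h\<bar> \<le> e / 2 * s\<^sup>2"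
        unfolding \<omega>_def by (rule loop_estimate[OF W(1) xh p q c(1,2) e2]) blast+
      obtain \<delta>0 where \<delta>0: "\<delta>0 > 0" "\<And>z s. dist z x < \<delta>0 \<Longrightarrow> 0 < s \<Longrightarrow> s < \<delta>0 \<Longrightarrow>
         \<bar>loop p q a b s z - s\<^sup>2 * \<omega> 0\<bar> \<le> e / 2 * s\<^sup>2"
        unfolding \<omega>0 by (rule loop_estimate[OF W p q c(1,2) e2]) blast+
      \<comment> \<open>The radius \<delta>1 depends on \<open>h\<close>, so \<open>s\<close> has to
        be chosen after \<open>h\<close>. The two errors \<open>e / 2\<close> come from comparing
        the loop at either end with its curl; all terms carry \<open>s\<^sup>2\<close>, which
        cancels.\<close>
      define s where "s = min (min H \<delta>) (min \<delta>0 \<delta>1) / 2"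
      have s: "0 < s" "s < H" "s < \<delta>" "s < \<delta>0" "s < \<delta>1"
        using H \<delta> \<delta>0 \<delta>1 by (auto simp: s_def)
      have "s\<^sup>2 * \<bar>\<omega> h - \<omega> 0 - F * h\<bar> = \<bar>s\<^sup>2 * (\<omega> h - \<omega> 0 - F * h)\<bar>"
        by (simp add: abs_mult)
      also have "\<dots> = \<bar>s\<^sup>2 * \<omega> h - s\<^sup>2 * \<omega> 0 - h * (s\<^sup>2 * F)\<bar>"
        by (simp add: algebra_simps)
      also have "\<dots> \<le> \<bar>h\<bar> * (\<epsilon> * s\<^sup>2) + e / 2 * s\<^sup>2 + e / 2 * s\<^sup>2"
      proof -
        have "\<bar>loop p q a b s (x + h *\<^sub>R k) - s\<^sup>2 * \<omega> h\<bar> \<le> e / 2 * s\<^sup>2"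
          using \<delta>1 s by (intro \<delta>1(2)) auto
        moreover have "\<bar>loop p q a b s x - s\<^sup>2 * \<omega> 0\<bar> \<le> e / 2 * s\<^sup>2"
          using \<delta>0 s by (intro \<delta>0(2)) auto
        ultimately show ?thesis using key[OF s(1-3) h] by linarith
      qed
      also have "\<dots> = s\<^sup>2 * (\<epsilon> * \<bar>h\<bar> + e)" by (simp add: algebra_simps)
      finally show "\<bar>\<omega> h - \<omega> 0 - F * h\<bar> \<le> \<epsilon> * \<bar>h\<bar> + e" using s(1) by simp
    qed
    then show ?thesis using d by (intro exI[of _ d]) auto
  qed
  then have "(\<omega> has_derivative (*) F) (at 0)"
    unfolding has_derivative_at_alt by (auto simp: bounded_linear_mult_right)
  then show ?thesis
    unfolding has_field_derivative_def F_def \<omega>_def .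
qed

text \<open>The loop integral of a gradient is zero, while divided by \<open>s\<^sup>2\<close> it
  tends to the difference of the two mixed derivatives.\<close>

lemma symmetric_second_derivative_real:
  fixes \<phi> :: "'a::real_normed_vector \<Rightarrow> real"
  assumes W: "open W" "x \<in> W"
    and \<phi>: "\<And>y. y \<in> W \<Longrightarrow> (\<phi> has_derivative \<phi>' y) (at y)"
    and a: "\<And>y. y \<in> W \<Longrightarrow> ((\<lambda>y. \<phi>' y a) has_derivative p' y) (at y)" "continuous_on W (\<lambda>y. p' y b)"
    and b: "\<And>y. y \<in> W \<Longrightarrow> ((\<lambda>y. \<phi>' y b) has_derivative q' y) (at y)" "continuous_on W (\<lambda>y. q' y a)"
  shows "p' x b = q' x a"
proof -
  have "\<bar>q' x a - p' x b\<bar> \<le> 0 + \<epsilon>" if \<epsilon>: "\<epsilon> > 0" for \<epsilon>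
  proof -
    obtain \<delta> where \<delta>: "\<delta> > 0" "\<And>z s. dist z x < \<delta> \<Longrightarrow> 0 < s \<Longrightarrow> s < \<delta> \<Longrightarrow>
       \<bar>loop (\<lambda>y. \<phi>' y a) (\<lambda>y. \<phi>' y b) a b s z - s\<^sup>2 * (q' x a - p' x b)\<bar> \<le> \<epsilon> * s\<^sup>2"
      by (rule loop_estimate[OF W a(1) b(1) a(2) b(2) \<epsilon>]) blast+
    obtain H where H: "H > 0" "\<And>h \<sigma> \<tau>. \<bar>h\<bar> < H \<Longrightarrow> \<bar>\<sigma>\<bar> < H \<Longrightarrow> \<bar>\<tau>\<bar> < H \<Longrightarrow>
        x + h *\<^sub>R 0 + \<sigma> *\<^sub>R a + \<tau> *\<^sub>R b \<in> W"
      using parallelepiped_subset[OF W] by metis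
    define s where "s = min \<delta> H / 2"
    have s: "0 < s" "s < \<delta>" "s < H" using \<delta> H by (auto simp: s_def)
    have "loop (\<lambda>y. \<phi>' y a) (\<lambda>y. \<phi>' y b) a b s x = 0"
      using s H(2)[of 0] by (intro loop_gradient[where \<phi>=\<phi>] \<phi>) auto
    then have "s\<^sup>2 * \<bar>q' x a - p' x b\<bar> \<le> s\<^sup>2 * \<epsilon>"
      using \<delta>(2)[of x s] s \<delta>(1) by (simp add: abs_mult mult_ac)
    then show ?thesis using s(1) by simp
  qed
  then have "\<bar>q' x a - p' x b\<bar> \<le> 0" by (rule field_le_epsilon)
  then show ?thesis by simp
qed

text \<open>\<open>curl_derivative\<close> delivers derivatives one direction at a time. Linearity
  in the direction and continuity of the coefficients make \<open>F y\<close> close to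
  \<open>F x\<close> uniformly over directions; the mean value theorem on the segment then yields
  the full derivative.\<close>

lemma directional_imp_has_derivative:
  fixes f :: "real^'i::finite \<Rightarrow> real"
  assumes W: "open W" "x \<in> W"
    and lin: "\<And>y. y \<in> W \<Longrightarrow> linear (F y)"
    and d: "\<And>y v. y \<in> W \<Longrightarrow> ((\<lambda>h. f (y + h *\<^sub>R v)) has_real_derivative F y v) (at 0)"
    and cont: "\<And>i. continuous_on W (\<lambda>y. F y (axis i 1))"
  shows "(f has_derivative F x) (at x)"
proof -
  have "\<exists>r>0. \<forall>y. norm (y - x) < r \<longrightarrow> norm (f y - f x - F x (y - x)) \<le> \<epsilon> * norm (y - x)"
    if "\<epsilon> > 0" for \<epsilon>
  proof -
    define \<epsilon>' where "\<epsilon>' = \<epsilon> / real CARD('i)"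
    have \<epsilon>': "\<epsilon>' > 0" using that by (simp add: \<epsilon>'_def)
    obtain r0 where r0: "r0 > 0" "ball x r0 \<subseteq> W" using W by (meson openE)
    have "\<exists>r>0. \<forall>y. dist y x < r \<longrightarrow> dist (F y (axis i 1)) (F x (axis i 1)) < \<epsilon>'" for i
      using cont[of i] W \<epsilon>' unfolding continuous_on_eq_continuous_at[OF W(1)] continuous_at_eps_delta by blast
    then obtain \<rho> where \<rho>: "\<And>i. \<rho> i > 0" "\<And>i y. dist y x < \<rho> i \<Longrightarrow> dist (F y (axis i 1)) (F x (axis i 1)) < \<epsilon>'"
      by metis
    define r where "r = Min (insert r0 (range \<rho>))"
    have r: "r > 0" "r \<le> r0" "\<And>i. r \<le> \<rho> i" using r0 \<rho>(1) by (auto simp: r_def intro: min.coboundedI2)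
    have close: "\<bar>F y v - F x v\<bar> \<le> \<epsilon> * norm v" if "dist y x < r" for y v
    proof -
      have y: "y \<in> W" using that r r0 by (auto simp: dist_commute)
      have "F y v - F x v = (\<Sum>i\<in>UNIV. v $ i * (F y (axis i 1) - F x (axis i 1)))"
        using linear_axis_expansion[OF lin[OF y], of v] linear_axis_expansion[OF lin[OF W(2)], of v]
        by (simp add: sum_subtractf right_diff_distrib)
      also have "\<bar>\<dots>\<bar> \<le> (\<Sum>i\<in>(UNIV::'i set). norm v * \<epsilon>')"
      proof (rule order_trans[OF sum_abs sum_mono])
        fix i
        have "\<bar>F y (axis i 1) - F x (axis i 1)\<bar> \<le> \<epsilon>'"
          using \<rho>(2)[of y i] that r(3)[of i] by (simp add: dist_real_def)
        then show "\<bar>v $ i * (F y (axis i 1) - F x (axis i 1))\<bar> \<le> norm v * \<epsilon>'"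
          by (simp add: abs_mult mult_mono component_le_norm_cart)
      qed
      finally show ?thesis by (simp add: \<epsilon>'_def mult_ac)
    qed
    have "norm (f y - f x - F x (y - x)) \<le> \<epsilon> * norm (y - x)" if y: "norm (y - x) < r" for y
    proof -
      define v where "v = y - x"
      define \<phi> where "\<phi> t = f (x + t *\<^sub>R v) - t * F x v" for t
      have seg: "dist (x + t *\<^sub>R v) x < r" if "t \<in> {0..1}" for t
      proof -
        have "norm (t *\<^sub>R v) \<le> norm v" using that by (simp add: mult_left_le_one_le)
        then show ?thesis using y by (simp add: v_def dist_norm)
      qed
      have "norm (\<phi> 1 - \<phi> 0) \<le> (\<epsilon> * norm v) * norm (1 - 0 :: real)"
      proof (rule field_differentiable_bound[of "{0..1}"])
        fix t :: real assume t: "t \<in> {0..1}"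
        have "x + t *\<^sub>R v \<in> W" using seg[OF t] r r0 by (auto simp: dist_commute)
        then have "((\<lambda>h. f (x + t *\<^sub>R v + h *\<^sub>R v)) has_real_derivative F (x + t *\<^sub>R v) v) (at 0)"
          by (rule d)
        then have "((\<lambda>h. f (x + h *\<^sub>R v)) has_real_derivative F (x + t *\<^sub>R v) v) (at t)"
          using DERIV_shift[of "\<lambda>h. f (x + h *\<^sub>R v)" _ 0 t] by (simp add: algebra_simps)
        from DERIV_diff[OF this DERIV_cmult_right[OF DERIV_ident]]
        show "(\<phi> has_field_derivative F (x + t *\<^sub>R v) v - F x v) (at t within {0..1})"
          unfolding \<phi>_def by (auto intro: has_field_derivative_at_within)
        show "norm (F (x + t *\<^sub>R v) v - F x v) \<le> \<epsilon> * norm v"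
          using close[OF seg[OF t]] by simp
      qed auto
      then show ?thesis by (simp add: \<phi>_def v_def algebra_simps)
    qed
    with r(1) show ?thesis by blast
  qed
  then show ?thesis
    unfolding has_derivative_at_alt using lin[OF W(2)] linear_conv_bounded_linear by auto
qed

lemma has_derivative_D_on_open:
  assumes "open W" "C_on (Suc k) W f" "x \<in> W"
  shows "(f has_derivative D_on W f x) (at x)"
  using has_derivative_D_on[OF assms(2,3)] at_within_open[OF assms(3,1)] by simp

lemma continuous_on_D_on:
  assumes "thick S" "C_on (Suc k) S f"
  shows "continuous_on S (\<lambda>x. D_on S f x v)"
  by (rule C_on_imp_continuous_on[OF C_on_D_on[OF assms]])

lemma D_on_sum_cmult:
  fixes u :: "'j \<Rightarrow> real^'i::finite \<Rightarrow> real"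
  assumes "thick S" "x \<in> S" "\<And>j. C_on (Suc k) S (u j)"
  shows "D_on S (\<lambda>y. \<Sum>j\<in>J. c j * u j y) x v = (\<Sum>j\<in>J. c j * D_on S (u j) x v)"
  by (subst D_on_eq[OF assms(1,2) has_derivative_sum[OF has_derivative_mult_right[OF has_derivative_D_on[OF assms(3,2)]]]])
    simp

lemma partial_sum_cmult:
  fixes u :: "'j \<Rightarrow> real^'i::finite \<Rightarrow> real"
  assumes "thick S" "x \<in> S" "\<And>j. C_on (Suc k) S (u j)"
  shows "partial S i (\<lambda>y. \<Sum>j\<in>J. c j * u j y) x = (\<Sum>j\<in>J. c j * partial S i (u j) x)"
  unfolding partial_def by (rule D_on_sum_cmult[OF assms])

text \<open>In the language of elasticity, the gradient of the rotation of a displacement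
  \<open>u\<close> is made of first derivatives of the strain \<open>E\<close>. For
  \<open>C\<^sup>2\<close> fields this is a commutation of derivatives; here the loop argument
  proves it, and the right-hand side \<open>F\<close> is continuous because \<open>E\<close> is
  \<open>C\<^sup>1\<close>.\<close>

lemma C_on_curl:
  fixes u :: "'i::finite \<Rightarrow> real^'i \<Rightarrow> real"
  assumes W: "open W" and u: "\<And>i. C_on 1 W (u i)"
    and e: "\<And>i j. C_on 1 W (\<lambda>x. partial W i (u j) x + partial W j (u i) x)"
  shows "C_on 1 W (\<lambda>x. partial W a (u b) x - partial W b (u a) x)"
proof -
  define E where "E i j x = partial W i (u j) x + partial W j (u i) x" for i j x
  have T: "thick W" by (rule open_thick[OF W])
  have u1: "C_on (Suc 0) W (u i)" for i using u[of i] by simp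
  have E1: "C_on (Suc 0) W (E i j)" for i j using e[of i j] by (simp add: E_def[abs_def])
  define F where "F x v = (\<Sum>k\<in>UNIV. v $ k * (partial W a (E k b) x - partial W b (E k a) x))" for x v
  have deriv: "((\<lambda>h. partial W a (u b) (x + h *\<^sub>R v) - partial W b (u a) (x + h *\<^sub>R v)) has_real_derivative F x v) (at 0)"
    if x: "x \<in> W" for x v
  proof -
    \<comment> \<open>For a direction \<open>v\<close> that is not a coordinate axis, the component
      of the one-form along the displacement is its contraction with the constant vector
      \<open>v\<close>.\<close>
    define \<phi> where "\<phi> y = (\<Sum>k\<in>UNIV. v $ k * u k y)" for y
    have \<phi>: "C_on (Suc 0) W \<phi>"
      unfolding \<phi>_def by (intro C_on_sum C_on_cmult T u1)
    have eq: "D_on W (u c) y v + D_on W \<phi> y (axis c 1) = (\<Sum>k\<in>UNIV. v $ k * E k c y)" if "y \<in> W" for c y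
      unfolding D_on_expansion[OF u1 that] \<phi>_def E_def partial_def[symmetric] partial_sum_cmult[OF T that u1]
      by (simp add: sum.distrib algebra_simps)
    have EC: "C_on (Suc 0) W (\<lambda>y. \<Sum>k\<in>UNIV. v $ k * E k c y)" for c
      by (intro C_on_sum C_on_cmult T E1)
    have dE: "((\<lambda>y. D_on W (u c) y v + D_on W \<phi> y (axis c 1)) has_derivative
        D_on W (\<lambda>y. \<Sum>k\<in>UNIV. v $ k * E k c y) y) (at y)" if "y \<in> W" for c y
      by (rule has_derivative_transform_within_open[OF has_derivative_D_on_open[OF W EC that] W that])
        (simp add: eq)
    have "((\<lambda>h. D_on W (u b) (x + h *\<^sub>R v) (axis a 1) - D_on W (u a) (x + h *\<^sub>R v) (axis b 1)) has_real_derivative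
        (D_on W (\<lambda>y. \<Sum>k\<in>UNIV. v $ k * E k b y) x (axis a 1) - D_on W (\<lambda>y. \<Sum>k\<in>UNIV. v $ k * E k a y) x (axis b 1))) (at 0)"
      by (rule curl_derivative[where \<phi>=\<phi>, OF W x has_derivative_D_on_open[OF W u1] has_derivative_D_on_open[OF W u1]
          has_derivative_D_on_open[OF W \<phi>] continuous_on_D_on[OF T u1] continuous_on_D_on[OF T u1]
          continuous_on_D_on[OF T \<phi>] dE dE continuous_on_D_on[OF T EC] continuous_on_D_on[OF T EC]])
    then show ?thesis
      unfolding F_def partial_def D_on_sum_cmult[OF T x E1]
      by (simp add: sum_subtractf right_diff_distrib)
  qed
  have Flin: "linear (F x)" for x
    unfolding F_def by (intro linearI) (simp_all add: distrib_right sum.distrib sum_distrib_left mult_ac)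
  have Fax: "F y (axis i 1) = partial W a (E i b) y - partial W b (E i a) y" for y i
    unfolding F_def by (simp add: axis_def if_distrib[of "\<lambda>x. x * _"] cong: if_cong)
  have Fcont: "continuous_on W (\<lambda>y. F y (axis i 1))" for i
    unfolding Fax using E1 by (intro continuous_on_diff) auto
  have D: "((\<lambda>x. partial W a (u b) x - partial W b (u a) x) has_derivative F x) (at x)" if "x \<in> W" for x
    by (rule directional_imp_has_derivative[OF W that Flin deriv Fcont])
  have "C_on 0 W (partial W i (\<lambda>x. partial W a (u b) x - partial W b (u a) x))" for i
    using Fcont[of i] partial_eq[OF T _ has_derivative_at_withinI[OF D]]
    by (auto intro!: C_on_congI[of 0 W "\<lambda>y. F y (axis i 1)"])
  then show ?thesis
    using D unfolding One_nat_def C_on.simps(2) differentiable_on_def differentiable_def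
    by (blast intro: has_derivative_at_withinI)
qed

text \<open>Each entry of the gradient is half the sum of its symmetric part, given as
  \<open>C\<^sup>1\<close>, and its antisymmetric part, which is \<open>C\<^sup>1\<close> by
  \<open>C_on_curl\<close>.\<close>

lemma C2_of_C1_symmetric_gradient:
  fixes u :: "'i::finite \<Rightarrow> real^'i \<Rightarrow> real"
  assumes W: "open W" and u: "\<And>i. C_on 1 W (u i)"
    and e: "\<And>i j. C_on 1 W (\<lambda>x. partial W i (u j) x + partial W j (u i) x)"
  shows "C_on 2 W (u b)"
proof -
  have T: "thick W" by (rule open_thick[OF W])
  have "C_on 1 W (partial W a (u b))" for a
  proof -
    have "C_on 1 W (\<lambda>x. (1/2) * ((partial W a (u b) x + partial W b (u a) x) + (partial W a (u b) x - partial W b (u a) x)))"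
      by (intro C_on_cmult[OF T] C_on_add[OF T] e C_on_curl[OF W u e])
    then show ?thesis by simp
  qed
  then show ?thesis using u[of b] by (simp add: numeral_2_eq_2)
qed

lemma symmetric_second_derivative:
  fixes f :: "real^'i::finite \<Rightarrow> 'b::euclidean_space"
  assumes W: "open W" "x \<in> W" and f: "C_on 2 W f"
  shows "D_on W (\<lambda>y. D_on W f y a) x b = D_on W (\<lambda>y. D_on W f y b) x a"
proof (rule euclidean_eqI)
  fix j :: 'b assume "j \<in> Basis"
  have T: "thick W" by (rule open_thick[OF W(1)])
  have f2: "C_on (Suc 1) W f" using f by (simp add: numeral_2_eq_2)
  have f1: "C_on (Suc 0) W (\<lambda>y. D_on W f y v)" for v
    using C_on_D_on[OF T f2] by simp
  have comp: "((\<lambda>y. h y \<bullet> j) has_derivative (\<lambda>v. h' v \<bullet> j)) (at y)"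
    if "(h has_derivative h') (at y)" for h :: "real^'i \<Rightarrow> 'b" and h' y
    using bounded_linear.has_derivative[OF bounded_linear_inner_left that] .
  show "D_on W (\<lambda>y. D_on W f y a) x b \<bullet> j = D_on W (\<lambda>y. D_on W f y b) x a \<bullet> j"
    by (rule symmetric_second_derivative_real[of W x "\<lambda>y. f y \<bullet> j" "\<lambda>y v. D_on W f y v \<bullet> j" a
          "\<lambda>y v. D_on W (\<lambda>y. D_on W f y a) y v \<bullet> j" b "\<lambda>y v. D_on W (\<lambda>y. D_on W f y b) y v \<bullet> j"])
      (intro W comp has_derivative_D_on_open[OF W(1) f2] has_derivative_D_on_open[OF W(1) f1]
        bounded_linear.continuous_on[OF bounded_linear_inner_left] continuous_on_D_on[OF T f1]; assumption)+
qed

section \<open>Killing fields in a coordinate domain\<close>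

text \<open>The body is that of \<open>inner_at\<close> with the matrix as a free argument, so that
  derivatives of the metric can be inserted as well as the metric.\<close>

definition bil :: "real^'i^'i::finite \<Rightarrow> real^'i \<Rightarrow> real^'i \<Rightarrow> real" where
  "bil M a b = (\<Sum>i\<in>UNIV. \<Sum>j\<in>UNIV. M $ i $ j * a $ i * b $ j)"

lemma bil_add:
  "bil (M + N) a b = bil M a b + bil N a b"
  "bil M (a + a') b = bil M a b + bil M a' b"
  "bil M a (b + b') = bil M a b + bil M a b'"
  by (simp_all add: bil_def algebra_simps sum.distrib)

lemma bil_diff:
  "bil (M - N) a b = bil M a b - bil N a b"
  "bil M (a - a') b = bil M a b - bil M a' b"
  "bil M a (b - b') = bil M a b - bil M a b'"
  by (simp_all add: bil_def algebra_simps sum_subtractf)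

lemma bil_scaleR:
  "bil (c *\<^sub>R M) a b = c * bil M a b"
  "bil M (c *\<^sub>R a) b = c * bil M a b"
  "bil M a (c *\<^sub>R b) = c * bil M a b"
  by (simp_all add: bil_def algebra_simps sum_distrib_left)

lemma bil_zero [simp]: "bil 0 a b = 0" "bil M 0 b = 0" "bil M a 0 = 0"
  by (simp_all add: bil_def)

lemma bil_eq_inner: "bil M a b = a \<bullet> (M *v b)"
  by (simp add: bil_def matrix_vector_mult_def inner_vec_def sum_distrib_left mult_ac)

lemma bil_axis: "bil M (axis i 1) (axis j 1) = M $ i $ j"
  by (simp add: bil_eq_inner matrix_vector_mult_basis inner_axis' column_def)

lemma bil_axis_left: "bil M (axis i 1) b = (\<Sum>j\<in>UNIV. M $ i $ j * b $ j)"
  by (simp add: bil_eq_inner inner_axis' matrix_vector_mult_def)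

lemma bil_axis_right: "bil M a (axis j 1) = (\<Sum>i\<in>UNIV. M $ i $ j * a $ i)"
  by (simp add: bil_eq_inner matrix_vector_mult_basis column_def inner_vec_def mult.commute)

lemma bil_transpose: "bil (transpose M) a b = bil M b a"
proof -
  have "bil (transpose M) a b = (\<Sum>i\<in>UNIV. \<Sum>j\<in>UNIV. M $ j $ i * b $ j * a $ i)"
    by (simp add: bil_def transpose_def mult_ac)
  also have "\<dots> = bil M b a" unfolding bil_def by (rule sum.swap)
  finally show ?thesis .
qed

lemma bil_bound:
  fixes M :: "real^'i::finite^'i"
  assumes "\<And>i j. \<bar>M $ i $ j\<bar> \<le> m"
  shows "\<bar>bil M a b\<bar> \<le> (real CARD('i))\<^sup>2 * m * norm a * norm b"
proof -
  have m: "m \<ge> 0" using assms[of undefined undefined] by linarith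
  have "\<bar>bil M a b\<bar> \<le> (\<Sum>i\<in>UNIV. \<bar>\<Sum>j\<in>UNIV. M $ i $ j * a $ i * b $ j\<bar>)"
    unfolding bil_def by (rule sum_abs)
  also have "\<dots> \<le> (\<Sum>i\<in>UNIV. \<Sum>j\<in>UNIV. \<bar>M $ i $ j * a $ i * b $ j\<bar>)"
    by (intro sum_mono sum_abs)
  also have "\<dots> \<le> (\<Sum>i\<in>(UNIV::'i set). \<Sum>j\<in>(UNIV::'i set). m * norm a * norm b)"
    unfolding abs_mult by (intro sum_mono mult_mono assms component_le_norm_cart) (auto simp: m)
  finally show ?thesis by (simp add: power2_eq_square mult_ac)
qed

lemma C_on_bil:
  assumes "thick S" "C_on k S M" "C_on k S A" "C_on k S B"
  shows "C_on k S (\<lambda>x. bil (M x) (A x) (B x))"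
  unfolding bil_def using assms by (intro C_on_sum C_on_mult C_on_vec_nth) auto

lemma has_derivative_bil:
  assumes "(M has_derivative M') (at x within S)" "(A has_derivative A') (at x within S)"
    "(B has_derivative B') (at x within S)"
  shows "((\<lambda>y. bil (M y) (A y) (B y)) has_derivative
     (\<lambda>h. bil (M' h) (A x) (B x) + bil (M x) (A' h) (B x) + bil (M x) (A x) (B' h))) (at x within S)"
proof -
  note nth = bounded_linear.has_derivative[OF bounded_linear_vec_nth]
  have "((\<lambda>y. bil (M y) (A y) (B y)) has_derivative
    (\<lambda>h. \<Sum>i\<in>UNIV. \<Sum>j\<in>UNIV. M x $ i $ j * A x $ i * B' h $ j + (M x $ i $ j * A' h $ i + M' h $ i $ j * A x $ i) * B x $ j)) (at x within S)"
    unfolding bil_def by (intro has_derivative_sum has_derivative_mult nth assms)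
  moreover have "(\<Sum>i\<in>UNIV. \<Sum>j\<in>UNIV. M x $ i $ j * A x $ i * B' h $ j + (M x $ i $ j * A' h $ i + M' h $ i $ j * A x $ i) * B x $ j)
    = bil (M' h) (A x) (B x) + bil (M x) (A' h) (B x) + bil (M x) (A x) (B' h)" for h
    by (simp add: bil_def sum.distrib algebra_simps)
  ultimately show ?thesis by simp
qed

lemma C_on_D_on_app:
  assumes T: "thick S" and f: "C_on (Suc k) S f" and X: "C_on k S X"
  shows "C_on k S (\<lambda>y. D_on S f y (X y))"
proof -
  have "C_on k S (\<lambda>y. \<Sum>i\<in>UNIV. X y $ i *\<^sub>R partial S i f y)"
    using f by (intro C_on_sum C_on_scaleR C_on_vec_nth T X) auto
  then show ?thesis by (rule C_on_congI) (rule D_on_expansion[OF f])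
qed

text \<open>A product rule: one term differentiates \<open>f\<close> a second time with the vector
  frozen at \<open>X x\<close>, the other moves the vector. Expanding in partial derivatives avoids
  operator-valued derivatives.\<close>

lemma has_derivative_D_on_app:
  assumes T: "thick S" and x: "x \<in> S" and f: "C_on (Suc (Suc k)) S f" and X: "(X has_derivative X') (at x within S)"
  shows "((\<lambda>y. D_on S f y (X y)) has_derivative
     (\<lambda>a. D_on S (\<lambda>y. D_on S f y (X x)) x a + D_on S f x (X' a))) (at x within S)"
proof -
  have f1: "C_on (Suc k) S (partial S i f)" for i using f by simp
  note pd = has_derivative_D_on[OF f1 x]
  have 1: "((\<lambda>y. \<Sum>i\<in>UNIV. X y $ i *\<^sub>R partial S i f y) has_derivative
    (\<lambda>a. \<Sum>i\<in>UNIV. X x $ i *\<^sub>R D_on S (partial S i f) x a + X' a $ i *\<^sub>R partial S i f x)) (at x within S)"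
    by (intro has_derivative_sum has_derivative_scaleR bounded_linear.has_derivative[OF bounded_linear_vec_nth X] pd)
  have 2: "((\<lambda>y. \<Sum>i\<in>UNIV. X x $ i *\<^sub>R partial S i f y) has_derivative
    (\<lambda>a. \<Sum>i\<in>UNIV. X x $ i *\<^sub>R D_on S (partial S i f) x a)) (at x within S)"
    by (intro has_derivative_sum has_derivative_scaleR_right pd)
  have "D_on S (\<lambda>y. D_on S f y (X x)) x = D_on S (\<lambda>y. \<Sum>i\<in>UNIV. X x $ i *\<^sub>R partial S i f y) x"
    by (rule D_on_cong[OF D_on_expansion[OF f] x])
  also have "\<dots> = (\<lambda>a. \<Sum>i\<in>UNIV. X x $ i *\<^sub>R D_on S (partial S i f) x a)"
    by (rule D_on_eq[OF T x 2])
  finally have eq: "(\<lambda>a. \<Sum>i\<in>UNIV. X x $ i *\<^sub>R D_on S (partial S i f) x a + X' a $ i *\<^sub>R partial S i f x)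
      = (\<lambda>a. D_on S (\<lambda>y. D_on S f y (X x)) x a + D_on S f x (X' a))"
    by (simp add: D_on_expansion[OF f x, of "X' _"] sum.distrib fun_eq_iff)
  show ?thesis
    using has_derivative_transform[OF x D_on_expansion[OF f] 1] unfolding eq by blast
qed

text \<open>The Lie derivative of \<open>g\<close> along \<open>X\<close> with arbitrary vectors in
  both slots. Frame fields and vectors such as \<open>D_on S Y x a\<close> will be inserted there,
  not only coordinate vectors.\<close>

definition killing_at :: "(real^'i::finite) set \<Rightarrow> (real^'i \<Rightarrow> real^'i^'i) \<Rightarrow> (real^'i \<Rightarrow> real^'i) \<Rightarrow> real^'i \<Rightarrow> bool" where
  "killing_at S g X x \<longleftrightarrow>
     (\<forall>a b. bil (D_on S g x (X x)) a b + bil (g x) (D_on S X x a) b + bil (g x) a (D_on S X x b) = 0)"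

definition lie_bracket :: "(real^'i::finite) set \<Rightarrow> (real^'i \<Rightarrow> real^'i) \<Rightarrow> (real^'i \<Rightarrow> real^'i) \<Rightarrow> real^'i \<Rightarrow> real^'i" where
  "lie_bracket S X Y x = D_on S Y x (X x) - D_on S X x (Y x)"

lemma C_on_lie_bracket:
  assumes "thick S" "C_on (Suc k) S X" "C_on (Suc k) S Y"
  shows "C_on k S (lie_bracket S X Y)"
proof -
  have "C_on k S (\<lambda>x. D_on S Y x (X x) - D_on S X x (Y x))"
    using assms C_on_Suc_imp by (intro C_on_diff C_on_D_on_app) blast+
  then show ?thesis by (rule C_on_congI) (simp add: lie_bracket_def)
qed

text \<open>The Killing equation expresses the symmetrized gradient of the lowered field by \<open>X\<close> and the
  first derivatives of \<open>g\<close>, which are as regular as \<open>X\<close> itself.\<close>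

lemma killing_C2:
  fixes g :: "real^'i::finite \<Rightarrow> real^'i^'i"
  assumes W: "open W" and g: "C_on 2 W g" "\<And>x. x \<in> W \<Longrightarrow> transpose (g x) = g x" "\<And>x. x \<in> W \<Longrightarrow> invertible (g x)"
    and X: "C_on 1 W X" and K: "\<And>x. x \<in> W \<Longrightarrow> killing_at W g X x"
  shows "C_on 2 W X"
proof -
  have T: "thick W" by (rule open_thick[OF W])
  have g2: "C_on (Suc 1) W g" using g(1) by (simp add: numeral_2_eq_2)
  have g1: "C_on 1 W g" by (rule C_on_le[OF g(1)]) simp
  have X1: "C_on (Suc 0) W X" and g1': "C_on (Suc 0) W g" using X g1 by simp_all
  define u where "u j x = bil (g x) (axis j 1) (X x)" for j x
  have u1: "C_on 1 W (u j)" for j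
    unfolding u_def[abs_def] by (rule C_on_bil[OF T g1 C_on_const[OF T] X])
  have du: "partial W i (u j) x = bil (D_on W g x (axis i 1)) (axis j 1) (X x) + bil (g x) (axis j 1) (D_on W X x (axis i 1))"
    if "x \<in> W" for i j x
    unfolding u_def[abs_def]
    using partial_eq[OF T that has_derivative_bil[OF has_derivative_D_on[OF g1' that] has_derivative_const has_derivative_D_on[OF X1 that]]]
    by simp
  have e: "C_on 1 W (\<lambda>x. partial W i (u j) x + partial W j (u i) x)" for i j
  proof -
    have "C_on 1 W (\<lambda>x. bil (D_on W g x (axis i 1)) (axis j 1) (X x) + bil (D_on W g x (axis j 1)) (axis i 1) (X x)
        - bil (D_on W g x (X x)) (axis i 1) (axis j 1))"
      by (intro C_on_diff C_on_add C_on_bil T C_on_D_on_app g2 C_on_const X)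
    then show ?thesis
    proof (rule C_on_congI)
      fix x assume x: "x \<in> W"
      have "bil (g x) (D_on W X x (axis i 1)) (axis j 1) = bil (g x) (axis j 1) (D_on W X x (axis i 1))"
        using bil_transpose[of "g x"] g(2)[OF x] by simp
      then show "partial W i (u j) x + partial W j (u i) x = bil (D_on W g x (axis i 1)) (axis j 1) (X x) + bil (D_on W g x (axis j 1)) (axis i 1) (X x)
        - bil (D_on W g x (X x)) (axis i 1) (axis j 1)"
        unfolding du[OF x] using K[OF x, unfolded killing_at_def, rule_format, of "axis i 1" "axis j 1"] by simp
    qed
  qed
  have u2: "C_on 2 W (u j)" for j by (rule C2_of_C1_symmetric_gradient[OF W u1 e])
  \<comment> \<open>Raising the index again loses nothing: the entries of the inverse of a
    \<open>C\<^sup>2\<close> matrix are \<open>C\<^sup>2\<close>.\<close>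
  have X_eq: "X x $ k = (\<Sum>j\<in>UNIV. matrix_inv (g x) $ k $ j * u j x)" if "x \<in> W" for x k
  proof -
    have "matrix_inv (g x) *v (g x *v X x) = X x"
      using g(3)[OF that] by (simp add: matrix_vector_mul_assoc matrix_inv_mult)
    then have "X x $ k = (matrix_inv (g x) *v (g x *v X x)) $ k" by simp
    also have "\<dots> = (\<Sum>j\<in>UNIV. matrix_inv (g x) $ k $ j * (g x *v X x) $ j)"
      by (subst matrix_vector_mult_def) simp
    also have "\<dots> = (\<Sum>j\<in>UNIV. matrix_inv (g x) $ k $ j * u j x)"
      by (simp add: u_def bil_eq_inner inner_axis')
    finally show ?thesis .
  qed
  show ?thesis
  proof (rule C_on_vec[OF T])
    fix k
    have "C_on 2 W (\<lambda>x. \<Sum>j\<in>UNIV. matrix_inv (g x) $ k $ j * u j x)"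
      by (intro C_on_sum C_on_mult T C_on_matrix_inv u2 g(3) C_on_vec_nth g(1))
    then show "C_on 2 W (\<lambda>x. X x $ k)" by (rule C_on_congI) (rule X_eq)
  qed
qed

lemma D_on_zero:
  assumes "thick S" "x \<in> S" "\<And>y. y \<in> S \<Longrightarrow> f y = 0"
  shows "D_on S f x v = 0"
proof -
  have "(f has_derivative (\<lambda>_. 0)) (at x within S)"
    by (rule has_derivative_transform[OF assms(2) assms(3)]) auto
  from D_on_eq[OF assms(1,2) this] show ?thesis by simp
qed

text \<open>This is the rule that the Lie derivative along a bracket is the commutator of the Lie
  derivatives. The Killing equation of \<open>Y\<close> is differentiated along \<open>X\<close>,
  that of \<open>X\<close> along \<open>Y\<close>, and the results are subtracted. Second
  derivatives of \<open>g\<close> cancel by symmetry, those of the fields belong to the derivative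
  of the bracket, and the mixed first-order terms are removed by the Killing equations with
  \<open>XX\<close> or \<open>YY\<close> applied in one slot.\<close>

lemma killing_lie_bracket:
  fixes g :: "real^'i::finite \<Rightarrow> real^'i^'i"
  assumes W: "open W" and x: "x \<in> W" and g: "C_on 2 W g"
    and X: "C_on 2 W X" "\<And>x. x \<in> W \<Longrightarrow> killing_at W g X x"
    and Y: "C_on 2 W Y" "\<And>x. x \<in> W \<Longrightarrow> killing_at W g Y x"
  shows "killing_at W g (lie_bracket W X Y) x"
proof -
  have T: "thick W" by (rule open_thick[OF W])
  define G where "G = D_on W g x"
  define XX where "XX = D_on W X x"
  define YY where "YY = D_on W Y x"
  define G2 where "G2 v = D_on W (\<lambda>y. D_on W g y v) x" for v
  have C1: "C_on (Suc 0) W f" if "C_on 2 W f" for f :: "real^'i \<Rightarrow> 'b::real_normed_vector"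
    using C_on_le[OF that, of "Suc 0"] by simp
  have C2: "C_on (Suc (Suc 0)) W f" if "C_on 2 W f" for f :: "real^'i \<Rightarrow> 'b::real_normed_vector"
    using that by (simp only: numeral_2_eq_2)
  note hd = has_derivative_D_on[OF C1 x]
  have hd2: "((\<lambda>y. D_on W f y a) has_derivative D_on W (\<lambda>y. D_on W f y a) x) (at x within W)"
    if "C_on 2 W f" for f :: "real^'i \<Rightarrow> 'b::real_normed_vector" and a
    by (rule has_derivative_D_on[OF C_on_D_on[OF T C2[OF that]] x])
  \<comment> \<open>The left side of the Killing equation is zero on all of \<open>W\<close>, hence
    so is its derivative along \<open>v\<close>, which the product rule expands.\<close>
  have prolong: "bil (G2 (P x) v + G (D_on W P x v)) a b
      + (bil (G v) (D_on W P x a) b + bil (g x) (D_on W (\<lambda>y. D_on W P y a) x v) b)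
      + (bil (G v) a (D_on W P x b) + bil (g x) a (D_on W (\<lambda>y. D_on W P y b) x v)) = 0"
    if P: "C_on 2 W P" "\<And>x. x \<in> W \<Longrightarrow> killing_at W g P x" for P v a b
  proof -
    have "((\<lambda>y. bil (D_on W g y (P y)) a b + bil (g y) (D_on W P y a) b + bil (g y) a (D_on W P y b)) has_derivative
      (\<lambda>v. (bil (G2 (P x) v + G (D_on W P x v)) a b + bil (D_on W g x (P x)) 0 b + bil (D_on W g x (P x)) a 0)
      + (bil (G v) (D_on W P x a) b + bil (g x) (D_on W (\<lambda>y. D_on W P y a) x v) b + bil (g x) (D_on W P x a) 0)
      + (bil (G v) a (D_on W P x b) + bil (g x) 0 (D_on W P x b) + bil (g x) a (D_on W (\<lambda>y. D_on W P y b) x v)))) (at x within W)"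
      unfolding G_def G2_def
      by (intro has_derivative_add has_derivative_bil has_derivative_const hd[OF g] hd2[OF P(1)]
          has_derivative_D_on_app[OF T x C2[OF g] hd[OF P(1)]])
    from D_on_eq[OF T x this]
    show ?thesis
      using D_on_zero[OF T x, of "\<lambda>y. bil (D_on W g y (P y)) a b + bil (g y) (D_on W P y a) b + bil (g y) a (D_on W P y b)" v]
        P(2) unfolding killing_at_def by simp
  qed
  have sym: "D_on W (\<lambda>y. D_on W f y v) x w = D_on W (\<lambda>y. D_on W f y w) x v"
    if "C_on 2 W f" for f :: "real^'i \<Rightarrow> 'b::euclidean_space" and v w
    by (rule symmetric_second_derivative[OF W x that])
  have dZ: "D_on W (lie_bracket W X Y) x a
      = (D_on W (\<lambda>y. D_on W Y y (X x)) x a + YY (XX a)) - (D_on W (\<lambda>y. D_on W X y (Y x)) x a + XX (YY a))" for a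
  proof -
    have "(lie_bracket W X Y has_derivative (\<lambda>a. (D_on W (\<lambda>y. D_on W Y y (X x)) x a + YY (XX a))
        - (D_on W (\<lambda>y. D_on W X y (Y x)) x a + XX (YY a)))) (at x within W)"
      unfolding lie_bracket_def[abs_def] XX_def YY_def
      by (intro has_derivative_diff has_derivative_D_on_app[OF T x C2] hd X(1) Y(1))
    from D_on_eq[OF T x this] show ?thesis by simp
  qed
  have Zx: "lie_bracket W X Y x = YY (X x) - XX (Y x)"
    by (simp add: lie_bracket_def XX_def YY_def)
  have Gdiff: "G (v - w) = G v - G w" for v w
    unfolding G_def using linear_D_on[OF C1[OF g] x] by (rule linear_diff)
  have KX: "bil (G (X x)) a b + bil (g x) (XX a) b + bil (g x) a (XX b) = 0" for a b
    using X(2)[OF x] unfolding killing_at_def G_def XX_def by blast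
  have KY: "bil (G (Y x)) a b + bil (g x) (YY a) b + bil (g x) a (YY b) = 0" for a b
    using Y(2)[OF x] unfolding killing_at_def G_def YY_def by blast
  have "bil (G (YY (X x) - XX (Y x))) a b + bil (g x) (D_on W (lie_bracket W X Y) x a) b
      + bil (g x) a (D_on W (lie_bracket W X Y) x b) = 0" for a b
    using prolong[OF Y, of "X x" a b] prolong[OF X, of "Y x" a b] sym[OF g, of "X x" "Y x"]
      sym[OF X(1), of "Y x" a] sym[OF X(1), of "Y x" b] sym[OF Y(1), of "X x" a] sym[OF Y(1), of "X x" b]
      KX[of "YY a" b] KX[of a "YY b"] KY[of "XX a" b] KY[of a "XX b"]
    by (simp add: dZ Gdiff G2_def bil_add bil_diff flip: XX_def YY_def)
  then show ?thesis unfolding killing_at_def Zx by (simp add: G_def)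
qed

section \<open>Unique continuation and decay\<close>

text \<open>The Killing equation eliminates the derivatives of the field, so that the values of \<open>X\<close> can be
  estimated by the values of \<open>X\<close> elsewhere.\<close>

lemma killing_along_line:
  fixes g :: "real^'i::finite \<Rightarrow> real^'i^'i"
  assumes W: "open W" "y + t *\<^sub>R w \<in> W" and g: "C_on 1 W g" "\<And>x. x \<in> W \<Longrightarrow> transpose (g x) = g x"
    and X: "C_on 1 W X" "killing_at W g X (y + t *\<^sub>R w)"
  shows "((\<lambda>t. bil (g (y + t *\<^sub>R w)) (X (y + t *\<^sub>R w)) w) has_real_derivative
     bil (D_on W g (y + t *\<^sub>R w) w) (X (y + t *\<^sub>R w)) w
     - bil (D_on W g (y + t *\<^sub>R w) (X (y + t *\<^sub>R w))) w w / 2) (at t)"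
proof -
  let ?z = "y + t *\<^sub>R w"
  have g1: "C_on (Suc 0) W g" and X1: "C_on (Suc 0) W X" using g(1) X(1) by simp_all
  have d: "((\<lambda>z. bil (g z) (X z) w) has_derivative
    (\<lambda>h. bil (D_on W g ?z h) (X ?z) w + bil (g ?z) (D_on W X ?z h) w + bil (g ?z) (X ?z) 0)) (at ?z)"
    by (intro has_derivative_bil has_derivative_const has_derivative_D_on_open[OF W(1) g1 W(2)]
        has_derivative_D_on_open[OF W(1) X1 W(2)])
  have l: "((\<lambda>t. y + t *\<^sub>R w) has_derivative (\<lambda>h. h *\<^sub>R w)) (at t)"
    by (auto intro!: derivative_eq_intros)
  have c: "((\<lambda>t. bil (g (y + t *\<^sub>R w)) (X (y + t *\<^sub>R w)) w) has_derivative
    (\<lambda>h. bil (D_on W g ?z (h *\<^sub>R w)) (X ?z) w + bil (g ?z) (D_on W X ?z (h *\<^sub>R w)) w + bil (g ?z) (X ?z) 0)) (at t)"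
    by (rule has_derivative_compose[OF l d])
  have lin: "D_on W g ?z (h *\<^sub>R w) = h *\<^sub>R D_on W g ?z w" "D_on W X ?z (h *\<^sub>R w) = h *\<^sub>R D_on W X ?z w" for h
    using linear_D_on[OF g1 W(2)] linear_D_on[OF X1 W(2)] by (simp_all add: linear_scale)
  have sym: "bil (g ?z) w (D_on W X ?z w) = bil (g ?z) (D_on W X ?z w) w"
    using bil_transpose[of "g ?z"] g(2)[OF W(2)] by simp
  \<comment> \<open>With the direction \<open>w\<close> in both slots, the Killing equation
    determines the only term that contains a derivative of \<open>X\<close>.\<close>
  have k: "bil (g ?z) (D_on W X ?z w) w = - bil (D_on W g ?z (X ?z)) w w / 2"
    using X(2)[unfolded killing_at_def, rule_format, of w w] sym by simp
  have "(\<lambda>h. bil (D_on W g ?z (h *\<^sub>R w)) (X ?z) w + bil (g ?z) (D_on W X ?z (h *\<^sub>R w)) w + bil (g ?z) (X ?z) 0)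
    = (*) (bil (D_on W g ?z w) (X ?z) w - bil (D_on W g ?z (X ?z)) w w / 2)"
    by (simp add: fun_eq_iff lin bil_scaleR k algebra_simps)
  with c show ?thesis unfolding has_field_derivative_def by simp
qed

lemma killing_along_line_bound:
  fixes g :: "real^'i::finite \<Rightarrow> real^'i^'i"
  assumes "\<And>v a b. \<bar>bil (D_on W g z v) a b\<bar> \<le> C * norm v * norm a * norm b" "norm (X z) \<le> S" "0 \<le> C"
  shows "\<bar>bil (D_on W g z w) (X z) w - bil (D_on W g z (X z)) w w / 2\<bar> \<le> 2 * C * (norm w)\<^sup>2 * S"
proof -
  have "\<bar>bil (D_on W g z w) (X z) w\<bar> \<le> C * norm w * norm (X z) * norm w" by (rule assms)
  also have "\<dots> \<le> C * norm w * S * norm w"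
    by (intro mult_right_mono mult_left_mono assms) (auto simp: assms)
  finally have 1: "\<bar>bil (D_on W g z w) (X z) w\<bar> \<le> C * (norm w)\<^sup>2 * S" by (simp add: power2_eq_square mult_ac)
  have "\<bar>bil (D_on W g z (X z)) w w\<bar> \<le> C * norm (X z) * norm w * norm w" by (rule assms)
  also have "\<dots> \<le> C * S * norm w * norm w"
    by (intro mult_right_mono mult_left_mono assms) auto
  finally have 2: "\<bar>bil (D_on W g z (X z)) w w\<bar> \<le> C * (norm w)\<^sup>2 * S" by (simp add: power2_eq_square mult_ac)
  have "C * (norm w)\<^sup>2 * S \<ge> 0" using 1 by linarith
  with 1 2 show ?thesis by linarith
qed

text \<open>This takes the place of a Gronwall argument: since \<open>h\<close> applies to every
  bound \<open>M\<close>, an initial bound can be halved indefinitely.\<close>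

lemma zero_by_halving:
  fixes X :: "'a \<Rightarrow> 'b::real_normed_vector"
  assumes b: "\<And>y. y \<in> T \<Longrightarrow> norm (X y) \<le> M"
    and h: "\<And>M y. (\<And>y. y \<in> T \<Longrightarrow> norm (X y) \<le> M) \<Longrightarrow> y \<in> T \<Longrightarrow> norm (X y) \<le> M / 2"
    and y: "y \<in> T"
  shows "X y = 0"
proof -
  have "\<forall>y\<in>T. norm (X y) \<le> M * (1/2)^n" for n
  proof (induction n)
    case (Suc n)
    then show ?case using h[of "M * (1/2)^n"] by auto
  qed (use b in simp)
  then have "norm (X y) \<le> M * (1/2)^n" for n using y by blast
  moreover have "(\<lambda>n. M * (1/2::real)^n) \<longlonglongrightarrow> M * 0"
    by (intro tendsto_intros LIMSEQ_power_zero) simp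
  ultimately have "norm (X y) \<le> M * 0" by (intro LIMSEQ_le_const) auto
  then show ?thesis by simp
qed

text \<open>The test vector is \<open>M *v v\<close> rescaled to length \<open>r\<close>. Pairing
  with \<open>v\<close> itself would give nothing for a null vector of an indefinite metric.\<close>

lemma norm_bound_of_bil_bound:
  fixes M :: "real^'i::finite^'i"
  assumes M: "transpose M = M" "m * norm v \<le> norm (M *v v)"
    and r: "0 < r" and B: "\<And>b. norm b \<le> r \<Longrightarrow> \<bar>bil M v b\<bar> \<le> B"
  shows "r * (m * norm v) \<le> B"
proof (cases "M *v v = 0")
  case True
  then have "m * norm v \<le> 0" using M by simp
  then have "r * (m * norm v) \<le> 0" using r by (simp add: mult_le_0_iff)
  then show ?thesis using B[of 0] r by simp
next
  case False
  define b where "b = (r / norm (M *v v)) *\<^sub>R (M *v v)"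
  have "bil M v b = bil M b v" using bil_transpose[of M] M(1) by simp
  also have "\<dots> = r * norm (M *v v)"
    using False by (simp add: bil_eq_inner b_def power2_norm_eq_inner[symmetric] power2_eq_square)
  finally have eq: "bil M v b = r * norm (M *v v)" .
  have "norm b \<le> r" using False r by (simp add: b_def)
  from B[OF this] eq have "r * norm (M *v v) \<le> B" using r by simp
  moreover have "r * (m * norm v) \<le> r * norm (M *v v)" using M(2) r by (intro mult_left_mono) auto
  ultimately show ?thesis by linarith
qed

section \<open>Unique continuation on a convex open set with uniform bounds\<close>

context
  fixes g :: "real^'i::finite \<Rightarrow> real^'i^'i" and X :: "real^'i \<Rightarrow> real^'i"
    and W :: "(real^'i) set" and C m d B :: real
  assumes W: "open W" "convex W" and g: "C_on 1 W g" "\<And>x. x \<in> W \<Longrightarrow> transpose (g x) = g x"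
    and X: "C_on 1 W X" "\<And>x. x \<in> W \<Longrightarrow> killing_at W g X x"
    and C: "0 \<le> C" "\<And>z v a b. z \<in> W \<Longrightarrow> \<bar>bil (D_on W g z v) a b\<bar> \<le> C * norm v * norm a * norm b"
    and m: "0 < m" "\<And>z v. z \<in> W \<Longrightarrow> m * norm v \<le> norm (g z *v v)"
    and d: "\<And>y z. y \<in> W \<Longrightarrow> z \<in> W \<Longrightarrow> norm (y - z) \<le> d"
    and bound: "\<And>y. y \<in> W \<Longrightarrow> norm (X y) \<le> B"
begin

text \<open>If \<open>X\<close> vanishes on a ball, the lines from the ball to a nearby point run through the zero set
  except for a short piece, so the components of \<open>X\<close> at the point in a spanning set of directions are
  small compared with the supremum of \<open>X\<close>.\<close>

lemma killing_zero_extend: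
  assumes q: "0 < r" "cball q r \<subseteq> W" and rt: "r \<le> t"
    and \<delta>: "\<delta> = m * r\<^sup>2 / (16 * (2 * (C + 1) * (d + 1)\<^sup>2))"
    and zero: "\<And>y. y \<in> W \<inter> cball q t \<Longrightarrow> X y = 0"
    and y: "y \<in> W \<inter> cball q (t + \<delta>)"
  shows "X y = 0"
proof (rule zero_by_halving[OF _ _ y])
  show "norm (X y) \<le> B" if "y \<in> W \<inter> cball q (t + \<delta>)" for y using bound that by auto
  fix S y
  assume S: "\<And>y. y \<in> W \<inter> cball q (t + \<delta>) \<Longrightarrow> norm (X y) \<le> S" and y: "y \<in> W \<inter> cball q (t + \<delta>)"
  \<comment> \<open>\<open>K * S\<close> bounds the derivative of the component of \<open>X\<close>
    along any segment in \<open>W\<close>; the added ones keep \<open>K\<close> positive when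
    \<open>C\<close> or \<open>d\<close> is zero.\<close>
  define K where "K = 2 * (C + 1) * (d + 1)\<^sup>2"
  have qW: "q \<in> W" using q by auto
  have d0: "d \<ge> 0" using d[OF qW qW] by simp
  have K: "K > 0" using C(1) d0 by (simp add: K_def)
  have S0: "S \<ge> 0" using S[OF y] norm_ge_zero order_trans by blast
  show "norm (X y) \<le> S / 2"
  proof (cases "norm (y - q) \<le> t")
    case True
    then have "X y = 0" using y by (intro zero) (auto simp: dist_norm norm_minus_commute)
    then show ?thesis using S0 by simp
  next
    case False
    define t' where "t' = norm (y - q)"
    have t': "t < t'" "t' \<le> t + \<delta>"
      using False y by (auto simp: t'_def dist_norm norm_minus_commute)
    \<comment> \<open>The segment from a point of the ball of radius \<open>r / 2\<close> to
      \<open>y\<close> is, at parameter \<open>s\<close>, within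
      \<open>(1 - s) * (r / 2) + s * t'\<close> of \<open>q\<close>. At \<open>s0\<close> this
      equals \<open>t\<close>, so there the segment still lies in the zero set.\<close>
    define s0 where "s0 = (t - r / 2) / (t' - r / 2)"
    have den: "t' - r / 2 \<ge> r / 2" "t' - r / 2 > 0" using t' rt q(1) by auto
    have s0: "0 \<le> s0" "s0 \<le> 1" using den t' rt q(1) by (auto simp: s0_def)
    have "1 - s0 = (t' - t) / (t' - r / 2)" using den by (simp add: s0_def field_simps)
    also have "\<dots> \<le> \<delta> / (r / 2)" using den t' q(1) by (intro frac_le) auto
    finally have s0': "1 - s0 \<le> 2 * \<delta> / r" by (simp add: mult.commute)
    have key: "\<bar>bil (g y) (X y) (y - p)\<bar> \<le> K * S * (2 * \<delta> / r)" if p: "norm (p - q) \<le> r / 2" for p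
    proof -
      define v where "v = y - p"
      have pW: "p \<in> W" using p q by (auto simp: dist_norm norm_minus_commute subset_eq)
      have seg: "p + s *\<^sub>R v \<in> W" "norm (p + s *\<^sub>R v - q) \<le> (1 - s) * (r / 2) + s * t'" if "0 \<le> s" "s \<le> 1" for s
      proof -
        have eq: "p + s *\<^sub>R v = (1 - s) *\<^sub>R p + s *\<^sub>R y" by (simp add: v_def algebra_simps)
        show "p + s *\<^sub>R v \<in> W" unfolding eq using W(2) pW y that by (auto simp: convex_alt)
        have "p + s *\<^sub>R v - q = (1 - s) *\<^sub>R (p - q) + s *\<^sub>R (y - q)" by (simp add: v_def algebra_simps)
        then have "norm (p + s *\<^sub>R v - q) \<le> (1 - s) * norm (p - q) + s * norm (y - q)"
          using norm_triangle_ineq[of "(1 - s) *\<^sub>R (p - q)" "s *\<^sub>R (y - q)"] that by simp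
        also have "\<dots> \<le> (1 - s) * (r / 2) + s * t'"
          using p that by (intro add_mono mult_left_mono) (auto simp: t'_def)
        finally show "norm (p + s *\<^sub>R v - q) \<le> (1 - s) * (r / 2) + s * t'" .
      qed
      have in_T: "p + s *\<^sub>R v \<in> W \<inter> cball q (t + \<delta>)" if "0 \<le> s" "s \<le> 1" for s
      proof -
        have "(1 - s) * (r / 2) \<le> (1 - s) * t'" using that den(1) q(1) by (intro mult_left_mono) auto
        then have "(1 - s) * (r / 2) + s * t' \<le> t'" by (simp add: algebra_simps)
        then show ?thesis using seg[OF that] t' by (auto simp: dist_norm norm_minus_commute)
      qed
      define \<phi> where "\<phi> s = bil (g (p + s *\<^sub>R v)) (X (p + s *\<^sub>R v)) v" for s
      have "norm (\<phi> 1 - \<phi> s0) \<le> (K * S) * norm (1 - s0)"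
      proof (rule field_differentiable_bound[of "{s0..1}"])
        fix s assume s: "s \<in> {s0..1}"
        then have sW: "p + s *\<^sub>R v \<in> W" and sT: "norm (X (p + s *\<^sub>R v)) \<le> S"
          using s0 seg(1)[of s] S[OF in_T[of s]] by auto
        show "(\<phi> has_field_derivative bil (D_on W g (p + s *\<^sub>R v) v) (X (p + s *\<^sub>R v)) v
            - bil (D_on W g (p + s *\<^sub>R v) (X (p + s *\<^sub>R v))) v v / 2) (at s within {s0..1})"
          unfolding \<phi>_def by (rule has_field_derivative_at_within[OF killing_along_line[OF W(1) sW g X(1) X(2)[OF sW]]])
        have "\<bar>bil (D_on W g (p + s *\<^sub>R v) v) (X (p + s *\<^sub>R v)) v
            - bil (D_on W g (p + s *\<^sub>R v) (X (p + s *\<^sub>R v))) v v / 2\<bar> \<le> 2 * C * (norm v)\<^sup>2 * S"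
          by (rule killing_along_line_bound) (use C(2)[OF sW] sT C(1) in auto)
        also have "\<dots> \<le> K * S"
        proof -
          have "norm v \<le> d + 1" using d[of y p] y pW by (auto simp: v_def)
          then have "(norm v)\<^sup>2 \<le> (d + 1)\<^sup>2" by (intro power_mono) auto
          then have "2 * C * (norm v)\<^sup>2 \<le> K" unfolding K_def using C(1) by (intro mult_mono) auto
          then show ?thesis using S0 by (rule mult_right_mono)
        qed
        finally show "norm (bil (D_on W g (p + s *\<^sub>R v) v) (X (p + s *\<^sub>R v)) v
            - bil (D_on W g (p + s *\<^sub>R v) (X (p + s *\<^sub>R v))) v v / 2) \<le> K * S" by simp
      qed (use s0 in auto)
      moreover have "\<phi> s0 = 0"
      proof -
        have "(1 - s0) * (r / 2) + s0 * t' = r / 2 + s0 * (t' - r / 2)" by (simp add: field_simps)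
        also have "\<dots> = t" using den by (simp add: s0_def)
        finally have "p + s0 *\<^sub>R v \<in> W \<inter> cball q t"
          using seg[OF s0] by (auto simp: dist_norm norm_minus_commute)
        then show ?thesis by (simp add: \<phi>_def zero)
      qed
      moreover have "\<phi> 1 = bil (g y) (X y) (y - p)" by (simp add: \<phi>_def v_def)
      ultimately have "\<bar>bil (g y) (X y) (y - p)\<bar> \<le> (K * S) * (1 - s0)" using s0 by simp
      also have "\<dots> \<le> (K * S) * (2 * \<delta> / r)" using K S0 s0' by (intro mult_left_mono) auto
      finally show ?thesis .
    qed
    have "\<bar>bil (g y) (X y) b\<bar> \<le> 2 * (K * S * (2 * \<delta> / r))" if "norm b \<le> r / 2" for b
    proof -
      \<comment> \<open>Every short vector is a difference of two directions pointing to
        \<open>y\<close> from the ball of radius \<open>r / 2\<close>, so the estimate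
        \<open>key\<close> covers a spanning set.\<close>
      have "b = (y - (q - b)) - (y - q)" by simp
      then have "bil (g y) (X y) b = bil (g y) (X y) (y - (q - b)) - bil (g y) (X y) (y - q)"
        by (metis bil_diff(3))
      moreover have "\<bar>bil (g y) (X y) (y - (q - b))\<bar> \<le> K * S * (2 * \<delta> / r)" "\<bar>bil (g y) (X y) (y - q)\<bar> \<le> K * S * (2 * \<delta> / r)"
        using key[of "q - b"] key[of q] that q(1) by auto
      ultimately show ?thesis by linarith
    qed
    then have "r / 2 * (m * norm (X y)) \<le> 2 * (K * S * (2 * \<delta> / r))"
      using y q(1) by (intro norm_bound_of_bil_bound[OF g(2) m(2)]) auto
    \<comment> \<open>This identity dictates \<delta>: it is the value for which the bound becomes
      exactly half of \<open>S\<close> after division by \<open>r / 2 * m\<close>.\<close>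
    moreover have "2 * (K * S * (2 * \<delta> / r)) = r / 2 * (m * (S / 2))"
      unfolding \<delta> K_def[symmetric] using K q(1) by (simp add: field_simps power2_eq_square)
    ultimately have "r / 2 * m * norm (X y) \<le> r / 2 * m * (S / 2)"
      by (simp only: mult.assoc)
    moreover have "0 < r / 2 * m" using q(1) m(1) by simp
    ultimately show ?thesis by (simp only: mult_le_cancel_left_pos)
  qed
qed

text \<open>The gain \<delta> depends on the radius \<open>r\<close> of the initial ball but not on
  the radius reached so far, so finitely many extensions reach any point.\<close>

lemma killing_unique_continuation:
  assumes V: "open V" "V \<subseteq> W" "V \<noteq> {}" and zero: "\<And>y. y \<in> V \<Longrightarrow> X y = 0"
    and y: "y \<in> W"
  shows "X y = 0"
proof -
  obtain q where "q \<in> V" using V by blast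
  then obtain r where r: "0 < r" "cball q r \<subseteq> V" using V(1) open_contains_cball by blast
  have rW: "cball q r \<subseteq> W" using r V by blast
  define \<delta> where "\<delta> = m * r\<^sup>2 / (16 * (2 * (C + 1) * (d + 1)\<^sup>2))"
  have "d \<ge> 0" using d[OF y y] by simp
  then have \<delta>: "\<delta> > 0" using m(1) r(1) C(1) by (simp add: \<delta>_def)
  have step: "\<forall>y\<in>W \<inter> cball q (r + real n * \<delta>). X y = 0" for n
  proof (induction n)
    case 0
    then show ?case using r zero by auto
  next
    case (Suc n)
    have "X y = 0" if "y \<in> W \<inter> cball q ((r + real n * \<delta>) + \<delta>)" for y
      by (rule killing_zero_extend[OF r(1) rW _ \<delta>_def _ that])
        (use Suc \<delta> in auto)
    then show ?case by (simp add: algebra_simps)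
  qed
  obtain n where "norm (y - q) < real n * \<delta>" using reals_Archimedean3[OF \<delta>] by blast
  then have "y \<in> W \<inter> cball q (r + real n * \<delta>)" using y r(1) by (auto simp: dist_norm norm_minus_commute)
  then show ?thesis using step by blast
qed

end

section \<open>The exterior region and its radial directions\<close>

lemma linear_spatial: "linear spatial"
  by (rule linearI) (simp_all add: spatial_def vec_eq_iff)

abbreviation radius :: "real^('n::finite option) \<Rightarrow> real" where
  "radius x \<equiv> norm (spatial x)"

lemma norm_spatial_le: "radius (x :: real^('n::finite option)) \<le> norm x"
proof -
  have "(\<Sum>i\<in>UNIV. (x $ Some i)\<^sup>2) = (\<Sum>i\<in>range Some. (x $ i)\<^sup>2)"
    by (simp add: sum.reindex)
  also have "\<dots> \<le> (\<Sum>i\<in>UNIV. (x $ i)\<^sup>2)" by (rule sum_mono2) auto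
  finally show ?thesis
    by (simp add: norm_vec_def L2_set_def spatial_def)
qed

lemma continuous_on_spatial: "continuous_on S spatial"
  using linear_spatial linear_continuous_on linear_conv_bounded_linear by blast

lemma open_exterior: "open exterior"
proof -
  have "open {x :: real^('n::finite option). 1 < radius x}"
    by (intro open_Collect_less continuous_intros continuous_on_spatial)
  then show ?thesis by (simp add: exterior_def)
qed

lemma exists_radial_direction:
  fixes y :: "real^('n::finite option)"
  assumes "spatial y \<noteq> 0"
  obtains a where "norm a \<le> 1" "spatial a = (1 / radius y) *\<^sub>R spatial y"
proof -
  define a :: "real^('n option)" where "a = (\<chi> i. case i of None \<Rightarrow> 0 | Some j \<Rightarrow> y $ Some j / radius y)"
  have sp: "spatial a = (1 / radius y) *\<^sub>R spatial y"
    by (simp add: spatial_def a_def vec_eq_iff)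
  have "(norm a)\<^sup>2 = (\<Sum>i\<in>UNIV. (a $ i)\<^sup>2)"
    by (simp add: norm_vec_def L2_set_def sum_nonneg)
  also have "\<dots> = (\<Sum>i\<in>range Some. (a $ i)\<^sup>2)"
    by (rule sum.mono_neutral_right) (auto simp: a_def split: option.split)
  also have "\<dots> = (radius a)\<^sup>2"
    by (simp add: norm_vec_def L2_set_def sum_nonneg sum.reindex spatial_def)
  finally have "(norm a)\<^sup>2 = 1" using assms by (simp add: sp)
  then have "norm a = 1 \<or> norm a = - 1" by (simp only: power2_eq_1_iff)
  then have "norm a \<le> 1" by auto
  with sp that show ?thesis by simp
qed

section \<open>Killing fields that decay along radial rays\<close>

context
  fixes g :: "real^('n::finite option) \<Rightarrow> real^('n option)^('n option)"
    and X :: "real^('n option) \<Rightarrow> real^('n option)" and \<beta> \<kappa> C C2 C3 :: real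
  assumes \<beta>: "0 < \<beta>" and \<kappa>: "0 < \<kappa>"
    and g: "C_on 1 exterior g" "\<And>x. x \<in> exterior \<Longrightarrow> transpose (g x) = g x"
    and X: "C_on 1 exterior X" "\<And>x. x \<in> exterior \<Longrightarrow> killing_at exterior g X x"
    and C: "0 \<le> C" "\<And>z v a b. z \<in> exterior \<Longrightarrow>
       \<bar>bil (D_on exterior g z v) a b\<bar> \<le> C * radius z powr (- 1 - \<beta>) * norm v * norm a * norm b"
    and C2: "0 \<le> C2" "\<And>z. z \<in> exterior \<Longrightarrow> norm (X z) \<le> C2 * radius z powr (- \<kappa>)"
    and C3: "0 \<le> C3" "\<And>z a b. z \<in> exterior \<Longrightarrow> \<bar>bil (g z) a b\<bar> \<le> C3 * norm a * norm b"
begin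

text \<open>A ray from \<open>y\<close> whose direction is close to the radial one stays far out; the component of \<open>X\<close>
  in its direction tends to zero, and by the previous derivative formula it varies by at most
  \<open>O(|x|\<^sup>-\<^sup>\<beta>) sup |X|\<close>.\<close>

lemma killing_component_decay:
  assumes \<rho>: "1 < \<rho>" and S: "\<And>y. \<rho> \<le> radius y \<Longrightarrow> norm (X y) \<le> S"
    and y: "\<rho> \<le> radius y" and a: "norm a \<le> 1" "spatial a = (1 / radius y) *\<^sub>R spatial y"
    and b: "norm b \<le> 1 / 2"
  shows "\<bar>bil (g y) (X y) (a + b)\<bar> \<le> 10 * C * S / \<beta> * \<rho> powr (- \<beta>)"
proof -
  define R where "R = radius y"
  define w where "w = a + b"
  have R: "R > 1" "\<rho> \<le> R" using \<rho> y by (auto simp: R_def)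
  have S0: "S \<ge> 0" using S[OF y] norm_ge_zero order_trans by blast
  have w: "norm w \<le> 3 / 2" using norm_triangle_ineq[of a b] a b by (simp add: w_def)
  \<comment> \<open>The spatial part of \<open>w\<close> is a radial unit vector plus a perturbation
    of length at most \<open>1 / 2\<close>, so the radius grows at rate at least
    \<open>1 / 2\<close>.\<close>
  have far: "R + t / 2 \<le> radius (y + t *\<^sub>R w)" if "0 \<le> t" for t
  proof -
    have "spatial (y + t *\<^sub>R w) = (1 + t / R) *\<^sub>R spatial y + t *\<^sub>R spatial b"
      by (simp add: w_def linear_add[OF linear_spatial] linear_scale[OF linear_spatial] a(2) algebra_simps R_def)
    then have "radius (y + t *\<^sub>R w) \<ge> norm ((1 + t / R) *\<^sub>R spatial y) - norm (t *\<^sub>R spatial b)"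
      by (metis norm_diff_ineq)
    moreover have "norm ((1 + t / R) *\<^sub>R spatial y) = R + t"
      using R that by (simp add: R_def[symmetric] field_simps)
    moreover have "norm (t *\<^sub>R spatial b) \<le> t / 2"
      using norm_spatial_le[of b] b that mult_left_mono[of "radius b" "1/2" t] by simp
    ultimately show ?thesis by linarith
  qed
  have ext: "y + t *\<^sub>R w \<in> exterior" if "0 \<le> t" for t
    using far[OF that] R that by (simp add: exterior_def)
  define \<phi> where "\<phi> t = bil (g (y + t *\<^sub>R w)) (X (y + t *\<^sub>R w)) w" for t
  define \<phi>' where "\<phi>' t = bil (D_on exterior g (y + t *\<^sub>R w) w) (X (y + t *\<^sub>R w)) w
     - bil (D_on exterior g (y + t *\<^sub>R w) (X (y + t *\<^sub>R w))) w w / 2" for t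
  have \<phi>': "(\<phi> has_real_derivative \<phi>' t) (at t)" if "0 \<le> t" for t
    unfolding \<phi>_def \<phi>'_def
    by (rule killing_along_line[OF open_exterior ext[OF that] g X(1) X(2)[OF ext[OF that]]])
  have \<phi>'_bound: "\<bar>\<phi>' t\<bar> \<le> 5 * C * S * (R + t / 2) powr (- 1 - \<beta>)" if t: "0 \<le> t" for t
  proof -
    let ?n = "radius (y + t *\<^sub>R w)"
    have "\<bar>\<phi>' t\<bar> \<le> 2 * (C * ?n powr (- 1 - \<beta>)) * (norm w)\<^sup>2 * S"
      unfolding \<phi>'_def
    proof (rule killing_along_line_bound)
      show "norm (X (y + t *\<^sub>R w)) \<le> S" using far[OF t] R t by (intro S) simp
    qed (use C ext[OF t] in auto)
    also have "\<dots> \<le> 2 * (C * (R + t / 2) powr (- 1 - \<beta>)) * (5 / 2) * S"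
    proof (intro mult_right_mono mult_mono mult_left_mono C S0)
      show "?n powr (- 1 - \<beta>) \<le> (R + t / 2) powr (- 1 - \<beta>)"
        using far[OF t] R t \<beta> by (intro powr_mono2') auto
      have "(norm w)\<^sup>2 \<le> (3 / 2)\<^sup>2" using w by (intro power_mono) auto
      then show "(norm w)\<^sup>2 \<le> 5 / 2" by (simp add: power2_eq_square)
    qed (use C in auto)
    finally show ?thesis by (simp add: mult_ac)
  qed
  \<comment> \<open>The derivative of \<psi> is minus the bound for \<open>\<phi>'\<close>. The
    factor 10 is 5 doubled, since the argument of the power moves at rate
    \<open>1 / 2\<close>.\<close>
  define \<psi> where "\<psi> t = 10 * C * S / \<beta> * (R + t / 2) powr (- \<beta>)" for t
  have \<psi>': "(\<psi> has_real_derivative - (5 * C * S * (R + t / 2) powr (- 1 - \<beta>))) (at t)" if "0 \<le> t" for t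
  proof -
    have "((\<lambda>t. (R + t / 2) powr (- \<beta>)) has_real_derivative - \<beta> * (R + t / 2) powr (- \<beta> - 1) * (1 / 2)) (at t)"
      using R that by (auto intro!: derivative_eq_intros)
    moreover have "- \<beta> - 1 = - 1 - \<beta>" by simp
    ultimately have "((\<lambda>t. (R + t / 2) powr (- \<beta>)) has_real_derivative - \<beta> * (R + t / 2) powr (- 1 - \<beta>) * (1 / 2)) (at t)"
      by (simp only:)
    from DERIV_cmult[OF this, of "10 * C * S / \<beta>"]
    show ?thesis unfolding \<psi>_def using \<beta> by (simp add: algebra_simps)
  qed
  have lim_powr: "((\<lambda>t. (R + t / 2) powr (- \<gamma>)) \<longlongrightarrow> 0) at_top" if "0 < \<gamma>" for \<gamma>
  proof (rule tendsto_neg_powr)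
    show "filterlim (\<lambda>t. R + t / 2) at_top at_top"
      by (intro filterlim_tendsto_add_at_top[OF tendsto_const] filterlim_at_top_mult_tendsto_pos[where c="1/2", of "\<lambda>_. 1/2" _ "\<lambda>t. t", simplified] filterlim_ident)
  qed (use that in simp)
  have lim_\<psi>: "(\<psi> \<longlongrightarrow> 0) at_top"
    unfolding \<psi>_def using tendsto_mult_left[OF lim_powr[OF \<beta>], of "10 * C * S / \<beta>"] by simp
  have lim_\<phi>: "(\<phi> \<longlongrightarrow> 0) at_top"
  proof (rule Lim_null_comparison)
    show "\<forall>\<^sub>F t in at_top. norm (\<phi> t) \<le> C3 * C2 * (3 / 2) * (R + t / 2) powr (- \<kappa>)"
    proof (rule eventually_at_top_linorderI[of 0])
      fix t :: real assume t: "0 \<le> t"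
      let ?n = "radius (y + t *\<^sub>R w)"
      have "norm (\<phi> t) \<le> C3 * norm (X (y + t *\<^sub>R w)) * norm w"
        unfolding \<phi>_def using C3(2)[OF ext[OF t]] by simp
      also have "\<dots> \<le> C3 * (C2 * ?n powr (- \<kappa>)) * (3 / 2)"
        by (intro mult_mono mult_left_mono C2(2)[OF ext[OF t]] w C3) (auto simp: C2 C3)
      also have "\<dots> \<le> C3 * (C2 * (R + t / 2) powr (- \<kappa>)) * (3 / 2)"
        using far[OF t] R t \<kappa> by (intro mult_right_mono mult_left_mono C2 C3 powr_mono2') auto
      finally show "norm (\<phi> t) \<le> C3 * C2 * (3 / 2) * (R + t / 2) powr (- \<kappa>)" by simp
    qed
    show "((\<lambda>t. C3 * C2 * (3 / 2) * (R + t / 2) powr (- \<kappa>)) \<longlongrightarrow> 0) at_top"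
      using tendsto_mult_left[OF lim_powr[OF \<kappa>], of "C3 * C2 * (3 / 2)"] by simp
  qed
  \<comment> \<open>Applied to \<psi> + \<phi> and \<psi> - \<phi>, this bounds |\<phi> 0| by \<psi>
    0 without an improper integral: both functions are nonincreasing and tend to zero.\<close>
  have dec: "0 \<le> h 0" if h: "\<And>t. 0 \<le> t \<Longrightarrow> \<exists>h'. (h has_real_derivative h') (at t) \<and> h' \<le> 0" and "(h \<longlongrightarrow> 0) at_top" for h
  proof (rule tendsto_upperbound[OF that(2)])
    show "\<forall>\<^sub>F t in at_top. h t \<le> h 0"
      by (rule eventually_at_top_linorderI[of 0]) (rule DERIV_nonpos_imp_nonincreasing, auto simp: h)
  qed simp
  have "0 \<le> \<phi> 0 + \<psi> 0"
  proof (rule dec[of "\<lambda>t. \<phi> t + \<psi> t"])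
    fix t :: real assume t: "0 \<le> t"
    show "\<exists>h'. ((\<lambda>t. \<phi> t + \<psi> t) has_real_derivative h') (at t) \<and> h' \<le> 0"
      using DERIV_add[OF \<phi>'[OF t] \<psi>'[OF t]] \<phi>'_bound[OF t] by fastforce
  qed (use tendsto_add[OF lim_\<phi> lim_\<psi>] in simp)
  moreover have "0 \<le> - \<phi> 0 + \<psi> 0"
  proof (rule dec[of "\<lambda>t. - \<phi> t + \<psi> t"])
    fix t :: real assume t: "0 \<le> t"
    show "\<exists>h'. ((\<lambda>t. - \<phi> t + \<psi> t) has_real_derivative h') (at t) \<and> h' \<le> 0"
      using DERIV_add[OF DERIV_minus[OF \<phi>'[OF t]] \<psi>'[OF t]] \<phi>'_bound[OF t] by fastforce
  qed (use tendsto_add[OF tendsto_minus[OF lim_\<phi>] lim_\<psi>] in simp)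
  moreover have "\<psi> 0 \<le> 10 * C * S / \<beta> * \<rho> powr (- \<beta>)"
    unfolding \<psi>_def using R \<rho> \<beta> C(1) S0 by (intro mult_left_mono) (auto intro!: powr_mono2')
  moreover have "\<phi> 0 = bil (g y) (X y) (a + b)" by (simp add: \<phi>_def w_def)
  ultimately show ?thesis by linarith
qed

text \<open>Subtracting the estimates for the directions \<open>a + b\<close> and \<open>a\<close>
  bounds the component in every short direction \<open>b\<close>. Beyond radius \<rho> the resulting
  bound is at most half of the assumed supremum.\<close>

lemma killing_vanishes_near_infinity:
  assumes m: "0 < m" "\<And>z v. z \<in> exterior \<Longrightarrow> \<rho> \<le> radius z \<Longrightarrow> m * norm v \<le> norm (g z *v v)"
    and \<rho>: "1 < \<rho>" "80 * C * \<rho> powr (- \<beta>) \<le> m * \<beta>"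
    and y: "\<rho> \<le> radius y"
  shows "X y = 0"
proof -
  have yT: "y \<in> {y. \<rho> \<le> radius y}" using y by simp
  show ?thesis
  proof (rule zero_by_halving[OF _ _ yT])
  show "norm (X y) \<le> C2" if "y \<in> {y. \<rho> \<le> radius y}" for y
  proof -
    have "norm (X y) \<le> C2 * radius y powr (- \<kappa>)"
      using that \<rho> by (intro C2) (simp add: exterior_def)
    also have "\<dots> \<le> C2 * 1"
      using that \<rho> \<kappa> powr_mono2'[of "-\<kappa>" 1 "radius y"] by (intro mult_left_mono C2) auto
    finally show ?thesis by simp
  qed
  fix S and y :: "real^('n option)"
  assume S: "\<And>y. y \<in> {y. \<rho> \<le> radius y} \<Longrightarrow> norm (X y) \<le> S" and "y \<in> {y. \<rho> \<le> radius y}"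
  then have y: "\<rho> \<le> radius y" by simp
  have "norm (X y) \<le> S" using S y by simp
  then have S0: "S \<ge> 0" using norm_ge_zero order_trans by blast
  have ey: "y \<in> exterior" using y \<rho> by (simp add: exterior_def)
  have "spatial y \<noteq> 0" using y \<rho> by auto
  then obtain a where a: "norm a \<le> 1" "spatial a = (1 / radius y) *\<^sub>R spatial y"
    using exists_radial_direction by blast
  define B where "B = 10 * C * S / \<beta> * \<rho> powr (- \<beta>)"
  have key: "\<bar>bil (g y) (X y) (a + b)\<bar> \<le> B" if "norm b \<le> 1 / 2" for b
    unfolding B_def
    by (rule killing_component_decay[OF \<rho>(1) _ y a that]) (use S in auto)
  have "\<bar>bil (g y) (X y) b\<bar> \<le> 2 * B" if "norm b \<le> 1 / 2" for b
    using key[OF that] key[of 0] bil_add(3)[of "g y" "X y" a b] by simp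
  then have "1 / 2 * (m * norm (X y)) \<le> 2 * B"
    by (intro norm_bound_of_bil_bound[OF g(2)[OF ey] m(2)[OF ey y]]) auto
  \<comment> \<open>The inequality needed for halving is \<open>4 * B \<le> m * S / 2\<close>; the
    number 80 in the hypothesis is this 8 times the 10 in \<open>B\<close>.\<close>
  moreover have "B * 8 \<le> m * S"
  proof -
    have "\<beta> * (B * 8) = (80 * C * \<rho> powr (- \<beta>)) * S" using \<beta> by (simp add: B_def)
    also have "\<dots> \<le> m * \<beta> * S" using \<rho>(2) S0 by (rule mult_right_mono)
    finally show ?thesis using \<beta> by (simp add: mult_ac)
  qed
  ultimately have "m * norm (X y) \<le> m * (S / 2)" by simp
  then show "norm (X y) \<le> S / 2" using m(1) by simp
  qed
qed

end

section \<open>Frames of Killing fields\<close>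

definition coord_domain :: "(real^'i::finite) set \<Rightarrow> bool" where
  "coord_domain S \<longleftrightarrow> open S \<or> (\<exists>k. openin (top_of_set (half_space k)) S)"

lemma coord_domain_openin:
  assumes "coord_domain S" "openin (top_of_set S) V"
  shows "coord_domain V"
  using assms unfolding coord_domain_def by (metis openin_open_trans openin_trans)

lemma coord_domain_cases:
  assumes "coord_domain S"
  obtains "open S" | k T where "open T" "S = {x. 0 \<le> x $ k} \<inter> T"
  using assms unfolding coord_domain_def half_space_def openin_open by blast

lemma coord_domain_thick:
  fixes S :: "(real^'i::finite) set"
  assumes "coord_domain S"
  shows "thick S"
proof (cases rule: coord_domain_cases[OF assms])
  case 1
  then show ?thesis by (rule open_thick)
next
  case (2 k T)
  show ?thesis unfolding thick_def
  proof (intro ballI allI impI)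
    fix x i :: "real^'i" and \<epsilon> :: real
    assume x: "x \<in> S" and i: "i \<in> Basis" and \<epsilon>: "0 < \<epsilon>"
    then obtain r where r: "r > 0" "ball x r \<subseteq> T" using 2 by (meson IntD2 openE)
    \<comment> \<open>The sign makes the displacement point into the half-space.\<close>
    define d where "d = (if 0 \<le> i $ k then 1 else - 1) * (min \<epsilon> r / 2)"
    have d: "0 < \<bar>d\<bar>" "\<bar>d\<bar> < \<epsilon>" "\<bar>d\<bar> < r" using r \<epsilon> by (auto simp: d_def)
    have "0 \<le> d * i $ k" using r \<epsilon> by (auto simp: d_def mult_nonneg_nonpos)
    moreover have "x + d *\<^sub>R i \<in> ball x r" using d i by (simp add: dist_norm)
    ultimately have "x + d *\<^sub>R i \<in> S" using x r 2 by auto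
    with d show "\<exists>d. 0 < \<bar>d\<bar> \<and> \<bar>d\<bar> < \<epsilon> \<and> x + d *\<^sub>R i \<in> S" by blast
  qed
qed

text \<open>At a boundary point \<open>W\<close> is the open half-ball. It is convex and open, as
  unique continuation requires, and dense in the relative ball, so that its conclusions extend by
  continuity.\<close>

lemma coord_domain_nbhd:
  fixes S :: "(real^'i::finite) set"
  assumes S: "coord_domain S" and x: "x \<in> S" and \<epsilon>: "0 < \<epsilon>"
  obtains \<delta> W where "0 < \<delta>" "\<delta> \<le> \<epsilon>" "open W" "convex W" "W \<subseteq> S \<inter> ball x \<delta>" "S \<inter> ball x \<delta> \<subseteq> closure W"
proof (cases rule: coord_domain_cases[OF S])
  case 1
  then obtain r where "r > 0" "ball x r \<subseteq> S" using x by (meson openE)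
  with \<epsilon> show ?thesis
    by (intro that[of "min r \<epsilon>" "ball x (min r \<epsilon>)"]) (auto intro: closure_subset[THEN subsetD])
next
  case (2 k T)
  then obtain r where r: "r > 0" "ball x r \<subseteq> T" using x by (meson IntD2 openE)
  define \<delta> where "\<delta> = min r \<epsilon>"
  define W where "W = ball x \<delta> \<inter> {z. 0 < z $ k}"
  have \<delta>: "0 < \<delta>" "\<delta> \<le> \<epsilon>" "\<delta> \<le> r" using r \<epsilon> by (auto simp: \<delta>_def)
  have op: "open {z::real^'i. 0 < z $ k}" using open_halfspace_component_gt_cart[of 0 k] by simp
  have cv: "convex {z::real^'i. 0 < z $ k}"
    using convex_halfspace_gt[of 0 "axis k (1::real)"] by (simp add: inner_axis')
  show ?thesis
  proof (rule that[OF \<delta>(1,2)])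
    show "open W" "convex W" using op cv by (auto simp: W_def convex_Int)
    show "W \<subseteq> S \<inter> ball x \<delta>" using 2 r \<delta> by (auto simp: W_def)
    show "S \<inter> ball x \<delta> \<subseteq> closure W"
    proof
      fix z assume z: "z \<in> S \<inter> ball x \<delta>"
      show "z \<in> closure W" unfolding closure_approachable
      proof (intro allI impI)
        fix e :: real assume e: "0 < e"
        define s where "s = min e (\<delta> - dist x z) / 2"
        have s: "0 < s" "s < e" "s < \<delta> - dist x z" using e z by (auto simp: s_def)
        have "dist (z + s *\<^sub>R axis k 1) z = s" using s by (simp add: dist_norm)
        moreover have "dist x (z + s *\<^sub>R axis k 1) \<le> dist x z + dist z (z + s *\<^sub>R axis k 1)"
          by (rule dist_triangle)
        ultimately have "z + s *\<^sub>R axis k 1 \<in> W \<and> dist (z + s *\<^sub>R axis k 1) z < e"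
          using s z 2 by (auto simp: W_def dist_commute axis_def)
        then show "\<exists>y\<in>W. dist y z < e" by blast
      qed
    qed
  qed
qed

text \<open>Carries identities from interior points to boundary points; \<open>h\<close> is
  controlled only on \<open>S\<close>, so the limit point must lie in \<open>S\<close> too.\<close>

lemma constant_on_closure_within:
  fixes h :: "'a::topological_space \<Rightarrow> 'b::t1_space"
  assumes "continuous_on S h" "W \<subseteq> S" "\<And>x. x \<in> W \<Longrightarrow> h x = c" "x \<in> S" "x \<in> closure W"
  shows "h x = c"
proof -
  obtain T where T: "closed T" "{x \<in> S. h x = c} = S \<inter> T"
    using continuous_closedin_preimage_constant[OF assms(1)] unfolding closedin_closed by blast
  then have "W \<subseteq> T" using assms(2,3) by blast
  then have "closure W \<subseteq> T" using T(1) by (simp add: closure_minimal)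
  then show ?thesis using T(2) assms(4,5) by blast
qed

lemma zero_bilinear_form:
  fixes F :: "real^'i::finite \<Rightarrow> real^'i \<Rightarrow> real"
  assumes l: "\<And>b. linear (\<lambda>a. F a b)" and r: "\<And>a. linear (F a)"
    and "\<And>i j. F (axis i 1) (axis j 1) = 0"
  shows "F a b = 0"
  using linear_axis_expansion[OF l[of b], of a] linear_axis_expansion[OF r, of _ b] assms(3) by simp

lemma partial_component:
  assumes "thick S" "x \<in> S" "C_on (Suc k) S X"
  shows "partial S i (\<lambda>y. X y $ j) x = D_on S X x (axis i 1) $ j"
  by (rule partial_eq[OF assms(1,2) bounded_linear.has_derivative[OF bounded_linear_vec_nth has_derivative_D_on[OF assms(3,2)]]])

lemma partial_matrix_component:
  assumes "thick S" "x \<in> S" "C_on (Suc k) S X"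
  shows "partial S i (\<lambda>y. X y $ l $ j) x = D_on S X x (axis i 1) $ l $ j"
  by (rule partial_eq[OF assms(1,2) bounded_linear.has_derivative[OF bounded_linear_vec_nth
    bounded_linear.has_derivative[OF bounded_linear_vec_nth has_derivative_D_on[OF assms(3,2)]]]])

text \<open>The left side of \<open>killing_at\<close> is bilinear in the two slots, and its values
  on coordinate vectors are the components \<open>lie_derivative\<close>. Only the direction from
  components to vectors is stated.\<close>

lemma killing_at_iff_lie_derivative:
  fixes g :: "('m, 'i::finite) bilinear_field"
  assumes T: "thick (image_of c)" "x \<in> image_of c" and g: "C_on 1 (image_of c) (g c)" and X: "C_on 1 (image_of c) (X c)"
    and L: "\<And>i j. lie_derivative X g c i j x = 0"
  shows "killing_at (image_of c) (g c) (X c) x"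
proof -
  let ?S = "image_of c"
  have g1: "C_on (Suc 0) ?S (g c)" and X1: "C_on (Suc 0) ?S (X c)" using g X by simp_all
  define F where "F a b = bil (D_on ?S (g c) x (X c x)) a b + bil (g c x) (D_on ?S (X c) x a) b
    + bil (g c x) a (D_on ?S (X c) x b)" for a b
  have "F (axis i 1) (axis j 1) = lie_derivative X g c i j x" for i j
  proof -
    have "bil (D_on ?S (g c) x (X c x)) (axis i 1) (axis j 1) = (\<Sum>k\<in>UNIV. X c x $ k * partial ?S k (\<lambda>y. g c y $ i $ j) x)"
      unfolding bil_axis partial_matrix_component[OF T g1]
      using linear_axis_expansion[OF linear_D_on[OF g1 T(2)], of "X c x"] by simp
    then show ?thesis
      unfolding F_def lie_derivative_def bil_axis_left bil_axis_right partial_component[OF T X1]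
      by (simp add: sum.distrib)
  qed
  then have z: "F (axis i 1) (axis j 1) = 0" for i j using L by simp
  have lin: "linear (D_on ?S (X c) x)" by (rule linear_D_on[OF X1 T(2)])
  have "F a b = 0" for a b
    by (rule zero_bilinear_form[of F, OF _ _ z])
      (auto intro!: linearI simp: F_def bil_add bil_scaleR linear_add[OF lin] linear_scale[OF lin] algebra_simps)
  then show ?thesis unfolding killing_at_def F_def by blast
qed

definition frame_matrix :: "('j \<Rightarrow> real^'i::finite \<Rightarrow> real^'i) \<Rightarrow> real^'i \<Rightarrow> real^'j::finite^'i" where
  "frame_matrix Y x = (\<chi> i \<mu>. Y \<mu> x $ i)"

lemma frame_expansion:
  fixes Y :: "'i::finite \<Rightarrow> real^'i \<Rightarrow> real^'i"
  assumes "invertible (frame_matrix Y x)"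
  obtains c where "v = (\<Sum>\<mu>\<in>UNIV. c \<mu> *\<^sub>R Y \<mu> x)"
proof -
  define w where "w = matrix_inv (frame_matrix Y x) *v v"
  have "v = frame_matrix Y x *v w"
    unfolding w_def using assms by (simp add: matrix_vector_mul_assoc matrix_inv_mult)
  also have "\<dots> = (\<Sum>\<mu>\<in>UNIV. w $ \<mu> *\<^sub>R Y \<mu> x)"
    by (simp add: vec_eq_iff matrix_vector_mult_def frame_matrix_def mult.commute)
  finally show ?thesis by (rule that)
qed

text \<open>Pointwise identities that are linear in a vector may be tested on the frame, where
  commutation and the Killing equations can be inserted.\<close>

lemma linear_zero_on_frame:
  fixes Y :: "'i::finite \<Rightarrow> real^'i \<Rightarrow> real^'i" and L :: "real^'i \<Rightarrow> 'b::real_vector"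
  assumes "invertible (frame_matrix Y x)" "linear L" "\<And>\<mu>. L (Y \<mu> x) = 0"
  shows "L v = 0"
proof -
  obtain c where "v = (\<Sum>\<mu>\<in>UNIV. c \<mu> *\<^sub>R Y \<mu> x)" using frame_expansion[OF assms(1)] .
  then show ?thesis using assms(2,3) by (simp add: linear_sum linear_scale)
qed

lemma invertible_eta: "invertible ((\<chi> \<mu> \<nu>. eta \<mu> \<nu>) :: real^('n::finite option)^('n option))"
proof -
  let ?\<eta> = "(\<chi> \<mu> \<nu>. eta \<mu> \<nu>) :: real^('n option)^('n option)"
  have "eta i k * eta k j = (if k = i then eta i i * eta i j else 0)" for i j k :: "'n option"
    by (simp add: eta_def)
  then have "?\<eta> ** ?\<eta> = mat 1"
    by (simp add: matrix_matrix_mult_def mat_def vec_eq_iff eta_def)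
  then show ?thesis unfolding invertible_def by blast
qed

lemma invertible_of_congruent_eta:
  fixes M P :: "real^('n::finite option)^('n option)"
  assumes "transpose P ** M ** P = (\<chi> \<mu> \<nu>. eta \<mu> \<nu>)"
  shows "invertible M" "invertible P"
proof -
  have "det (transpose P ** M ** P) \<noteq> 0"
    unfolding assms using invertible_eta invertible_det_nz by blast
  then show "invertible M" "invertible P" by (simp_all add: invertible_det_nz det_mul)
qed

lemma gram_matrix:
  "(transpose (frame_matrix Y x) ** M ** frame_matrix Y x) $ \<mu> $ \<nu> = bil M (Y \<mu> x) (Y \<nu> x)"
proof -
  have "(transpose (frame_matrix Y x) ** M ** frame_matrix Y x) $ \<mu> $ \<nu>
    = (\<Sum>j\<in>UNIV. \<Sum>i\<in>UNIV. M $ i $ j * Y \<mu> x $ i * Y \<nu> x $ j)"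
    by (simp add: matrix_matrix_mult_def transpose_def frame_matrix_def sum_distrib_left sum_distrib_right mult_ac)
  also have "\<dots> = bil M (Y \<mu> x) (Y \<nu> x)" unfolding bil_def by (rule sum.swap)
  finally show ?thesis .
qed

text \<open>Orthonormality alone does not suffice: the left-invariant Killing fields of a round \<open>S\<^sup>3\<close> are
  orthonormal but do not commute.\<close>

definition translation_frame_at ::
    "(real^('n::finite option)) set \<Rightarrow> (real^('n option) \<Rightarrow> real^('n option)^('n option)) \<Rightarrow>
      ('n option \<Rightarrow> real^('n option) \<Rightarrow> real^('n option)) \<Rightarrow> real^('n option) \<Rightarrow> bool" where
  "translation_frame_at S g Y x \<longleftrightarrow>
     (\<forall>\<mu> \<nu>. bil (g x) (Y \<mu> x) (Y \<nu> x) = eta \<mu> \<nu>) \<and> (\<forall>\<mu> \<nu>. lie_bracket S (Y \<mu>) (Y \<nu>) x = 0)"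

lemma orthonormal_imp_invertible:
  fixes Y :: "'n option \<Rightarrow> real^('n::finite option) \<Rightarrow> real^('n option)"
  assumes "\<And>\<mu> \<nu>. bil (g x) (Y \<mu> x) (Y \<nu> x) = eta \<mu> \<nu>"
  shows "invertible (frame_matrix Y x)"
  by (rule invertible_of_congruent_eta(2)[of _ "g x"]) (simp add: vec_eq_iff gram_matrix assms)

text \<open>The Lie derivative along \<open>Y\<^sub>\<kappa>\<close> annihilates \<open>g\<close> and, as the fields commute, every \<open>Y\<^sub>\<mu>\<close>.\<close>

lemma frame_products_locally_constant:
  fixes Y :: "'i::finite \<Rightarrow> real^'i \<Rightarrow> real^'i"
  assumes T: "thick S" and x: "x \<in> S" and g: "C_on 1 S g" and Y: "\<And>\<mu>. C_on 1 S (Y \<mu>)"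
    and K: "\<And>\<mu>. killing_at S g (Y \<mu>) x" and Z: "\<And>\<mu> \<nu>. lie_bracket S (Y \<mu>) (Y \<nu>) x = 0"
    and F: "invertible (frame_matrix Y x)"
  shows "((\<lambda>y. bil (g y) (Y \<mu> y) (Y \<nu> y)) has_derivative (\<lambda>v. 0)) (at x within S)"
proof -
  have g1: "C_on (Suc 0) S g" and Y1: "C_on (Suc 0) S (Y \<mu>)" for \<mu> using g Y by simp_all
  note d = has_derivative_bil[OF has_derivative_D_on[OF g1 x] has_derivative_D_on[OF Y1 x] has_derivative_D_on[OF Y1 x], of \<mu> \<nu>]
  have "bil (D_on S g x v) (Y \<mu> x) (Y \<nu> x) + bil (g x) (D_on S (Y \<mu>) x v) (Y \<nu> x)
      + bil (g x) (Y \<mu> x) (D_on S (Y \<nu>) x v) = 0" for v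
  proof (rule linear_zero_on_frame[OF F has_derivative_linear[OF d]])
    fix \<kappa>
    have "D_on S (Y \<rho>) x (Y \<kappa> x) = D_on S (Y \<kappa>) x (Y \<rho> x)" for \<rho>
      using Z[of \<kappa> \<rho>] by (simp add: lie_bracket_def)
    then show "bil (D_on S g x (Y \<kappa> x)) (Y \<mu> x) (Y \<nu> x) + bil (g x) (D_on S (Y \<mu>) x (Y \<kappa> x)) (Y \<nu> x)
      + bil (g x) (Y \<mu> x) (D_on S (Y \<nu>) x (Y \<kappa> x)) = 0"
      using K[of \<kappa>] unfolding killing_at_def by simp
  qed
  with d show ?thesis by simp
qed

lemma D_on_bil_bound:
  fixes g :: "real^'i::finite \<Rightarrow> real^'i^'i"
  assumes g: "C_on 1 S g" and z: "z \<in> S" and b: "\<And>i j k. \<bar>partial S k g z $ i $ j\<bar> \<le> \<mu>"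
  shows "\<bar>bil (D_on S g z v) a b\<bar> \<le> (real CARD('i))^3 * \<mu> * norm v * norm a * norm b"
proof -
  have g1: "C_on (Suc 0) S g" using g by simp
  have "\<bar>D_on S g z v $ i $ j\<bar> \<le> real CARD('i) * \<mu> * norm v" for i j
  proof -
    have "D_on S g z v $ i $ j = (\<Sum>k\<in>UNIV. v $ k * partial S k g z $ i $ j)"
      unfolding D_on_expansion[OF g1 z] by simp
    also have "\<bar>\<dots>\<bar> \<le> (\<Sum>k\<in>(UNIV::'i set). norm v * \<mu>)"
      by (rule order_trans[OF sum_abs sum_mono]) (auto simp: abs_mult intro!: mult_mono b component_le_norm_cart)
    finally show ?thesis by (simp add: mult_ac)
  qed
  from bil_bound[OF this, of a b] show ?thesis by (simp add: power2_eq_square power3_eq_cube mult_ac)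
qed

lemma norm_matrix_vector_bound:
  fixes M :: "real^'k::finite^'k"
  assumes "\<And>i j. \<bar>M $ i $ j\<bar> \<le> \<mu>"
  shows "norm (M *v v) \<le> (real CARD('k))\<^sup>2 * \<mu> * norm v"
proof (cases "norm (M *v v) = 0")
  case True
  have "0 \<le> \<mu>" using assms[of undefined undefined] by linarith
  then show ?thesis using True by simp
next
  case False
  have "(norm (M *v v))\<^sup>2 = bil M (M *v v) v" by (simp add: bil_eq_inner power2_norm_eq_inner)
  also have "\<dots> \<le> (real CARD('k))\<^sup>2 * \<mu> * norm (M *v v) * norm v"
    using bil_bound[OF assms, of "M *v v" v] by linarith
  finally show ?thesis using False by (simp add: power2_eq_square mult_ac)
qed

text \<open>Nondegeneracy at one point is made quantitative and uniform nearby: an injective linear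
  map is bounded below, and a perturbation with small entries costs at most half of that
  bound.\<close>

lemma lower_bound_near:
  fixes P :: "real^'i::finite \<Rightarrow> real^'k^'k::finite"
  assumes P: "continuous_on S P" and x: "x \<in> S" and inv: "invertible (P x)"
  obtains m \<delta> where "0 < m" "0 < \<delta>" "\<And>z v. z \<in> S \<Longrightarrow> dist z x < \<delta> \<Longrightarrow> m * norm v \<le> norm (P z *v v)"
proof -
  have "inj ((*v) (P x))"
    using inv by (metis invertible_def inj_matrix_vector_mult)
  then obtain B where B: "B > 0" "\<And>v. B * norm v \<le> norm (P x *v v)"
    using linear_inj_bounded_below_pos matrix_vector_mul_linear by blast
  define N where "N = (real CARD('k))\<^sup>2"
  have N: "N > 0" by (simp add: N_def)
  have "B / (2 * N) > 0" using B N by simp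
  then obtain \<delta> where \<delta>: "\<delta> > 0" "\<And>z. z \<in> S \<Longrightarrow> dist z x < \<delta> \<Longrightarrow> dist (P z) (P x) < B / (2 * N)"
    using P x unfolding continuous_on_iff by metis
  have "B / 2 * norm v \<le> norm (P z *v v)" if z: "z \<in> S" "dist z x < \<delta>" for z v
  proof -
    let ?M = "P z - P x"
    have entry: "\<bar>?M $ i $ j\<bar> \<le> B / (2 * N)" for i j
      using component_le_norm_cart[of "?M $ i" j] Finite_Cartesian_Product.norm_nth_le[of ?M i] \<delta>(2)[OF z]
      by (simp add: dist_norm)
    have "norm (?M *v v) \<le> B / 2 * norm v"
      using norm_matrix_vector_bound[OF entry, of v] N unfolding N_def by simp
    moreover have "P x *v v = P z *v v - ?M *v v" by (simp add: matrix_vector_mult_diff_rdistrib)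
    then have "norm (P x *v v) \<le> norm (P z *v v) + norm (?M *v v)"
      using norm_triangle_ineq4[of "P z *v v" "?M *v v"] by simp
    ultimately show ?thesis using B(2)[of v] by simp
  qed
  then show ?thesis using that[of "B / 2" \<delta>] B \<delta> by simp
qed

lemma invertible_of_lower_bound:
  fixes P :: "real^'k::finite^'k"
  assumes "0 < m" "\<And>v. m * norm v \<le> norm (P *v v)"
  shows "invertible P"
proof -
  have "v = 0" if "P *v v = 0" for v
    using assms(2)[of v] that assms(1) by (simp add: mult_le_0_iff)
  then have "\<exists>B. B ** P = mat 1" using matrix_left_invertible_ker by blast
  then show ?thesis using matrix_left_right_inverse unfolding invertible_def by blast
qed

lemma killing_at_open_subset:
  assumes "open W" "W \<subseteq> S" "x \<in> W" "killing_at S g X x"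
  shows "killing_at W g X x"
  using assms(4) unfolding killing_at_def D_on_open_subset[OF assms(1-3)] .

lemma lie_bracket_open_subset:
  assumes "open W" "W \<subseteq> S" "x \<in> W"
  shows "lie_bracket W X Y x = lie_bracket S X Y x"
  unfolding lie_bracket_def D_on_open_subset[OF assms] ..

lemma local_bound:
  fixes f :: "'j::finite \<Rightarrow> 'a::metric_space \<Rightarrow> 'b::real_normed_vector"
  assumes "\<And>j. continuous_on S (f j)" "x \<in> S"
  obtains B \<delta> where "0 < \<delta>" "\<And>j z. z \<in> S \<Longrightarrow> dist z x < \<delta> \<Longrightarrow> norm (f j z) \<le> B"
proof -
  have "\<exists>\<delta>>0. \<forall>z\<in>S. dist z x < \<delta> \<longrightarrow> dist (f j z) (f j x) < 1" for j
    using assms(1)[of j] assms(2) unfolding continuous_on_iff by (meson zero_less_one)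
  then obtain \<rho> where \<rho>: "\<And>j. \<rho> j > 0" "\<And>j z. z \<in> S \<Longrightarrow> dist z x < \<rho> j \<Longrightarrow> dist (f j z) (f j x) < 1"
    by metis
  define \<delta> where "\<delta> = Min (range \<rho>)"
  have \<delta>: "\<delta> > 0" "\<And>j. \<delta> \<le> \<rho> j" using \<rho>(1) by (auto simp: \<delta>_def)
  have "norm (f j z) \<le> (\<Sum>j\<in>UNIV. norm (f j x)) + 1" if "z \<in> S" "dist z x < \<delta>" for j z
  proof -
    have "norm (f j z) \<le> norm (f j x) + norm (f j z - f j x)"
      using norm_triangle_ineq[of "f j x" "f j z - f j x"] by simp
    moreover have "norm (f j z - f j x) < 1" using \<rho>(2)[of z j] that \<delta>(2)[of j] by (simp add: dist_norm)
    moreover have "norm (f j x) \<le> (\<Sum>j\<in>UNIV. norm (f j x))" by (rule member_le_sum) auto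
    ultimately show ?thesis by linarith
  qed
  with \<delta> that show ?thesis by blast
qed

lemma frame_products_constant:
  fixes Y :: "'i::finite \<Rightarrow> real^'i \<Rightarrow> real^'i"
  assumes W: "open W" "convex W" and g: "C_on 1 W g" and Y: "\<And>\<mu>. C_on 1 W (Y \<mu>)"
    and K: "\<And>\<mu> x. x \<in> W \<Longrightarrow> killing_at W g (Y \<mu>) x"
    and Z: "\<And>\<mu> \<nu> x. x \<in> W \<Longrightarrow> lie_bracket W (Y \<mu>) (Y \<nu>) x = 0"
    and F: "\<And>x. x \<in> W \<Longrightarrow> invertible (frame_matrix Y x)"
    and x: "x \<in> W" and y: "y \<in> W"
  shows "bil (g x) (Y \<mu> x) (Y \<nu> x) = bil (g y) (Y \<mu> y) (Y \<nu> y)"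
proof -
  have "\<exists>c. \<forall>x\<in>W. bil (g x) (Y \<mu> x) (Y \<nu> x) = c"
    using has_derivative_zero_constant[OF W(2)
        frame_products_locally_constant[OF open_thick[OF W(1)] _ g Y K Z F]] by blast
  then show ?thesis using x y by auto
qed

text \<open>On a small half-ball the brackets are Killing fields with an open zero set, hence zero; then
  the products are constant.\<close>

lemma translation_frame_propagates:
  fixes g :: "real^('n::finite option) \<Rightarrow> real^('n option)^('n option)"
  assumes S: "coord_domain S" and g: "C_on 2 S g" "\<And>x. x \<in> S \<Longrightarrow> transpose (g x) = g x" "\<And>x. x \<in> S \<Longrightarrow> invertible (g x)"
    and Y: "\<And>\<mu>. C_on 1 S (Y \<mu>)" and K: "\<And>\<mu> x. x \<in> S \<Longrightarrow> killing_at S g (Y \<mu>) x"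
    and x0: "x0 \<in> S"
    and V: "\<And>\<delta>. 0 < \<delta> \<Longrightarrow> \<exists>V. openin (top_of_set S) V \<and> V \<noteq> {} \<and> V \<subseteq> ball x0 \<delta> \<and> (\<forall>x\<in>V. translation_frame_at S g Y x)"
  obtains \<delta> where "0 < \<delta>" "\<And>x. x \<in> S \<inter> ball x0 \<delta> \<Longrightarrow> translation_frame_at S g Y x"
proof -
  have T: "thick S" by (rule coord_domain_thick[OF S])
  have Y1: "C_on (Suc 0) S (Y \<mu>)" for \<mu> using Y by simp
  have g1: "C_on 1 S g" by (rule C_on_le[OF g(1)]) simp
  have cf: "continuous_on S (\<lambda>x. bil (g x) (Y \<mu> x) (Y \<nu> x))" for \<mu> \<nu>
    by (rule C_on_imp_continuous_on[OF C_on_bil[OF T g1 Y Y]])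
  have cZ: "continuous_on S (lie_bracket S (Y \<mu>) (Y \<nu>))" for \<mu> \<nu>
    by (rule C_on_imp_continuous_on[OF C_on_lie_bracket[OF T Y1 Y1]])
  define A where "A = {x \<in> S. translation_frame_at S g Y x}"
  \<comment> \<open>The point \<open>x0\<close> is a limit of points where the fields are
    orthonormal. By continuity they are orthonormal at \<open>x0\<close>, hence a basis nearby,
    before their products are known on the ball.\<close>
  have "x0 \<in> closure A" unfolding closure_approachable
  proof (intro allI impI)
    fix \<delta> :: real assume "0 < \<delta>"
    then obtain V where "openin (top_of_set S) V" "V \<noteq> {}" "V \<subseteq> ball x0 \<delta>" "\<forall>x\<in>V. translation_frame_at S g Y x"
      using V by blast
    then obtain z where "z \<in> A" "z \<in> ball x0 \<delta>" using openin_imp_subset unfolding A_def by blast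
    then show "\<exists>y\<in>A. dist y x0 < \<delta>" by (auto simp: dist_commute)
  qed
  then have "bil (g x0) (Y \<mu> x0) (Y \<nu> x0) = eta \<mu> \<nu>" for \<mu> \<nu>
    by (intro constant_on_closure_within[OF cf _ _ x0]) (auto simp: A_def translation_frame_at_def)
  then have inv: "invertible (frame_matrix Y x0)" by (rule orthonormal_imp_invertible)
  have cP: "continuous_on S (frame_matrix Y)"
    unfolding frame_matrix_def[abs_def] using C_on_imp_continuous_on[OF Y] by (intro continuous_intros)
  obtain m1 \<delta>1 where m1: "0 < m1" "0 < \<delta>1" "\<And>z v. z \<in> S \<Longrightarrow> dist z x0 < \<delta>1 \<Longrightarrow> m1 * norm v \<le> norm (frame_matrix Y z *v v)"
    by (rule lower_bound_near[OF cP x0 inv]) blast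
  obtain m \<delta>2 where m: "0 < m" "0 < \<delta>2" "\<And>z v. z \<in> S \<Longrightarrow> dist z x0 < \<delta>2 \<Longrightarrow> m * norm v \<le> norm (g z *v v)"
    by (rule lower_bound_near[OF C_on_imp_continuous_on[OF g1] x0 g(3)[OF x0]]) blast
  have "continuous_on S (partial S k g)" for k using g1 by simp
  then obtain B \<delta>3 where B: "0 < \<delta>3" "\<And>k z. z \<in> S \<Longrightarrow> dist z x0 < \<delta>3 \<Longrightarrow> norm (partial S k g z) \<le> B"
    by (rule local_bound[where f="\<lambda>k. partial S k g", OF _ x0]) blast
  obtain B' \<delta>4 where B': "0 < \<delta>4"
    "\<And>p z. z \<in> S \<Longrightarrow> dist z x0 < \<delta>4 \<Longrightarrow> norm (case p of (\<mu>, \<nu>) \<Rightarrow> lie_bracket S (Y \<mu>) (Y \<nu>) z) \<le> B'"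
    by (rule local_bound[OF _ x0, of "\<lambda>p z. case p of (\<mu>, \<nu>) \<Rightarrow> lie_bracket S (Y \<mu>) (Y \<nu>) z"])
      (auto split: prod.split intro: cZ)
  \<comment> \<open>Within these radii the fields form a basis, the metric is bounded below, its
    first derivatives are bounded, and so are all brackets.\<close>
  have "0 < min (min \<delta>1 \<delta>2) (min \<delta>3 \<delta>4)" using m1 m B B' by simp
  from coord_domain_nbhd[OF S x0 this]
  obtain \<delta> W where \<delta>: "0 < \<delta>" "\<delta> \<le> min (min \<delta>1 \<delta>2) (min \<delta>3 \<delta>4)"
    and W: "open W" "convex W" "W \<subseteq> S \<inter> ball x0 \<delta>" "S \<inter> ball x0 \<delta> \<subseteq> closure W" by blast
  have WS: "W \<subseteq> S" using W by blast
  have near: "dist z x0 < \<delta>1" "dist z x0 < \<delta>2" "dist z x0 < \<delta>3" "dist z x0 < \<delta>4" "z \<in> S" if "z \<in> W" for z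
    using W(3) that \<delta>(2) by (auto simp: dist_commute)
  \<comment> \<open>The size of the ball is fixed before the open set is chosen in it; the
    assumption on \<open>V\<close> therefore speaks of all radii.\<close>
  obtain V where V': "openin (top_of_set S) V" "V \<noteq> {}" "V \<subseteq> ball x0 \<delta>" "\<forall>x\<in>V. translation_frame_at S g Y x"
    using V[OF \<delta>(1)] by blast
  obtain O' where O': "open O'" "V = S \<inter> O'" using V'(1) unfolding openin_open by blast
  \<comment> \<open>\<open>V\<close> is only relatively open and may touch the boundary; density of
    \<open>W\<close> in the relative ball makes it meet \<open>W\<close> in an open set.\<close>
  have VW: "open (O' \<inter> W)" "O' \<inter> W \<subseteq> W" "O' \<inter> W \<noteq> {}"
  proof -
    obtain z where z: "z \<in> V" using V' by blast
    then have "z \<in> closure W" using V' O' W(4) by blast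
    then show "O' \<inter> W \<noteq> {}" using z O' open_Int_closure_eq_empty[OF O'(1), of W] by blast
  qed (use O' W in auto)
  have hold_V: "translation_frame_at S g Y x" if "x \<in> O' \<inter> W" for x
    using that V'(4) O'(2) WS by blast
  have gW: "C_on 2 W g" "C_on 1 W g" by (rule C_on_open_subset[OF g(1) W(1) WS], rule C_on_open_subset[OF g1 W(1) WS])
  have gW': "transpose (g x) = g x" "invertible (g x)" if "x \<in> W" for x using g that WS by auto
  have YW: "C_on 1 W (Y \<mu>)" for \<mu> by (rule C_on_open_subset[OF Y W(1) WS])
  have KW: "killing_at W g (Y \<mu>) x" if "x \<in> W" for \<mu> x
    by (rule killing_at_open_subset[OF W(1) WS that K]) (use that WS in blast)
  have YW2: "C_on 2 W (Y \<mu>)" for \<mu>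
    by (rule killing_C2[OF W(1) gW(1) gW'(1) gW'(2) YW KW])
  have bracketW: "lie_bracket W (Y \<mu>) (Y \<nu>) x = lie_bracket S (Y \<mu>) (Y \<nu>) x" if "x \<in> W" for \<mu> \<nu> x
    by (rule lie_bracket_open_subset[OF W(1) WS that])
  have ZW: "lie_bracket W (Y \<mu>) (Y \<nu>) x = 0" if x: "x \<in> W" for \<mu> \<nu> x
  proof (rule killing_unique_continuation[OF W(1,2) gW(2) gW'(1) _ _ _ _ m(1) _ _ _ VW _ x,
        where B = B' and d = "2 * \<delta>" and C = "(real CARD('n option))^3 * \<bar>B\<bar>"])
    have "C_on (Suc 1) W (Y \<mu>)" for \<mu> using YW2[of \<mu>] by (simp add: numeral_2_eq_2)
    then show "C_on 1 W (lie_bracket W (Y \<mu>) (Y \<nu>))"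
      using C_on_lie_bracket[OF open_thick[OF W(1)]] by blast
    show "killing_at W g (lie_bracket W (Y \<mu>) (Y \<nu>)) x" if "x \<in> W" for x
      by (rule killing_lie_bracket[OF W(1) that gW(1) YW2 KW YW2 KW])
    show "\<bar>bil (D_on W g z v) a b\<bar> \<le> (real CARD('n option))^3 * \<bar>B\<bar> * norm v * norm a * norm b"
      if z: "z \<in> W" for z v a b
    proof (rule D_on_bil_bound[OF gW(2) z])
      fix i j k
      have eq: "partial W k g z = partial S k g z"
        unfolding partial_def D_on_open_subset[OF W(1) WS z] ..
      have "\<bar>partial S k g z $ i $ j\<bar> \<le> norm (partial S k g z)"
        using component_le_norm_cart[of "partial S k g z $ i" j] Finite_Cartesian_Product.norm_nth_le[of "partial S k g z" i]
        by simp
      then show "\<bar>partial W k g z $ i $ j\<bar> \<le> \<bar>B\<bar>" using B(2)[of z k] near[OF z] eq by simp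
    qed
    show "m * norm v \<le> norm (g z *v v)" if "z \<in> W" for z v using m(3) near[OF that] by blast
    show "norm (y - z) \<le> 2 * \<delta>" if "y \<in> W" "z \<in> W" for y z
    proof -
      have "dist x0 y < \<delta>" "dist x0 z < \<delta>" using that W(3) by auto
      then have "dist y z < 2 * \<delta>" using dist_triangle[of y z x0] by (simp add: dist_commute)
      then show ?thesis by (simp add: dist_norm)
    qed
    show "norm (lie_bracket W (Y \<mu>) (Y \<nu>) y) \<le> B'" if "y \<in> W" for y
      using B'(2)[of y "(\<mu>, \<nu>)"] near[OF that] bracketW[OF that] by simp
    show "lie_bracket W (Y \<mu>) (Y \<nu>) y = 0" if "y \<in> O' \<inter> W" for y
      using hold_V[OF that] bracketW[of y] that unfolding translation_frame_at_def by simp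
  qed (assumption | intro mult_nonneg_nonneg zero_le_power of_nat_0_le_iff abs_ge_zero)+
  have FW: "invertible (frame_matrix Y x)" if "x \<in> W" for x
    by (rule invertible_of_lower_bound[OF m1(1)]) (use m1(3) near[OF that] in blast)
  obtain z where z: "z \<in> O' \<inter> W" using VW(3) by blast
  have fW: "bil (g x) (Y \<mu> x) (Y \<nu> x) = eta \<mu> \<nu>" if "x \<in> W" for x \<mu> \<nu>
    using frame_products_constant[where Y=Y and g=g, OF W(1,2) gW(2) YW KW ZW FW that, of z] z hold_V[OF z]
    unfolding translation_frame_at_def by simp
  have "translation_frame_at S g Y x" if x: "x \<in> S \<inter> ball x0 \<delta>" for x
  proof -
    have xc: "x \<in> S" "x \<in> closure W" using x W(4) by auto
    have "bil (g x) (Y \<mu> x) (Y \<nu> x) = eta \<mu> \<nu>" for \<mu> \<nu>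
      by (rule constant_on_closure_within[OF cf WS fW xc])
    moreover have "lie_bracket S (Y \<mu>) (Y \<nu>) x = 0" for \<mu> \<nu>
      by (rule constant_on_closure_within[OF cZ WS _ xc]) (use bracketW ZW in simp)
    ultimately show ?thesis unfolding translation_frame_at_def by blast
  qed
  with \<delta>(1) that show ?thesis by blast
qed

section \<open>Curvature\<close>

text \<open>The expression is \<open>d\<theta>(a, b)\<close> for the one-form \<open>\<theta> = g(Y\<^sub>\<mu>, \<cdot>)\<close>, which for a Killing field is
  twice the lowered covariant derivative.\<close>

lemma translation_frame_closed:
  fixes Y :: "'i::finite \<Rightarrow> real^'i \<Rightarrow> real^'i"
  assumes T: "thick S" and x: "x \<in> S" and g: "C_on 1 S g" and Y: "\<And>\<mu>. C_on 1 S (Y \<mu>)"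
    and K: "\<And>\<mu>. killing_at S g (Y \<mu>) x" and Z: "\<And>\<mu> \<nu>. lie_bracket S (Y \<mu>) (Y \<nu>) x = 0"
    and F: "invertible (frame_matrix Y x)"
  shows "bil (D_on S g x a) (Y \<mu> x) b + bil (g x) (D_on S (Y \<mu>) x a) b
      - bil (D_on S g x b) (Y \<mu> x) a - bil (g x) (D_on S (Y \<mu>) x b) a = 0"
proof -
  have g1: "C_on (Suc 0) S g" and Y1: "C_on (Suc 0) S (Y \<mu>)" for \<mu> using g Y by simp_all
  have lg: "linear (D_on S g x)" and lY: "linear (D_on S (Y \<mu>) x)" for \<mu>
    by (rule linear_D_on[OF g1 x], rule linear_D_on[OF Y1 x])
  define \<omega> where "\<omega> a b = bil (D_on S g x a) (Y \<mu> x) b + bil (g x) (D_on S (Y \<mu>) x a) b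
      - bil (D_on S g x b) (Y \<mu> x) a - bil (g x) (D_on S (Y \<mu>) x b) a" for a b
  have l: "linear (\<lambda>a. \<omega> a b)" and r: "linear (\<omega> a)" for a b
    unfolding \<omega>_def[abs_def]
    by (auto intro!: linearI simp: linear_add[OF lg] linear_scale[OF lg] linear_add[OF lY] linear_scale[OF lY]
        bil_add bil_scaleR algebra_simps)
  \<comment> \<open>Two derivatives of the same product function are compared: zero, because the
    products are locally constant to first order, and the one from the product rule.\<close>
  have df: "bil (D_on S g x v) (Y \<mu> x) (Y \<nu> x) + bil (g x) (D_on S (Y \<mu>) x v) (Y \<nu> x)
      + bil (g x) (Y \<mu> x) (D_on S (Y \<nu>) x v) = 0" for \<nu> v
    using D_on_eq[OF T x frame_products_locally_constant[OF T x g Y K Z F]]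
      D_on_eq[OF T x has_derivative_bil[OF has_derivative_D_on[OF g1 x] has_derivative_D_on[OF Y1 x] has_derivative_D_on[OF Y1 x]]]
    by metis
  have frame: "\<omega> (Y \<alpha> x) (Y \<gamma> x) = 0" for \<alpha> \<gamma>
  proof -
    have "D_on S (Y \<gamma>) x (Y \<alpha> x) = D_on S (Y \<alpha>) x (Y \<gamma> x)"
      using Z[of \<alpha> \<gamma>] by (simp add: lie_bracket_def)
    then show ?thesis unfolding \<omega>_def using df[of "Y \<alpha> x" \<gamma>] df[of "Y \<gamma> x" \<alpha>] by simp
  qed
  have "\<omega> a (Y \<gamma> x) = 0" for a \<gamma>
    by (rule linear_zero_on_frame[OF F l frame])
  then have "\<omega> a b = 0" for a b
    by (rule linear_zero_on_frame[OF F r])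
  then show ?thesis unfolding \<omega>_def by blast
qed

lemma transpose_D_on:
  fixes g :: "real^'i::finite \<Rightarrow> real^'i^'i"
  assumes T: "thick S" and x: "x \<in> S" and g: "C_on (Suc k) S g" "\<And>x. x \<in> S \<Longrightarrow> transpose (g x) = g x"
  shows "transpose (D_on S g x v) = D_on S g x v"
proof -
  have l: "bounded_linear (transpose :: real^'i^'i \<Rightarrow> _)"
    unfolding linear_conv_bounded_linear[symmetric]
    by (intro linearI) (simp_all add: transpose_def vec_eq_iff)
  have "(g has_derivative (\<lambda>v. transpose (D_on S g x v))) (at x within S)"
    by (rule has_derivative_transform[OF x _ bounded_linear.has_derivative[OF l has_derivative_D_on[OF g(1) x]]])
      (use g(2) in simp)
  from fun_cong[OF D_on_eq[OF T x this], of v] show ?thesis by (rule sym)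
qed

text \<open>With \<theta> the lowered field, twice the lowered covariant derivative is the Lie
  derivative of the metric plus the exterior derivative of \<theta>. The first vanishes by the
  Killing equation, the second by \<open>translation_frame_closed\<close>.\<close>

lemma covariant_derivative_translation_frame:
  fixes g :: "('m, 'i::finite) bilinear_field" and Y :: "'i \<Rightarrow> ('m, 'i) vector_field"
  assumes T: "thick (image_of c)" "x \<in> image_of c" and g: "C_on 1 (image_of c) (g c)"
    and sym: "\<And>x. x \<in> image_of c \<Longrightarrow> transpose (g c x) = g c x" and inv: "invertible (g c x)"
    and Y: "\<And>\<mu>. C_on 1 (image_of c) (Y \<mu> c)"
    and K: "\<And>\<mu>. killing_at (image_of c) (g c) (Y \<mu> c) x"
    and Z: "\<And>\<mu> \<nu>. lie_bracket (image_of c) (Y \<mu> c) (Y \<nu> c) x = 0"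
    and F: "invertible (frame_matrix (\<lambda>\<mu>. Y \<mu> c) x)"
  shows "covariant_derivative g (Y \<mu>) c i k x = 0"
proof -
  let ?S = "image_of c" and ?X = "Y \<mu> c x"
  let ?G = "D_on ?S (g c) x" and ?D = "D_on ?S (Y \<mu> c) x (axis i 1)"
  have g1: "C_on (Suc 0) ?S (g c)" and Y1: "C_on (Suc 0) ?S (Y \<mu> c)" for \<mu> using g Y by simp_all
  have symG: "bil (?G v) a b = bil (?G v) b a" for v a b
    using bil_transpose[of "?G v" a b] transpose_D_on[OF T g1 sym] by simp
  have symg: "bil (g c x) a b = bil (g c x) b a" for a b
    using bil_transpose[of "g c x" a b] sym[OF T(2)] by simp
  \<comment> \<open>Twice the Christoffel symbols of the first kind, contracted with the field; the
    aim is to see that they cancel the partial derivatives.\<close>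
  define w where "w l = (\<Sum>j\<in>UNIV. ?X $ j * (?G (axis i 1) $ j $ l + ?G (axis j 1) $ i $ l - ?G (axis l 1) $ i $ j))" for l
  have "w l = bil (?G (axis i 1)) ?X (axis l 1) + bil (?G ?X) (axis i 1) (axis l 1) - bil (?G (axis l 1)) (axis i 1) ?X" for l
  proof -
    have "bil (?G ?X) (axis i 1) (axis l 1) = (\<Sum>j\<in>UNIV. ?X $ j * ?G (axis j 1) $ i $ l)"
      unfolding bil_axis using linear_axis_expansion[OF linear_D_on[OF g1 T(2)], of ?X] by simp
    then show ?thesis
      by (simp add: w_def bil_axis_left bil_axis_right sum.distrib sum_subtractf algebra_simps)
  qed
  then have w: "w l = - 2 * bil (g c x) (axis l 1) ?D" for l
    using translation_frame_closed[where S="?S" and g="g c" and Y="\<lambda>\<mu>. Y \<mu> c", OF T g Y K Z F, of "axis i 1" \<mu> "axis l 1"]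
      K[of \<mu>, unfolded killing_at_def, rule_format, of "axis i 1" "axis l 1"]
      symG[of "axis l 1" "axis i 1" ?X] symg[of "axis l 1" ?D] symg[of "axis i 1" "D_on ?S (Y \<mu> c) x (axis l 1)"]
    by simp
  have "(\<Sum>j\<in>UNIV. christoffel g c k i j x * ?X $ j)
      = (\<Sum>j\<in>UNIV. \<Sum>l\<in>UNIV. matrix_inv (g c x) $ k $ l * (?X $ j * (?G (axis i 1) $ j $ l + ?G (axis j 1) $ i $ l - ?G (axis l 1) $ i $ j)) / 2)"
    unfolding christoffel_def partial_matrix_component[OF T g1]
    by (simp add: sum_distrib_left sum_distrib_right sum_divide_distrib mult_ac)
  also have "\<dots> = (\<Sum>l\<in>UNIV. matrix_inv (g c x) $ k $ l * w l / 2)"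
    by (subst sum.swap) (simp add: w_def sum_distrib_left sum_divide_distrib)
  also have "\<dots> = - (\<Sum>l\<in>UNIV. matrix_inv (g c x) $ k $ l * (g c x *v ?D) $ l)"
    by (simp add: w bil_eq_inner inner_axis' sum_negf)
  also have "\<dots> = - (matrix_inv (g c x) *v (g c x *v ?D)) $ k"
    by (subst (2) matrix_vector_mult_def) simp
  also have "\<dots> = - ?D $ k"
    using inv by (simp add: matrix_vector_mul_assoc matrix_inv_mult)
  finally show ?thesis
    unfolding covariant_derivative_def partial_component[OF T Y1] by simp
qed

lemma C_on_christoffel:
  fixes g :: "('m, 'i::finite) bilinear_field"
  assumes T: "thick (image_of c)" and g: "C_on 2 (image_of c) (g c)" and inv: "\<And>x. x \<in> image_of c \<Longrightarrow> invertible (g c x)"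
  shows "C_on 1 (image_of c) (christoffel g c k i j)"
proof -
  have g2: "C_on (Suc 1) (image_of c) (\<lambda>y. g c y $ a $ b)" for a b
    using C_on_vec_nth[OF T C_on_vec_nth[OF T g]] by (simp add: numeral_2_eq_2)
  have p: "C_on 1 (image_of c) (partial (image_of c) l (\<lambda>y. g c y $ a $ b))" for l a b
    using g2 by (simp only: C_on.simps)
  have "C_on 1 (image_of c) (\<lambda>x. (1 / 2) * (\<Sum>l\<in>UNIV. matrix_inv (g c x) $ k $ l *
        (partial (image_of c) i (\<lambda>y. g c y $ j $ l) x + partial (image_of c) j (\<lambda>y. g c y $ i $ l) x
         - partial (image_of c) l (\<lambda>y. g c y $ i $ j) x)))"
    using C_on_Suc_imp[OF g2] inv
    by (intro C_on_cmult C_on_sum C_on_mult C_on_add C_on_diff C_on_matrix_inv p T)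
  then show ?thesis by (rule C_on_congI) (simp add: christoffel_def)
qed

lemma continuous_on_riemann:
  fixes g :: "('m, 'i::finite) bilinear_field"
  assumes T: "thick (image_of c)" and g: "C_on 2 (image_of c) (g c)" and inv: "\<And>x. x \<in> image_of c \<Longrightarrow> invertible (g c x)"
  shows "continuous_on (image_of c) (riemann g c l k i j)"
proof -
  have G: "C_on 1 (image_of c) (christoffel g c b d e)" for b d e
    by (rule C_on_christoffel[where g=g and c=c, OF T g]) (rule inv)
  have p: "continuous_on (image_of c) (partial (image_of c) a (christoffel g c b d e))" for a b d e
    using G[of b d e] by simp
  show ?thesis
    unfolding riemann_def[abs_def]
    by (intro continuous_intros p C_on_imp_continuous_on[OF G])
qed

text \<open>The Ricci identity: for a parallel field, equality of mixed second derivatives says that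
  the curvature annihilates it. Parallel fields that span force every component to vanish. The open
  \<open>W\<close> is where second derivatives are known to commute.\<close>

lemma riemann_zero_interior:
  fixes g :: "('m, 'i::finite) bilinear_field" and Y :: "'i \<Rightarrow> ('m, 'i) vector_field"
  assumes T: "thick (image_of c)" and g: "C_on 2 (image_of c) (g c)" and inv: "\<And>x. x \<in> image_of c \<Longrightarrow> invertible (g c x)"
    and Y: "\<And>\<mu>. C_on 1 (image_of c) (Y \<mu> c)"
    and cd: "\<And>\<mu> i k x. x \<in> image_of c \<Longrightarrow> covariant_derivative g (Y \<mu>) c i k x = 0"
    and F: "invertible (frame_matrix (\<lambda>\<mu>. Y \<mu> c) x)"
    and W: "open W" "W \<subseteq> image_of c" "x \<in> W"
  shows "riemann g c l k i j x = 0"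
proof -
  let ?S = "image_of c"
  define \<Gamma> where "\<Gamma> = christoffel g c"
  have G: "C_on 1 ?S (\<Gamma> a b d)" for a b d unfolding \<Gamma>_def by (rule C_on_christoffel[where g=g and c=c, OF T g]) (rule inv)
  have x: "x \<in> ?S" using W by blast
  have dG: "\<Gamma> a b d differentiable (at x within ?S)" for a b d
    using G[of a b d] x by (simp add: differentiable_on_def)
  have Yc: "C_on 1 ?S (\<lambda>y. Y \<mu> c y $ a)" for \<mu> a by (rule C_on_vec_nth[OF T Y])
  have dY: "(\<lambda>y. Y \<mu> c y $ a) differentiable (at x within ?S)" for \<mu> a
    using Yc[of \<mu> a] x by (simp add: differentiable_on_def)
  have first: "partial ?S b (\<lambda>y. Y \<mu> c y $ a) y = (\<Sum>d\<in>UNIV. - (\<Gamma> a b d y * Y \<mu> c y $ d))" if "y \<in> ?S" for \<mu> a b y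
    using cd[OF that, of \<mu> b a] unfolding covariant_derivative_def \<Gamma>_def by (simp add: sum_negf)
  \<comment> \<open>The parallel equation gives the partial derivatives as products of
    \<open>C\<^sup>1\<close> functions, which makes the fields \<open>C\<^sup>2\<close>.\<close>
  have C1: "C_on 1 ?S (partial ?S b (\<lambda>y. Y \<mu> c y $ a))" for \<mu> a b
  proof (rule C_on_congI)
    show "C_on 1 ?S (\<lambda>y. \<Sum>d\<in>UNIV. - (\<Gamma> a b d y * Y \<mu> c y $ d))"
      by (intro C_on_sum C_on_uminus C_on_mult T G Yc)
  qed (rule first)
  then have C2: "C_on 2 ?S (\<lambda>y. Y \<mu> c y $ a)" for \<mu> a
    using Yc[of \<mu> a] by (simp add: numeral_2_eq_2)
  have sym: "partial ?S e (partial ?S b (\<lambda>y. Y \<mu> c y $ a)) x = partial ?S b (partial ?S e (\<lambda>y. Y \<mu> c y $ a)) x" for \<mu> a b e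
  proof -
    have eq: "partial W e (partial W b f) x = partial ?S e (partial ?S b f) x" for e b and f :: "real^'i \<Rightarrow> real"
    proof -
      have "partial W e (partial W b f) x = partial W e (partial ?S b f) x"
        by (rule partial_cong[OF _ W(3)]) (simp add: partial_def D_on_open_subset[OF W(1,2)])
      also have "\<dots> = partial ?S e (partial ?S b f) x"
        by (simp add: partial_def D_on_open_subset[OF W])
      finally show ?thesis .
    qed
    have "D_on W (\<lambda>y. D_on W (\<lambda>y. Y \<mu> c y $ a) y (axis b 1)) x (axis e 1)
        = D_on W (\<lambda>y. D_on W (\<lambda>y. Y \<mu> c y $ a) y (axis e 1)) x (axis b 1)"
      by (rule symmetric_second_derivative[OF W(1,3) C_on_open_subset[OF C2 W(1,2)]])
    then show ?thesis
      unfolding eq[symmetric] by (simp add: partial_def[abs_def])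
  qed
  have second: "partial ?S e (partial ?S b (\<lambda>y. Y \<mu> c y $ a)) x
      = (\<Sum>m\<in>UNIV. \<Sum>d\<in>UNIV. \<Gamma> a b m x * \<Gamma> m e d x * Y \<mu> c x $ d) - (\<Sum>d\<in>UNIV. partial ?S e (\<Gamma> a b d) x * Y \<mu> c x $ d)"
    for \<mu> a b e
  proof -
    have diff: "(\<lambda>y. - (\<Gamma> a b d y * Y \<mu> c y $ d)) differentiable (at x within ?S)" for d
      by (intro differentiable_minus differentiable_mult dG dY)
    have "partial ?S e (partial ?S b (\<lambda>y. Y \<mu> c y $ a)) x = partial ?S e (\<lambda>y. \<Sum>d\<in>UNIV. - (\<Gamma> a b d y * Y \<mu> c y $ d)) x"
      by (rule partial_cong[OF first x])
    also have "\<dots> = (\<Sum>d\<in>UNIV. partial ?S e (\<lambda>y. - (\<Gamma> a b d y * Y \<mu> c y $ d)) x)"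
    proof -
      have "((\<lambda>y. \<Sum>d\<in>UNIV. - (\<Gamma> a b d y * Y \<mu> c y $ d)) has_derivative
          (\<lambda>h. \<Sum>d\<in>UNIV. D_on ?S (\<lambda>y. - (\<Gamma> a b d y * Y \<mu> c y $ d)) x h)) (at x within ?S)"
        by (rule has_derivative_sum[OF diff[unfolded frechet_derivative_works]])
      from D_on_eq[OF T x this] show ?thesis by (simp add: partial_def)
    qed
    also have "\<dots> = (\<Sum>d\<in>UNIV. - (\<Gamma> a b d x * partial ?S e (\<lambda>y. Y \<mu> c y $ d) x + partial ?S e (\<Gamma> a b d) x * Y \<mu> c x $ d))"
    proof (rule sum.cong[OF refl])
      fix d
      have "partial ?S e (\<lambda>y. - (\<Gamma> a b d y * Y \<mu> c y $ d)) x = - partial ?S e (\<lambda>y. \<Gamma> a b d y * Y \<mu> c y $ d) x"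
        by (rule partial_bounded_linear[OF bounded_linear_minus[OF bounded_linear_ident] T x differentiable_mult[OF dG dY]])
      also have "\<dots> = - (\<Gamma> a b d x * partial ?S e (\<lambda>y. Y \<mu> c y $ d) x + partial ?S e (\<Gamma> a b d) x * Y \<mu> c x $ d)"
        using partial_bilinear[OF bounded_bilinear_mult T x dG dY] by simp
      finally show "partial ?S e (\<lambda>y. - (\<Gamma> a b d y * Y \<mu> c y $ d)) x
        = - (\<Gamma> a b d x * partial ?S e (\<lambda>y. Y \<mu> c y $ d) x + partial ?S e (\<Gamma> a b d) x * Y \<mu> c x $ d)" .
    qed
    also have "\<dots> = (\<Sum>m\<in>UNIV. \<Sum>d\<in>UNIV. \<Gamma> a b m x * \<Gamma> m e d x * Y \<mu> c x $ d) - (\<Sum>d\<in>UNIV. partial ?S e (\<Gamma> a b d) x * Y \<mu> c x $ d)"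
      by (simp add: first[OF x] sum_negf sum.distrib sum_distrib_left mult_ac flip: sum_subtractf)
    finally show ?thesis .
  qed
  define R where "R v = (\<Sum>k\<in>UNIV. riemann g c l k i j x * v $ k)" for v
  have RY: "R (Y \<mu> c x) = 0" for \<mu>
  proof -
    have "R (Y \<mu> c x) = (\<Sum>d\<in>UNIV. partial ?S i (\<Gamma> l j d) x * Y \<mu> c x $ d) - (\<Sum>d\<in>UNIV. partial ?S j (\<Gamma> l i d) x * Y \<mu> c x $ d)
      + ((\<Sum>d\<in>UNIV. \<Sum>m\<in>UNIV. \<Gamma> l i m x * \<Gamma> m j d x * Y \<mu> c x $ d) - (\<Sum>d\<in>UNIV. \<Sum>m\<in>UNIV. \<Gamma> l j m x * \<Gamma> m i d x * Y \<mu> c x $ d))"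
      unfolding R_def riemann_def \<Gamma>_def[symmetric]
      by (simp add: sum.distrib sum_subtractf algebra_simps sum_distrib_left)
    also have "(\<Sum>d\<in>UNIV. \<Sum>m\<in>UNIV. \<Gamma> l i m x * \<Gamma> m j d x * Y \<mu> c x $ d) = (\<Sum>m\<in>UNIV. \<Sum>d\<in>UNIV. \<Gamma> l i m x * \<Gamma> m j d x * Y \<mu> c x $ d)"
      by (rule sum.swap)
    also have "(\<Sum>d\<in>UNIV. \<Sum>m\<in>UNIV. \<Gamma> l j m x * \<Gamma> m i d x * Y \<mu> c x $ d) = (\<Sum>m\<in>UNIV. \<Sum>d\<in>UNIV. \<Gamma> l j m x * \<Gamma> m i d x * Y \<mu> c x $ d)"
      by (rule sum.swap)
    finally show ?thesis using second[of i j \<mu> l] second[of j i \<mu> l] sym[of i j \<mu> l] by simp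
  qed
  have lin: "linear R"
    unfolding R_def by (intro linearI) (simp_all add: algebra_simps sum.distrib sum_distrib_left)
  have "R (axis k 1) = 0" by (rule linear_zero_on_frame[OF F lin RY])
  moreover have "R (axis k 1) = riemann g c l k i j x"
    unfolding R_def by (simp add: axis_def if_distrib[of "\<lambda>x. _ * x"] cong: if_cong)
  ultimately show ?thesis by simp
qed

section \<open>The asymptotic end\<close>

text \<open>All summands of the defining sum are nonnegative; the empty list and the one-element
  lists give the two bounds.\<close>

lemma O2_bounds:
  assumes "O2 \<beta> f"
  obtains C where "0 \<le> C"
    "\<And>x. x \<in> exterior \<Longrightarrow> \<bar>f x\<bar> \<le> C * radius x powr (- \<beta>)"
    "\<And>x i. x \<in> exterior \<Longrightarrow> \<bar>partial exterior i f x\<bar> \<le> C * radius x powr (- 1 - \<beta>)"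
proof -
  from assms obtain C where C: "C > 0" "\<And>x. x \<in> exterior \<Longrightarrow>
      (\<Sum>I | length I \<le> 2. \<bar>radius x powr (\<beta> + real (length I)) * foldr (partial exterior) I f x\<bar>) \<le> C"
    unfolding O2_def by blast
  have bd: "radius x powr (\<beta> + real (length I)) * \<bar>foldr (partial exterior) I f x\<bar> \<le> C"
    if "x \<in> exterior" "length I \<le> 2" for x I
  proof -
    have "\<bar>radius x powr (\<beta> + real (length I)) * foldr (partial exterior) I f x\<bar>
      \<le> (\<Sum>I | length I \<le> 2. \<bar>radius x powr (\<beta> + real (length I)) * foldr (partial exterior) I f x\<bar>)"
      by (rule member_le_sum) (use that finite_multi_indices in auto)
    then show ?thesis using C(2)[OF that(1)] by (simp add: abs_mult)
  qed
  have le: "a \<le> C * r powr (- \<gamma>)" if "r powr \<gamma> * a \<le> C" "r > 1" for a r \<gamma> :: real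
    using that by (simp add: powr_minus field_simps)
  have r: "radius x > 1" if "x \<in> exterior" for x :: "real^('a option)" using that by (simp add: exterior_def)
  have "\<bar>f x\<bar> \<le> C * radius x powr (- \<beta>)" if "x \<in> exterior" for x
    using le[OF _ r[OF that]] bd[OF that, of "[]"] by simp
  moreover have "\<bar>partial exterior i f x\<bar> \<le> C * radius x powr (- 1 - \<beta>)" if "x \<in> exterior" for x i
  proof -
    have eq: "- 1 - \<beta> = - (\<beta> + 1)" by simp
    show ?thesis unfolding eq
      by (rule le[OF _ r[OF that]]) (use bd[OF that, of "[i]"] in simp)
  qed
  ultimately show ?thesis using that C(1) by (meson less_imp_le)
qed

lemma O2_family_bounds:
  fixes f :: "'j::finite \<Rightarrow> real^('n::finite option) \<Rightarrow> real"
  assumes "\<And>j. O2 \<beta> (f j)"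
  obtains C where "0 \<le> C"
    "\<And>j x. x \<in> exterior \<Longrightarrow> \<bar>f j x\<bar> \<le> C * radius x powr (- \<beta>)"
    "\<And>j x i. x \<in> exterior \<Longrightarrow> \<bar>partial exterior i (f j) x\<bar> \<le> C * radius x powr (- 1 - \<beta>)"
proof -
  have "\<exists>C\<ge>0. (\<forall>x\<in>exterior. \<bar>f j x\<bar> \<le> C * radius x powr (- \<beta>)) \<and>
     (\<forall>x\<in>exterior. \<forall>i. \<bar>partial exterior i (f j) x\<bar> \<le> C * radius x powr (- 1 - \<beta>))" for j
    using O2_bounds[OF assms[of j]] by metis
  then obtain c where c: "\<And>j. c j \<ge> 0" "\<And>j x. x \<in> exterior \<Longrightarrow> \<bar>f j x\<bar> \<le> c j * radius x powr (- \<beta>)"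
     "\<And>j x i. x \<in> exterior \<Longrightarrow> \<bar>partial exterior i (f j) x\<bar> \<le> c j * radius x powr (- 1 - \<beta>)"
    by metis
  define C where "C = (\<Sum>j\<in>UNIV. c j)"
  have cC: "c j \<le> C" for j unfolding C_def by (rule member_le_sum) (use c in auto)
  have "0 \<le> C" using c(1) by (simp add: C_def sum_nonneg)
  then show ?thesis
  proof (rule that)
    show "\<bar>f j x\<bar> \<le> C * radius x powr (- \<beta>)" if "x \<in> exterior" for j x
      using c(2)[OF that, of j] mult_right_mono[OF cC[of j], of "radius x powr (- \<beta>)"] by simp
    show "\<bar>partial exterior i (f j) x\<bar> \<le> C * radius x powr (- 1 - \<beta>)" if "x \<in> exterior" for j x i
      using c(3)[OF that, of i j] mult_right_mono[OF cC[of j], of "radius x powr (- 1 - \<beta>)"] by simp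
  qed
qed

lemma norm_eta_vector:
  fixes v :: "real^('n::finite option)"
  shows "norm ((\<chi> \<mu> \<nu>. eta \<mu> \<nu>) *v v) = norm v"
proof -
  have "((\<chi> \<mu> \<nu>. eta \<mu> \<nu>) *v v) $ \<mu> = eta \<mu> \<mu> * v $ \<mu>" for \<mu>
  proof -
    have "(\<Sum>\<nu>\<in>UNIV. eta \<mu> \<nu> * v $ \<nu>) = (\<Sum>\<nu>\<in>UNIV. if \<nu> = \<mu> then eta \<mu> \<mu> * v $ \<mu> else 0)"
      by (rule sum.cong) (simp_all add: eta_def)
    also have "\<dots> = eta \<mu> \<mu> * v $ \<mu>" by simp
    finally show ?thesis by (simp add: matrix_vector_mult_def)
  qed
  moreover have "\<bar>eta \<mu> \<mu>\<bar> = 1" for \<mu> :: "'n option" by (simp add: eta_def)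
  ultimately show ?thesis by (simp add: norm_vec_def abs_mult)
qed

text \<open>The perturbation argument of \<open>lower_bound_near\<close> with an explicit threshold,
  because the region near infinity is unbounded. It serves \<open>g\<close> against \<eta> and the
  frame against the identity.\<close>

lemma half_le_of_near_isometry:
  fixes P Q :: "real^'k::finite^'k"
  assumes "\<And>v. norm (Q *v v) = norm v" "\<And>i j. \<bar>(P - Q) $ i $ j\<bar> \<le> \<mu>" "2 * (real CARD('k))\<^sup>2 * \<mu> \<le> 1"
  shows "1 / 2 * norm v \<le> norm (P *v v)"
proof -
  have "norm ((P - Q) *v v) \<le> (real CARD('k))\<^sup>2 * \<mu> * norm v" by (rule norm_matrix_vector_bound[OF assms(2)])
  also have "\<dots> \<le> 1 / 2 * norm v" using assms(3) by (intro mult_right_mono) auto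
  finally have "norm ((P - Q) *v v) \<le> 1 / 2 * norm v" .
  moreover have "Q *v v = P *v v - (P - Q) *v v" by (simp add: matrix_vector_mult_diff_rdistrib)
  then have "norm v \<le> norm (P *v v) + norm ((P - Q) *v v)"
    using norm_triangle_ineq4[of "P *v v" "(P - Q) *v v"] assms(1)[of v] by simp
  ultimately show ?thesis by simp
qed

lemma exists_large_radius:
  assumes "0 < \<beta>" "0 < (\<epsilon>::real)"
  obtains \<rho> where "1 < \<rho>" "\<And>r. \<rho> \<le> r \<Longrightarrow> r powr (- \<beta>) \<le> \<epsilon>"
proof -
  have "((\<lambda>r. r powr (- \<beta>)) \<longlongrightarrow> 0) at_top"
    by (rule tendsto_neg_powr[OF _ filterlim_ident]) (use assms in simp)
  then have "\<forall>\<^sub>F r in at_top. r powr (- \<beta>) < \<epsilon>" by (rule order_tendstoD) (rule assms)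
  then obtain \<rho> where "\<And>r. \<rho> \<le> r \<Longrightarrow> r powr (- \<beta>) < \<epsilon>" unfolding eventually_at_top_linorder by blast
  then show ?thesis by (intro that[of "max \<rho> 2"]) (auto simp: less_imp_le)
qed

lemma translation_frame_near_infinity:
  fixes g :: "real^('n::finite option) \<Rightarrow> real^('n option)^('n option)"
  assumes \<beta>: "0 < \<beta>" and g: "C_on 2 exterior g" "\<And>x. x \<in> exterior \<Longrightarrow> transpose (g x) = g x"
    and inv: "\<And>x. x \<in> exterior \<Longrightarrow> invertible (g x)"
    and Y: "\<And>\<mu>. C_on 1 exterior (Y \<mu>)" and K: "\<And>\<mu> x. x \<in> exterior \<Longrightarrow> killing_at exterior g (Y \<mu>) x"
    and Og: "\<And>\<mu> \<nu>. O2 \<beta> (\<lambda>x. g x $ \<mu> $ \<nu> - eta \<mu> \<nu>)"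
    and OY: "\<And>\<mu> \<nu>. O2 \<beta> (\<lambda>x. Y \<mu> x $ \<nu> - axis \<mu> 1 $ \<nu>)"
  obtains \<rho> where "1 < \<rho>" "\<And>x. \<rho> \<le> radius x \<Longrightarrow> translation_frame_at exterior g Y x"
proof -
  define E :: "(real^('n option)) set" where "E = exterior"
  have E: "open E" "thick E" using open_exterior open_thick unfolding E_def by blast+
  define N where "N = real CARD('n option)"
  have N1: "N \<ge> 1" unfolding N_def using one_le_card_finite[where 'a="'n option"] by linarith
  have g1: "C_on (Suc 0) E g" "C_on 1 E g" and Y1: "C_on (Suc 0) E (Y \<mu>)" for \<mu>
    using C_on_le[OF g(1), of 1] Y[of \<mu>] by (simp_all add: E_def)
  obtain Cg where Cg: "0 \<le> Cg"
    "\<And>p x. x \<in> E \<Longrightarrow> \<bar>(\<lambda>x. g x $ fst p $ snd p - eta (fst p) (snd p)) x\<bar> \<le> Cg * radius x powr (- \<beta>)"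
    "\<And>p x i. x \<in> E \<Longrightarrow> \<bar>partial E i (\<lambda>x. g x $ fst p $ snd p - eta (fst p) (snd p)) x\<bar> \<le> Cg * radius x powr (- 1 - \<beta>)"
    unfolding E_def by (rule O2_family_bounds[of \<beta> "\<lambda>p x. g x $ fst p $ snd p - eta (fst p) (snd p)", OF Og]) blast
  obtain CY where CY: "0 \<le> CY"
    "\<And>p x. x \<in> E \<Longrightarrow> \<bar>(\<lambda>x. Y (fst p) x $ snd p - axis (fst p) 1 $ snd p) x\<bar> \<le> CY * radius x powr (- \<beta>)"
    "\<And>p x i. x \<in> E \<Longrightarrow> \<bar>partial E i (\<lambda>x. Y (fst p) x $ snd p - axis (fst p) 1 $ snd p) x\<bar> \<le> CY * radius x powr (- 1 - \<beta>)"
    unfolding E_def by (rule O2_family_bounds[of \<beta> "\<lambda>p x. Y (fst p) x $ snd p - axis (fst p) 1 $ snd p", OF OY]) blast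
  have gb: "\<bar>g x $ i $ j - eta i j\<bar> \<le> Cg * radius x powr (- \<beta>)" if "x \<in> E" for i j x
    using Cg(2)[OF that, of "(i, j)"] by simp
  have Yb: "\<bar>Y \<mu> x $ j - axis \<mu> 1 $ j\<bar> \<le> CY * radius x powr (- \<beta>)" if "x \<in> E" for \<mu> j x
    using CY(2)[OF that, of "(\<mu>, j)"] by simp
  have gd: "\<bar>partial E k g x $ i $ j\<bar> \<le> Cg * radius x powr (- 1 - \<beta>)" if x: "x \<in> E" for i j k x
  proof -
    have "((\<lambda>y. g y $ i $ j - eta i j) has_derivative (\<lambda>v. D_on E g x v $ i $ j - 0)) (at x within E)"
      by (intro has_derivative_diff has_derivative_const bounded_linear.has_derivative[OF bounded_linear_vec_nth]
          has_derivative_D_on[OF g1(1) x])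
    from partial_eq[OF E(2) x this, of k] show ?thesis
      using Cg(3)[OF x, of k "(i, j)"] by (simp add: partial_def)
  qed
  have Yd: "\<bar>partial E k (Y \<mu>) x $ j\<bar> \<le> CY * radius x powr (- 1 - \<beta>)" if x: "x \<in> E" for \<mu> j k x
  proof -
    have "((\<lambda>y. Y \<mu> y $ j - axis \<mu> 1 $ j) has_derivative (\<lambda>v. D_on E (Y \<mu>) x v $ j - 0)) (at x within E)"
      by (intro has_derivative_diff has_derivative_const bounded_linear.has_derivative[OF bounded_linear_vec_nth]
          has_derivative_D_on[OF Y1 x])
    from partial_eq[OF E(2) x this, of k] show ?thesis
      using CY(3)[OF x, of k "(\<mu>, j)"] by (simp add: partial_def)
  qed
  have r1: "radius x > 1" if "x \<in> E" for x using that by (simp add: E_def exterior_def)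
  have powr_le_1: "radius x powr (- \<beta>) \<le> 1" if "x \<in> E" for x
    using powr_mono2'[of "- \<beta>" 1 "radius x"] r1[OF that] \<beta> by simp
  have norm_le: "norm v \<le> N * c" if "\<And>j. \<bar>v $ j\<bar> \<le> c" for v :: "real^('n option)" and c
    using order_trans[OF norm_le_l1_cart sum_bounded_above[of UNIV "\<lambda>j. \<bar>v $ j\<bar>" c]] that by (simp add: N_def)
  have Yn: "norm (Y \<mu> x) \<le> N * (1 + CY)" if x: "x \<in> E" for \<mu> x
  proof (rule norm_le)
    fix j
    have "CY * radius x powr (- \<beta>) \<le> CY * 1" using powr_le_1[OF x] CY(1) by (rule mult_left_mono)
    moreover have "\<bar>axis \<mu> (1::real) $ j\<bar> \<le> 1" by (simp add: axis_def)
    ultimately show "\<bar>Y \<mu> x $ j\<bar> \<le> 1 + CY" using Yb[OF x, of \<mu> j] by linarith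
  qed
  have DYn: "norm (D_on E (Y \<mu>) x v) \<le> N * (norm v * (N * (CY * radius x powr (- 1 - \<beta>))))"
    if x: "x \<in> E" for \<mu> v x
  proof -
    have "norm (D_on E (Y \<mu>) x v) \<le> (\<Sum>k\<in>UNIV. norm (v $ k *\<^sub>R partial E k (Y \<mu>) x))"
      unfolding D_on_expansion[OF Y1 x] by (rule norm_sum)
    also have "\<dots> \<le> (\<Sum>k\<in>(UNIV::'n option set). norm v * (N * (CY * radius x powr (- 1 - \<beta>))))"
      unfolding norm_scaleR
      by (intro sum_mono mult_mono norm_le Yd[OF x]) (simp_all add: component_le_norm_cart)
    finally show ?thesis by (simp add: N_def)
  qed
  define P1 where "P1 = N * (N * (1 + CY) * (N * CY))"
  define C2 where "C2 = 2 * P1"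
  have C20: "0 \<le> C2" using N1 CY(1) by (simp add: C2_def P1_def)
  \<comment> \<open>Each term of a bracket is a bounded field times a first derivative, so the decay
    rate is \<open>1 + \<beta>\<close>, the value of \<kappa> used below.\<close>
  have Zn: "norm (lie_bracket E (Y \<mu>) (Y \<nu>) x) \<le> C2 * radius x powr (- (1 + \<beta>))" if x: "x \<in> E" for \<mu> \<nu> x
  proof -
    have *: "norm (D_on E (Y \<mu>) x (Y \<nu> x)) \<le> P1 * radius x powr (- 1 - \<beta>)" for \<mu> \<nu>
    proof -
      have "norm (D_on E (Y \<mu>) x (Y \<nu> x)) \<le> N * (norm (Y \<nu> x) * (N * (CY * radius x powr (- 1 - \<beta>))))"
        by (rule DYn[OF x])
      also have "\<dots> \<le> N * ((N * (1 + CY)) * (N * (CY * radius x powr (- 1 - \<beta>))))"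
        using N1 CY(1) by (intro mult_left_mono mult_right_mono Yn[OF x]) auto
      finally show ?thesis by (simp add: P1_def mult_ac)
    qed
    have "- (1 + \<beta>) = - 1 - \<beta>" by simp
    then show ?thesis
      unfolding lie_bracket_def C2_def
      using norm_triangle_ineq4[of "D_on E (Y \<nu>) x (Y \<mu> x)" "D_on E (Y \<mu>) x (Y \<nu> x)"] *[of \<nu> \<mu>] *[of \<mu> \<nu>]
      by simp
  qed
  define C where "C = N^3 * Cg"
  have C0: "0 \<le> C" using N1 Cg(1) by (simp add: C_def)
  have Cb: "\<bar>bil (D_on E g z v) a b\<bar> \<le> C * radius z powr (- 1 - \<beta>) * norm v * norm a * norm b"
    if "z \<in> E" for z v a b
    using D_on_bil_bound[OF g1(2) that gd[OF that], of v a b] unfolding C_def N_def by (simp add: mult_ac)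
  define C3 where "C3 = N^2 * (1 + Cg)"
  have C30: "0 \<le> C3" using Cg(1) by (simp add: C3_def)
  have C3b: "\<bar>bil (g z) a b\<bar> \<le> C3 * norm a * norm b" if z: "z \<in> E" for z a b
    unfolding C3_def N_def
  proof (rule bil_bound)
    fix i j :: "'n option"
    have "Cg * radius z powr (- \<beta>) \<le> Cg * 1" using powr_le_1[OF z] Cg(1) by (rule mult_left_mono)
    moreover have "\<bar>eta i j\<bar> \<le> 1" by (simp add: eta_def)
    ultimately show "\<bar>g z $ i $ j\<bar> \<le> 1 + Cg" using gb[OF z, of i j] by linarith
  qed
  \<comment> \<open>The first entry meets the condition with the constant 80 for
    \<open>m = 1 / 2\<close>; the second is the threshold of \<open>half_le_of_near_isometry\<close>
    for \<open>g\<close> and for the frame.\<close>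
  define \<epsilon> where "\<epsilon> = min (\<beta> / (160 * (C + 1))) (1 / (2 * N^2 * (1 + Cg + CY)))"
  have \<epsilon>: "0 < \<epsilon>" using \<beta> C0 N1 Cg(1) CY(1) by (simp add: \<epsilon>_def add_pos_nonneg)
  obtain \<rho> where \<rho>: "1 < \<rho>" "\<And>r. \<rho> \<le> r \<Longrightarrow> r powr (- \<beta>) \<le> \<epsilon>" by (rule exists_large_radius[OF \<beta> \<epsilon>]) blast
  have inE: "x \<in> E" if "\<rho> \<le> radius x" for x using that \<rho>(1) by (simp add: E_def exterior_def)
  have small: "2 * N\<^sup>2 * (c * radius x powr (- \<beta>)) \<le> 1"
    if "\<rho> \<le> radius x" "0 \<le> c" "c \<le> 1 + Cg + CY" for c and x :: "real^('n option)"
  proof -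
    have pos: "0 < 1 + Cg + CY" using Cg(1) CY(1) by linarith
    have "c * radius x powr (- \<beta>) \<le> (1 + Cg + CY) * (1 / (2 * N^2 * (1 + Cg + CY)))"
      using that \<rho>(2)[OF that(1)] pos unfolding \<epsilon>_def by (intro mult_mono) auto
    also have "\<dots> = 1 / (2 * N\<^sup>2)" using pos by simp
    finally show ?thesis using N1 by (simp add: field_simps)
  qed
  have lower: "1 / 2 * norm v \<le> norm (g z *v v)" if "\<rho> \<le> radius z" for z v
  proof (rule half_le_of_near_isometry[OF norm_eta_vector])
    show "\<bar>(g z - (\<chi> \<mu> \<nu>. eta \<mu> \<nu>)) $ i $ j\<bar> \<le> Cg * radius z powr (- \<beta>)" for i j
      using gb[OF inE[OF that]] by simp
    show "2 * (real CARD('n option))\<^sup>2 * (Cg * radius z powr (- \<beta>)) \<le> 1"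
      using small[OF that, of Cg] Cg(1) CY(1) unfolding N_def by simp
  qed
  have frame: "invertible (frame_matrix Y z)" if "\<rho> \<le> radius z" for z
  proof (rule invertible_of_lower_bound[of "1 / 2"])
    show "1 / 2 * norm v \<le> norm (frame_matrix Y z *v v)" for v
    proof (rule half_le_of_near_isometry[where Q="mat 1"])
      show "\<bar>(frame_matrix Y z - mat 1) $ i $ j\<bar> \<le> CY * radius z powr (- \<beta>)" for i j
        using Yb[OF inE[OF that], of j i] by (auto simp: frame_matrix_def mat_def axis_def)
      show "2 * (real CARD('n option))\<^sup>2 * (CY * radius z powr (- \<beta>)) \<le> 1"
        using small[OF that, of CY] Cg(1) CY(1) unfolding N_def by simp
    qed simp
  qed simp
  have KE: "killing_at E g (Y \<mu>) x" if "x \<in> E" for \<mu> x using K that unfolding E_def by blast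
  have symE: "transpose (g x) = g x" and invE: "invertible (g x)" if "x \<in> E" for x using g inv that unfolding E_def by blast+
  have gE: "C_on 2 E g" and YE: "C_on 1 E (Y \<mu>)" for \<mu> using g(1) Y unfolding E_def by blast+
  have Y2: "C_on 2 E (Y \<mu>)" for \<mu>
    by (rule killing_C2[OF E(1) gE symE invE YE KE])
  have Z1: "C_on 1 E (lie_bracket E (Y \<mu>) (Y \<nu>))" for \<mu> \<nu>
  proof -
    have "C_on (Suc 1) E (Y \<mu>)" for \<mu> using Y2[of \<mu>] by (simp add: numeral_2_eq_2)
    then show ?thesis using C_on_lie_bracket[OF E(2)] by blast
  qed
  have bracket: "lie_bracket E (Y \<mu>) (Y \<nu>) y = 0" if y: "\<rho> \<le> radius y" for \<mu> \<nu> y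
  proof (rule killing_vanishes_near_infinity[where m="1 / 2" and \<kappa>="1 + \<beta>" and g=g and X="lie_bracket E (Y \<mu>) (Y \<nu>)", OF \<beta> _ _ _ _ _ C0 _ C20 _ C30])
    show "killing_at exterior g (lie_bracket E (Y \<mu>) (Y \<nu>)) x" if "x \<in> exterior" for x
      using killing_lie_bracket[OF E(1) _ gE Y2 KE Y2 KE] that unfolding E_def by blast
    have "\<rho> powr (- \<beta>) \<le> \<beta> / (160 * (C + 1))" using \<rho>(2)[of \<rho>] by (simp add: \<epsilon>_def)
    then have "80 * C * \<rho> powr (- \<beta>) \<le> 80 * C * (\<beta> / (160 * (C + 1)))" using C0 by (intro mult_left_mono) auto
    also have "\<dots> \<le> 1 / 2 * \<beta>" using C0 \<beta> by (simp add: field_simps)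
    finally show "80 * C * \<rho> powr (- \<beta>) \<le> 1 / 2 * \<beta>" .
    show "C_on 1 exterior g" "C_on 1 exterior (lie_bracket E (Y \<mu>) (Y \<nu>))" using g1 Z1 unfolding E_def by blast+
  qed (use \<beta> symE Cb Zn C3b lower \<rho>(1) y in \<open>simp_all add: E_def\<close>)
  \<comment> \<open>Each point is joined to infinity by its own radial ray, along which the product
    is constant. This also covers one space dimension, where the region has two components.\<close>
  have const: "bil (g x) (Y \<mu> x) (Y \<nu> x) = eta \<mu> \<nu>" if x: "\<rho> \<le> radius x" for \<mu> \<nu> x
  proof -
    have "spatial x \<noteq> 0" using x \<rho> by auto
    then obtain a where a: "norm a \<le> 1" "spatial a = (1 / radius x) *\<^sub>R spatial x"
      using exists_radial_direction by blast
    define R where "R = radius x"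
    have R: "R > 1" using x \<rho> by (simp add: R_def)
    define p where "p t = x + t *\<^sub>R a" for t
    have sp: "radius (p t) = R + t" if "0 \<le> t" for t
    proof -
      have "spatial (p t) = (1 + t / R) *\<^sub>R spatial x"
        by (simp add: p_def linear_add[OF linear_spatial] linear_scale[OF linear_spatial] a(2) algebra_simps R_def)
      then show ?thesis using R that by (simp add: R_def[symmetric] field_simps)
    qed
    have far: "\<rho> \<le> radius (p t)" if "0 \<le> t" for t using sp[OF that] that x by (simp add: R_def)
    define h where "h t = bil (g (p t)) (Y \<mu> (p t)) (Y \<nu> (p t))" for t
    have "\<exists>c. \<forall>t\<in>{0..}. h t = c"
    proof (rule has_derivative_zero_constant)
      fix t :: real assume t: "t \<in> {0..}"
      have pE: "p t \<in> E" using inE[OF far] t by simp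
      have "((\<lambda>y. bil (g y) (Y \<mu> y) (Y \<nu> y)) has_derivative (\<lambda>v. 0)) (at (p t) within E)"
        using t by (intro frame_products_locally_constant[OF E(2) pE g1(2) YE KE[OF pE] bracket frame] far) auto
      then have d: "((\<lambda>y. bil (g y) (Y \<mu> y) (Y \<nu> y)) has_derivative (\<lambda>v. 0)) (at (p t))"
        using at_within_open[OF pE E(1)] by simp
      have "(p has_derivative (\<lambda>h. h *\<^sub>R a)) (at t within {0..})"
        unfolding p_def[abs_def] by (auto intro!: derivative_eq_intros)
      from has_derivative_compose[OF this d]
      show "(h has_derivative (\<lambda>h. 0)) (at t within {0..})" unfolding h_def .
    qed simp
    then have h0: "h t = h 0" if "0 \<le> t" for t using that by force
    have lim0: "((\<lambda>t. c * radius (p t) powr (- \<beta>)) \<longlongrightarrow> 0) at_top" for c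
    proof -
      have "((\<lambda>t. (R + t) powr (- \<beta>)) \<longlongrightarrow> 0) at_top"
        by (rule tendsto_neg_powr) (use \<beta> in \<open>auto intro: filterlim_tendsto_add_at_top[OF tendsto_const filterlim_ident]\<close>)
      from tendsto_mult_left[OF this, of c] have "((\<lambda>t. c * (R + t) powr (- \<beta>)) \<longlongrightarrow> 0) at_top" by simp
      then show ?thesis
        by (rule Lim_transform_eventually) (auto intro!: eventually_at_top_linorderI[of 0] simp: sp)
    qed
    have lim: "(f \<longlongrightarrow> l) at_top"
      if "\<And>t. 0 \<le> t \<Longrightarrow> \<bar>f t - l\<bar> \<le> c * radius (p t) powr (- \<beta>)" for f :: "real \<Rightarrow> real" and l c
    proof -
      have "((\<lambda>t. f t - l) \<longlongrightarrow> 0) at_top"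
        by (rule Lim_null_comparison[OF _ lim0[of c]]) (use that in \<open>auto intro!: eventually_at_top_linorderI[of 0]\<close>)
      then show ?thesis using LIM_zero_cancel by blast
    qed
    have gl: "((\<lambda>t. g (p t) $ i $ j) \<longlongrightarrow> (\<chi> i j. eta i j) $ i $ j) at_top" for i j
      by (rule lim[where c=Cg]) (use gb inE far in simp)
    have Yl: "((\<lambda>t. Y \<mu> (p t) $ i) \<longlongrightarrow> axis \<mu> 1 $ i) at_top" for \<mu> i
      by (rule lim[where c=CY]) (use Yb inE far in simp)
    have "(h \<longlongrightarrow> bil (\<chi> i j. eta i j) (axis \<mu> 1) (axis \<nu> 1)) at_top"
      unfolding h_def bil_def by (intro tendsto_sum tendsto_mult gl Yl)
    then have "(h \<longlongrightarrow> eta \<mu> \<nu>) at_top" by (simp add: bil_axis)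
    moreover have "(h \<longlongrightarrow> h 0) at_top"
      by (rule tendsto_eventually) (auto intro!: eventually_at_top_linorderI[of 0] h0)
    ultimately have "h 0 = eta \<mu> \<nu>" using tendsto_unique trivial_limit_at_top_linorder by blast
    then show ?thesis by (simp add: h_def p_def)
  qed
  have "translation_frame_at exterior g Y x" if "\<rho> \<le> radius x" for x
    using const[OF that] bracket[OF that] unfolding translation_frame_at_def E_def by blast
  with \<rho>(1) that show ?thesis by blast
qed

section \<open>Change of charts\<close>

lemma coord_domain_image_of: "is_chart c \<Longrightarrow> coord_domain (image_of c)"
  unfolding is_chart_def coord_domain_def by blast

lemma open_chart_preimage:
  assumes "is_chart c" "open T"
  shows "open (fst c \<inter> snd c -` T)"
  using assms unfolding is_chart_def homeomorphism_def by (meson continuous_open_preimage)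

lemma openin_chart_image:
  assumes "is_chart c" "open U" "U \<subseteq> fst c"
  shows "openin (top_of_set (image_of c)) (snd c ` U)"
proof (rule homeomorphism_imp_open_map)
  show "homeomorphism (fst c) (image_of c) (snd c) (point_at c)" using assms(1) by (simp add: is_chart_def)
  show "openin (top_of_set (fst c)) U" using assms(2,3) by (simp add: open_subset)
qed

lemma point_at_chart:
  assumes "is_chart c"
  shows "p \<in> fst c \<Longrightarrow> point_at c (snd c p) = p"
    and "x \<in> image_of c \<Longrightarrow> point_at c x \<in> fst c"
    and "x \<in> image_of c \<Longrightarrow> snd c (point_at c x) = x"
  using assms unfolding is_chart_def homeomorphism_def by blast+

lemma bil_congruent: "bil (transpose J ** M ** J) a b = bil M (J *v a) (J *v b)"
proof -
  have "bil (transpose J ** M ** J) a b = a \<bullet> (transpose J *v (M *v (J *v b)))"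
    by (simp add: bil_eq_inner matrix_vector_mul_assoc matrix_mul_assoc)
  also have "\<dots> = (J *v a) \<bullet> (M *v (J *v b))"
    by (metis dot_lmul_matrix vector_transpose_matrix)
  finally show ?thesis by (simp add: bil_eq_inner)
qed

lemma jacobian_eq_D_on:
  assumes "C_on (Suc k) (overlap c d) (transition c d)" "x \<in> overlap c d"
  shows "jacobian c d x *v v = D_on (overlap c d) (transition c d) x v"
  unfolding D_on_expansion[OF assms]
  by (simp add: jacobian_def matrix_vector_mult_def vec_eq_iff mult.commute)

text \<open>Differentiating the relation between the fields along each other produces a second
  derivative of \<sigma>, which cancels in the bracket by symmetry.\<close>

lemma lie_bracket_natural:
  fixes X Y :: "real^'i::finite \<Rightarrow> real^'i" and \<sigma> :: "real^'i \<Rightarrow> real^'i"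
  assumes W: "open W" "z \<in> W" and \<sigma>: "C_on 2 W \<sigma>" "\<sigma> ` W \<subseteq> S"
    and X: "C_on 1 W X" "C_on 1 S X'" "\<And>y. y \<in> W \<Longrightarrow> X' (\<sigma> y) = D_on W \<sigma> y (X y)"
    and Y: "C_on 1 W Y" "C_on 1 S Y'" "\<And>y. y \<in> W \<Longrightarrow> Y' (\<sigma> y) = D_on W \<sigma> y (Y y)"
  shows "lie_bracket S X' Y' (\<sigma> z) = D_on W \<sigma> z (lie_bracket W X Y z)"
proof -
  have T: "thick W" by (rule open_thick[OF W(1)])
  have \<sigma>2: "C_on (Suc (Suc 0)) W \<sigma>" using \<sigma>(1) by (simp only: numeral_2_eq_2)
  have \<sigma>1: "C_on (Suc 0) W \<sigma>" by (rule C_on_Suc_imp[OF \<sigma>2])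
  have d: "D_on S P' (\<sigma> z) (D_on W \<sigma> z v)
      = D_on W (\<lambda>y. D_on W \<sigma> y (P z)) z v + D_on W \<sigma> z (D_on W P z v)"
    if P: "C_on 1 W P" "C_on 1 S P'" "\<And>y. y \<in> W \<Longrightarrow> P' (\<sigma> y) = D_on W \<sigma> y (P y)" for P P' v
  proof -
    have P1: "C_on (Suc 0) W P" "C_on (Suc 0) S P'" using P(1,2) by simp_all
    \<comment> \<open>The target \<open>S\<close> may have a boundary. The chain rule within the
      image of \<open>W\<close> avoids showing that interior points go to interior points.\<close>
    have "(P' has_derivative D_on S P' (\<sigma> z)) (at (\<sigma> z) within \<sigma> ` W)"
      by (rule has_derivative_subset[OF has_derivative_D_on[OF P1(2)] \<sigma>(2)]) (use \<sigma>(2) W in blast)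
    from has_derivative_in_compose[OF has_derivative_D_on[OF \<sigma>1 W(2)] this]
    have c: "((\<lambda>y. P' (\<sigma> y)) has_derivative (\<lambda>v. D_on S P' (\<sigma> z) (D_on W \<sigma> z v))) (at z within W)" .
    have "((\<lambda>y. P' (\<sigma> y)) has_derivative
      (\<lambda>v. D_on W (\<lambda>y. D_on W \<sigma> y (P z)) z v + D_on W \<sigma> z (D_on W P z v))) (at z within W)"
      by (rule has_derivative_transform[OF W(2) P(3)
            has_derivative_D_on_app[OF T W(2) \<sigma>2 has_derivative_D_on[OF P1(1) W(2)]]])
    from D_on_eq[OF T W(2) c] D_on_eq[OF T W(2) this] show ?thesis by (simp add: fun_eq_iff)
  qed
  have "lie_bracket S X' Y' (\<sigma> z) = D_on S Y' (\<sigma> z) (D_on W \<sigma> z (X z)) - D_on S X' (\<sigma> z) (D_on W \<sigma> z (Y z))"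
    unfolding lie_bracket_def X(3)[OF W(2)] Y(3)[OF W(2)] ..
  also have "\<dots> = D_on W \<sigma> z (D_on W Y z (X z)) - D_on W \<sigma> z (D_on W X z (Y z))"
    using d[where P=X and P'=X', OF X, of "Y z"] d[where P=Y and P'=Y', OF Y, of "X z"]
      symmetric_second_derivative[OF W \<sigma>(1), of "Y z" "X z"] by simp
  also have "\<dots> = D_on W \<sigma> z (lie_bracket W X Y z)"
    unfolding lie_bracket_def using linear_diff[OF linear_D_on[OF \<sigma>1 W(2)]] by simp
  finally show ?thesis .
qed

lemma coord_domain_subset_closure_interior:
  assumes "coord_domain V" "z \<in> V"
  shows "z \<in> closure (interior V)"
proof -
  obtain \<delta> W where W: "(0::real) < \<delta>" "open W" "W \<subseteq> V \<inter> ball z \<delta>" "V \<inter> ball z \<delta> \<subseteq> closure W"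
    by (rule coord_domain_nbhd[OF assms, of 1]) auto
  have "W \<subseteq> interior V" using W by (intro interior_maximal) auto
  then have "closure W \<subseteq> closure (interior V)" by (rule closure_mono)
  then show ?thesis using W assms(2) by auto
qed

abbreviation translation_frame_in ::
    "('m, 'n::finite option) bilinear_field \<Rightarrow> ('n option \<Rightarrow> ('m, 'n option) vector_field) \<Rightarrow>
      ('m, 'n option) chart \<Rightarrow> real^('n option) \<Rightarrow> bool" where
  "translation_frame_in g Y c \<equiv> translation_frame_at (image_of c) (g c) (\<lambda>\<mu>. Y \<mu> c)"

text \<open>Orthonormality follows pointwise from the transformation laws. Brackets transform by
  \<open>lie_bracket_natural\<close> at interior points, and continuity adds the boundary.\<close>

lemma translation_frame_transfer:
  fixes g :: "('m::topological_space, 'n::finite option) bilinear_field"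
  assumes A: "manifold_structure A" and g: "lorentzian_metric 2 A g" and Y: "\<And>\<mu>. vector_field_on 1 A (Y \<mu>)"
    and c: "c \<in> A" and d: "d \<in> A" and U: "open U" "U \<subseteq> fst c" "U \<subseteq> fst d"
    and hold: "\<And>p. p \<in> U \<Longrightarrow> translation_frame_in g Y c (snd c p)"
    and q: "q \<in> U"
  shows "translation_frame_in g Y d (snd d q)"
proof -
  have charts: "is_chart c" "is_chart d" and compat: "compatible d c"
    using A c d unfolding manifold_structure_def by blast+
  define V where "V = snd d ` U"
  define \<sigma> where "\<sigma> = transition d c"
  have V: "openin (top_of_set (image_of d)) V" unfolding V_def by (rule openin_chart_image[OF charts(2) U(1,3)])
  have VS: "V \<subseteq> image_of d" using V openin_imp_subset by blast
  have Vo: "V \<subseteq> overlap d c" using U by (auto simp: V_def overlap_def)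
  have cdV: "coord_domain V" by (rule coord_domain_openin[OF coord_domain_image_of[OF charts(2)] V])
  have Td: "thick (image_of d)" by (rule coord_domain_thick[OF coord_domain_image_of[OF charts(2)]])
  have \<sigma>U: "\<exists>p\<in>U. \<sigma> z = snd c p" if zV: "z \<in> V" for z
  proof -
    obtain p where p: "p \<in> U" "z = snd d p" using zV by (auto simp: V_def)
    then have "point_at d z = p" using point_at_chart(1)[OF charts(2)] U(3) by blast
    then show ?thesis using p by (auto simp: \<sigma>_def transition_def)
  qed
  have \<sigma>S: "\<sigma> z \<in> image_of c" and hold\<sigma>: "translation_frame_in g Y c (\<sigma> z)" if "z \<in> V" for z
    using \<sigma>U[OF that] U(2) hold by (auto simp: image_of_def)
  have gfield: "bilinear_field_on 2 A g" using g by (simp add: lorentzian_metric_def)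
  have glaw: "g d z = transpose (jacobian d c z) ** g c (\<sigma> z) ** jacobian d c z" if "z \<in> V" for z
    using gfield c d Vo that unfolding bilinear_field_on_def \<sigma>_def by blast
  have Ylaw: "Y \<mu> c (\<sigma> z) = jacobian d c z *v Y \<mu> d z" if "z \<in> V" for z \<mu>
    using Y[of \<mu>] c d Vo that unfolding vector_field_on_def \<sigma>_def by blast
  have YC: "C_on 1 (image_of b) (Y \<mu> b)" if "b \<in> A" for \<mu> b
    using Y[of \<mu>] that unfolding vector_field_on_def by blast
  have prod: "bil (g d z) (Y \<mu> d z) (Y \<nu> d z) = eta \<mu> \<nu>" if "z \<in> V" for z \<mu> \<nu>
    using hold\<sigma>[OF that] unfolding glaw[OF that] bil_congruent Ylaw[OF that, symmetric] translation_frame_at_def by blast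
  have bracket_int: "lie_bracket (image_of d) (Y \<mu> d) (Y \<nu> d) z = 0" if z: "z \<in> interior V" for z \<mu> \<nu>
  proof -
    define W where "W = interior V"
    have W: "open W" "z \<in> W" "W \<subseteq> V" "W \<subseteq> image_of d" "W \<subseteq> overlap d c"
      using z VS Vo interior_subset by (auto simp: W_def)
    have \<sigma>3: "C_on 3 (overlap d c) \<sigma>" using compat unfolding compatible_def \<sigma>_def by blast
    then have \<sigma>3': "C_on (Suc 2) (overlap d c) \<sigma>" by (simp add: eval_nat_numeral)
    have \<sigma>2: "C_on 2 W \<sigma>"
      by (rule C_on_open_subset[OF C_on_le[OF \<sigma>3] W(1,5)]) simp
    have J: "jacobian d c y *v v = D_on W \<sigma> y v" if "y \<in> W" for y v
      using jacobian_eq_D_on[OF \<sigma>3'[unfolded \<sigma>_def], of y v] that W(5)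
      unfolding D_on_open_subset[OF W(1,5) that] \<sigma>_def by blast
    have YW: "C_on 1 W (Y \<mu> d)" for \<mu> by (rule C_on_open_subset[OF YC[OF d] W(1,4)])
    have law: "Y \<mu> c (\<sigma> y) = D_on W \<sigma> y (Y \<mu> d y)" if "y \<in> W" for \<mu> y
      using Ylaw[of y \<mu>] J[OF that] that W(3) by auto
    have "D_on W \<sigma> z (lie_bracket W (Y \<mu> d) (Y \<nu> d) z) = lie_bracket (image_of c) (Y \<mu> c) (Y \<nu> c) (\<sigma> z)"
      by (rule lie_bracket_natural[symmetric, OF W(1,2) \<sigma>2 _ YW YC[OF c] law YW YC[OF c] law])
        (use \<sigma>S W(3) in auto)
    also have "\<dots> = 0" using hold\<sigma> W(2,3) unfolding translation_frame_at_def by blast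
    finally have zero: "jacobian d c z *v lie_bracket W (Y \<mu> d) (Y \<nu> d) z = 0" by (simp add: J[OF W(2)])
    \<comment> \<open>Invertibility of the Jacobian comes from the metric: both sides of the
      transformation law have nonzero determinant.\<close>
    have "invertible (g d z)"
      using g d W(2,4) invertible_of_congruent_eta(1) unfolding lorentzian_metric_def by blast
    then have "invertible (jacobian d c z)"
      using glaw[of z] W(2,3) by (auto simp: invertible_det_nz det_mul)
    then have "lie_bracket W (Y \<mu> d) (Y \<nu> d) z = 0"
      using zero by (metis invertible_def matrix_left_invertible_ker)
    then show ?thesis using lie_bracket_open_subset[OF W(1,4,2)] by simp
  qed
  have bracket: "lie_bracket (image_of d) (Y \<mu> d) (Y \<nu> d) z = 0" if z: "z \<in> V" for z \<mu> \<nu>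
  proof (rule constant_on_closure_within[OF _ _ bracket_int])
    have "C_on (Suc 0) (image_of d) (Y \<mu> d)" for \<mu> using YC[OF d, of \<mu>] by simp
    then show "continuous_on (image_of d) (lie_bracket (image_of d) (Y \<mu> d) (Y \<nu> d))"
      by (intro C_on_imp_continuous_on[OF C_on_lie_bracket[OF Td]])
    show "interior V \<subseteq> image_of d" using VS interior_subset by blast
    show "z \<in> image_of d" using z VS by blast
    show "z \<in> closure (interior V)" by (rule coord_domain_subset_closure_interior[OF cdV z])
  qed
  have "snd d q \<in> V" using q by (simp add: V_def)
  then show ?thesis using prod bracket unfolding translation_frame_at_def by blast
qed

section \<open>The open and closed set of points with a translation frame\<close>

theorem theorem1p6:
  fixes A :: "('m::{t2_space,second_countable_topology}, 'n::finite option) chart set"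
    and g :: "('m, 'n option) bilinear_field"
    and Y :: "'n option \<Rightarrow> ('m, 'n option) vector_field"
    and e :: "('m, 'n option) chart"
    and \<beta> :: real
  assumes "manifold_structure A"
    and "connected (UNIV :: 'm set)"
    and "lorentzian_metric 2 A g"
    and "\<beta> > 0"
    and "asymptotically_flat \<beta> A g e"
    and "\<forall>\<mu>. killing_field A g (Y \<mu>)"
    and "asymptotic_to_translations \<beta> e Y"
  shows "lorentzian_orthonormal_frame A g Y \<and> (\<forall>\<mu>. covariant_constant A g (Y \<mu>)) \<and> flat A g"
proof -
  have chart: "is_chart c" if "c \<in> A" for c
    using assms(1) that unfolding manifold_structure_def by blast
  have dom: "coord_domain (image_of c)" and T: "thick (image_of c)" if "c \<in> A" for c
    using coord_domain_image_of[OF chart[OF that]] coord_domain_thick by blast+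
  have Yfield: "vector_field_on 1 A (Y \<mu>)" for \<mu>
    using assms(6) unfolding killing_field_def by blast
  have gC: "C_on 2 (image_of c) (g c)" if "c \<in> A" for c
    using assms(3) that unfolding lorentzian_metric_def bilinear_field_on_def by blast
  have gC1: "C_on 1 (image_of c) (g c)" if "c \<in> A" for c
    by (rule C_on_le[OF gC[OF that]]) simp
  have sym: "transpose (g c x) = g c x" if "c \<in> A" "x \<in> image_of c" for c x
    using assms(3) that unfolding lorentzian_metric_def by blast
  have inv: "invertible (g c x)" if "c \<in> A" "x \<in> image_of c" for c x
    using assms(3) that invertible_of_congruent_eta(1) unfolding lorentzian_metric_def by blast
  have YC: "C_on 1 (image_of c) (Y \<mu> c)" if "c \<in> A" for c \<mu>
    using Yfield[of \<mu>] that unfolding vector_field_on_def by blast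
  have K: "killing_at (image_of c) (g c) (Y \<mu> c) x" if "c \<in> A" "x \<in> image_of c" for c \<mu> x
    by (rule killing_at_iff_lie_derivative[where X="Y \<mu>" and g=g and c=c, OF T[OF that(1)] that(2) gC1[OF that(1)] YC[OF that(1)]])
      (use assms(6) that in \<open>unfold killing_field_def, blast\<close>)
  define hold where "hold c = translation_frame_in g Y c" for c
  have transfer: "hold d (snd d q)"
    if "c \<in> A" "d \<in> A" "open U" "U \<subseteq> fst c" "U \<subseteq> fst d" "\<And>p. p \<in> U \<Longrightarrow> hold c (snd c p)" "q \<in> U" for c d U q
    using translation_frame_transfer[where Y=Y, OF assms(1,3) Yfield that(1-5) _ that(7)] that(6) unfolding hold_def by blast
  \<comment> \<open>Asking for one chart and a whole neighbourhood makes openness immediate;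
    \<open>transfer\<close> then gives the property in every other chart around the point.\<close>
  define \<Omega> where "\<Omega> = {p. \<exists>c\<in>A. \<exists>U. open U \<and> p \<in> U \<and> U \<subseteq> fst c \<and> (\<forall>q\<in>U. hold c (snd c q))}"
  have "open \<Omega>"
    by (subst open_subopen) (unfold \<Omega>_def, blast)
  have ne: "\<Omega> \<noteq> {}"
  proof -
    have e: "e \<in> A" "image_of e = exterior" using assms(5) unfolding asymptotically_flat_def by blast+
    obtain \<rho> where \<rho>: "1 < \<rho>" "\<And>x. \<rho> \<le> radius x \<Longrightarrow> translation_frame_at exterior (g e) (\<lambda>\<mu>. Y \<mu> e) x"
    proof (rule translation_frame_near_infinity[OF assms(4), of "g e" "\<lambda>\<mu>. Y \<mu> e"])
      show "O2 \<beta> (\<lambda>x. g e x $ \<mu> $ \<nu> - eta \<mu> \<nu>)" for \<mu> \<nu> using assms(5) unfolding asymptotically_flat_def by blast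
      show "O2 \<beta> (\<lambda>x. Y \<mu> e x $ \<nu> - axis \<mu> 1 $ \<nu>)" for \<mu> \<nu> using assms(7) unfolding asymptotic_to_translations_def by blast
    qed (use gC[OF e(1)] sym[OF e(1)] inv[OF e(1)] YC[OF e(1)] K[OF e(1)] in \<open>simp_all add: e(2)\<close>)
    define U where "U = fst e \<inter> snd e -` {x. \<rho> < radius x}"
    have "open {x :: real^('n option). \<rho> < radius x}"
      by (intro open_Collect_less continuous_intros continuous_on_spatial)
    then have U: "open U" unfolding U_def by (rule open_chart_preimage[OF chart[OF e(1)]])
    have holdU: "hold e (snd e q)" if "q \<in> U" for q
      using \<rho>(2)[of "snd e q"] that unfolding hold_def e(2) U_def by simp
    \<comment> \<open>Each spatial coordinate exceeds \<rho>, hence so does the radius;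
      \<open>undefined\<close> below merely names some spatial index.\<close>
    define x :: "real^('n option)" where "x = (\<chi> i. case i of None \<Rightarrow> 0 | Some j \<Rightarrow> \<rho> + 1)"
    have "\<rho> + 1 \<le> radius x"
      using component_le_norm_cart[of "spatial x" undefined] \<rho>(1) by (simp add: spatial_def x_def)
    then have far: "\<rho> < radius x" "x \<in> image_of e" using \<rho>(1) by (simp_all add: e(2) exterior_def)
    then have "point_at e x \<in> U"
      unfolding U_def using point_at_chart(2,3)[OF chart[OF e(1)] far(2)] by simp
    then have "point_at e x \<in> \<Omega>" unfolding \<Omega>_def using e(1) U holdU unfolding U_def by blast
    then show ?thesis by blast
  qed
  have "closure \<Omega> \<subseteq> \<Omega>"
  proof
    fix p assume p: "p \<in> closure \<Omega>"
    obtain c where c: "c \<in> A" "p \<in> fst c" using assms(1) unfolding manifold_structure_def by blast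
    have x0: "snd c p \<in> image_of c" using c by (simp add: image_of_def)
    obtain \<delta> where \<delta>: "0 < \<delta>" "\<And>x. x \<in> image_of c \<inter> ball (snd c p) \<delta> \<Longrightarrow> hold c x"
      unfolding hold_def
    proof (rule translation_frame_propagates[OF dom[OF c(1)] gC[OF c(1)] sym[OF c(1)] inv[OF c(1)], of "\<lambda>\<mu>. Y \<mu> c" "snd c p"])
      fix \<delta> :: real assume \<delta>: "0 < \<delta>"
      define Q where "Q = fst c \<inter> snd c -` ball (snd c p) \<delta>"
      have Q: "open Q" "p \<in> Q" unfolding Q_def using open_chart_preimage[OF chart[OF c(1)]] c(2) \<delta> by auto
      \<comment> \<open>The point of \<Omega> near \<open>p\<close> comes with its own chart; its
        neighbourhood is cut down to the domain of \<open>c\<close> before transfer.\<close>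
      then obtain q where q: "q \<in> \<Omega>" "q \<in> Q" using p open_Int_closure_eq_empty[of Q \<Omega>] by blast
      then obtain c' U where U: "c' \<in> A" "open U" "q \<in> U" "U \<subseteq> fst c'" "\<And>q. q \<in> U \<Longrightarrow> hold c' (snd c' q)"
        unfolding \<Omega>_def by blast
      have UQ: "open (U \<inter> Q)" "U \<inter> Q \<subseteq> fst c" "U \<inter> Q \<subseteq> fst c'" using U Q by (auto simp: Q_def)
      have "\<forall>x\<in>snd c ` (U \<inter> Q). hold c x"
        using transfer[OF U(1) c(1) UQ(1,3,2)] U(5) by blast
      moreover have "openin (top_of_set (image_of c)) (snd c ` (U \<inter> Q))"
        by (rule openin_chart_image[OF chart[OF c(1)] UQ(1,2)])
      moreover have "snd c ` (U \<inter> Q) \<noteq> {}" using U(3) q(2) by blast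
      moreover have "snd c ` (U \<inter> Q) \<subseteq> ball (snd c p) \<delta>" by (auto simp: Q_def)
      ultimately show "\<exists>V. openin (top_of_set (image_of c)) V \<and> V \<noteq> {} \<and> V \<subseteq> ball (snd c p) \<delta> \<and>
          (\<forall>x\<in>V. translation_frame_in g Y c x)"
        unfolding hold_def by blast
    qed (use YC[OF c(1)] K[OF c(1)] x0 in auto)
    define U where "U = fst c \<inter> snd c -` ball (snd c p) \<delta>"
    have "open U" "p \<in> U" unfolding U_def using open_chart_preimage[OF chart[OF c(1)]] c(2) \<delta>(1) by auto
    moreover have "hold c (snd c q)" if "q \<in> U" for q
      using that by (intro \<delta>(2)) (auto simp: U_def image_of_def)
    ultimately show "p \<in> \<Omega>" unfolding \<Omega>_def using c(1) unfolding U_def by blast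
  qed
  then have "closed \<Omega>" by (simp add: closure_subset_eq)
  with \<open>open \<Omega>\<close> ne assms(2) have \<Omega>: "\<Omega> = UNIV"
    unfolding connected_clopen by (metis subtopology_UNIV open_openin closed_closedin)
  have hold: "hold c x" if c: "c \<in> A" and x: "x \<in> image_of c" for c x
  proof -
    have p: "point_at c x \<in> fst c" "snd c (point_at c x) = x"
      using point_at_chart(2,3)[OF chart[OF c] x] by blast+
    have "point_at c x \<in> \<Omega>" using \<Omega> by simp
    then obtain c' U where U: "c' \<in> A" "open U" "point_at c x \<in> U" "U \<subseteq> fst c'" "\<And>q. q \<in> U \<Longrightarrow> hold c' (snd c' q)"
      unfolding \<Omega>_def by blast
    have "open (U \<inter> fst c)" using U(2) chart[OF c] by (auto simp: is_chart_def)
    then have "hold c (snd c (point_at c x))"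
      by (rule transfer[OF U(1) c]) (use U p in auto)
    then show ?thesis using p by simp
  qed
  have prod: "bil (g c x) (Y \<mu> c x) (Y \<nu> c x) = eta \<mu> \<nu>" and bracket: "lie_bracket (image_of c) (Y \<mu> c) (Y \<nu> c) x = 0"
    if "c \<in> A" "x \<in> image_of c" for c x \<mu> \<nu>
    using hold[OF that] unfolding hold_def translation_frame_at_def by blast+
  have frame: "invertible (frame_matrix (\<lambda>\<mu>. Y \<mu> c) x)" if "c \<in> A" "x \<in> image_of c" for c x
    by (rule orthonormal_imp_invertible[of "g c"]) (rule prod[OF that])
  have cov: "covariant_derivative g (Y \<mu>) c i k x = 0" if c: "c \<in> A" and x: "x \<in> image_of c" for c x \<mu> i k
    by (rule covariant_derivative_translation_frame[where Y=Y and g=g and c=c, OF T[OF c] x gC1[OF c] sym[OF c] inv[OF c x] YC[OF c] K[OF c x]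
          bracket[OF c x] frame[OF c x]])
  \<comment> \<open>For a \<open>C\<^sup>2\<close> metric the curvature is continuous up to the
    boundary, so vanishing on the interior of the chart image suffices.\<close>
  have "riemann g c l k i j x = 0" if c: "c \<in> A" and x: "x \<in> image_of c" for c x l k i j
  proof (rule constant_on_closure_within[OF continuous_on_riemann[where g=g and c=c, OF T[OF c] gC[OF c] inv[OF c]] interior_subset _ x])
    show "riemann g c l k i j y = 0" if y: "y \<in> interior (image_of c)" for y
      using y interior_subset
      by (intro riemann_zero_interior[where Y=Y and g=g and c=c and W="interior (image_of c)", OF T[OF c] gC[OF c] inv[OF c] YC[OF c] cov[OF c] frame[OF c]]) auto
    show "x \<in> closure (interior (image_of c))"
      by (rule coord_domain_subset_closure_interior[OF dom[OF c] x])
  qed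
  then show ?thesis
    unfolding lorentzian_orthonormal_frame_def covariant_constant_def flat_def inner_at_def bil_def[symmetric]
    using prod cov by blast
qed

end
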